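(* Let $\varepsilon>0$ be a fixed constant and $r\geq 3$. Let $H$ be an $n$-vertex $r$-uniform hypergraph such that for every $v\in V(H)$ there exist at least $(\frac{1}{2}+\varepsilon)n$ vertices $u$ with codegree $d_H(u,v)\geq \varepsilon n^{r-2}$. Then with high probability $\tau_2(H)=\tau_{\mathcal{BH}}(H)$.
   Context: An $r$-uniform hypergraph ($r$-graph) has edges that are $r$-element subsets of its vertex set. For $S\subseteq V(H)$, $d_H(S)$ is the number of edges containing $S$; $d_H(u,v)=d_H(\{u,v\})$ is the codegree. The random subgraph process $(H_t)_{t=0}^{|E(H)|}$ on $H$ is obtained by choosing an ordering $\sigma$ of $E(H)$ uniformly at random among all $|E(H)|!$ orderings and letting $H_t$ be the hypergraph on $V(H)$ with edge set $\{\sigma(1),\dots,\sigma(t)\}$. For a property $\mathcal{P}$, the hitting time $\tau_{\mathcal{P}}(H)$ is the smallest $t$ with $H_t\in\mathcal{P}$; $\tau_2(H)$ is the hitting time of having minimum degree at least $2$, and $\tau_{\mathcal{BH}}(H)$ is the hitting time of containing a Berge Hamilton cycle. A Berge cycle is a sequence $(v_1,e_1,v_2,e_2,\dots,v_k,e_k,v_{k+1})$ with $v_1,\dots,v_k$ distinct vertices, $v_{k+1}=v_1$, $e_1,\dots,e_k$ distinct edges, and $v_i,v_{i+1}\in e_i$ for all $i$; it is a Berge Hamilton cycle if $\{v_1,\dots,v_k\}=V(H)$. "With high probability" means with probability tending to $1$ as $n\to\infty$. *)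

theory Defs
  imports "HOL-Probability.Probability" "HOL-Combinatorics.Multiset_Permutations"
    "HOL-Library.Extended_Nat"
begin

text \<open>A hypergraph is given by its vertex set \<open>V\<close> and its edge set \<open>E\<close>.\<close>

definition uniform_hypergraph :: "nat \<Rightarrow> 'a set \<Rightarrow> 'a set set \<Rightarrow> bool" where
  "uniform_hypergraph r V E \<longleftrightarrow> finite V \<and> (\<forall>e\<in>E. e \<subseteq> V \<and> card e = r)"

definition degree :: "'a set set \<Rightarrow> 'a set \<Rightarrow> nat" where
  "degree E S = card {e \<in> E. S \<subseteq> e}"

definition codegree :: "'a set set \<Rightarrow> 'a \<Rightarrow> 'a \<Rightarrow> nat" where
  "codegree E u v = degree E {u, v}"

definition min_degree_at_least :: "nat \<Rightarrow> 'a set \<Rightarrow> 'a set set \<Rightarrow> bool" where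
  "min_degree_at_least k V E \<longleftrightarrow> (\<forall>v\<in>V. k \<le> degree E {v})"

text \<open>
  The cycle \<open>(v_1, e_1, \<dots>, v_k, e_k, v_{k+1})\<close> is given by the list \<open>vs\<close> of its \<open>k + 1\<close>
  vertices and the list \<open>es\<close> of its \<open>k\<close> edges; thus \<open>butlast vs\<close> is \<open>v_1, \<dots>, v_k\<close>.
\<close>

definition berge_cycle :: "'a set \<Rightarrow> 'a set set \<Rightarrow> 'a list \<Rightarrow> 'a set list \<Rightarrow> bool" where
  "berge_cycle V E vs es \<longleftrightarrow>
     es \<noteq> [] \<and> length vs = Suc (length es) \<and>
     set vs \<subseteq> V \<and> set es \<subseteq> E \<and>
     distinct (butlast vs) \<and> last vs = hd vs \<and> distinct es \<and>
     (\<forall>i<length es. vs ! i \<in> es ! i \<and> vs ! Suc i \<in> es ! i)"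

definition has_berge_hamilton_cycle :: "'a set \<Rightarrow> 'a set set \<Rightarrow> bool" where
  "has_berge_hamilton_cycle V E \<longleftrightarrow>
     (\<exists>vs es. berge_cycle V E vs es \<and> set (butlast vs) = V)"

text \<open>
  An ordering of the edge set is a list \<open>\<sigma>\<close> enumerating it without repetition; \<open>process_edges \<sigma> t\<close>
  is the edge set of \<open>H_t\<close>.
\<close>

definition random_ordering :: "'a set set \<Rightarrow> 'a set list pmf" where
  "random_ordering E = pmf_of_set (permutations_of_set E)"

definition process_edges :: "'a set list \<Rightarrow> nat \<Rightarrow> 'a set set" where
  "process_edges \<sigma> t = set (take t \<sigma>)"

text \<open>The value is \<open>\<infinity>\<close> if no \<open>H_t\<close> has the property.\<close>

definition hitting_time ::
    "('a set \<Rightarrow> 'a set set \<Rightarrow> bool) \<Rightarrow> 'a set \<Rightarrow> 'a set list \<Rightarrow> enat" where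
  "hitting_time P V \<sigma> = Inf (enat ` {t. t \<le> length \<sigma> \<and> P V (process_edges \<sigma> t)})"

end

theory Submission
  imports Defs "HOL-Real_Asymp.Real_Asymp"
begin

text \<open>
  The random ordering is obtained by sorting a uniformly random one according to independent random
  sets of hyperedges \<open>x0, xa, xb, x1\<close>, with rates such that the hitting time of minimum degree two
  lies, with high probability, between \<open>x0 \<union> xa \<union> xb\<close> (which leaves some vertex isolated) and
  \<open>x0 \<union> xa \<union> xb \<union> x1\<close>. All relevant events then have product probabilities.

  Vertices of small degree in \<open>x0\<close> are pairwise far apart. By Hall's theorem the other vertices
  choose many pairwise distinct hyperedges of \<open>x0\<close>, each of which is replaced by a pair of its
  vertices. Together with two hyperedges at every small vertex this gives a sparse expander. Take a
  longest path in it, allowing few additional hyperedges. By Posa's lemma linearly many vertices \<open>v\<close>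
  are ends of such paths on the same vertex set \<open>U\<close>, and each has linearly many opposite ends. Rotating
  with the hyperedges of \<open>xa\<close> raises the number of opposite ends of \<open>v\<close> above \<open>n / 2\<close>, so that the
  Dirac condition gives quadratically many pairs \<open>{v, y}\<close> closing a cycle on \<open>U\<close>; a hyperedge of \<open>xb\<close>
  contains one of them, and the cycle is Hamiltonian or extends to a longer path. The union bound over
  the additional hyperedges is affordable as there are only \<open>O(n)\<close> of them, while each failure has
  probability \<open>exp (- c n log n)\<close>.
\<close>

section \<open>Paths and rotations\<close>

text \<open>Two obstacles shape the argument. First, a vertex sees about \<open>ln n\<close>
  hyperedges, so expansion up to linear size is obtained by letting each vertex own order
  \<open>ln n\<close> of them. Enumerating all owned hyperedges in a union bound would cost a factor
  of the same exponential order as the failure probability. They are therefore a fixed function of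
  \<open>x0\<close>, and only what is added to them is enumerated: two hyperedges for each small
  vertex and at most three for each lengthening of the path. Revealing \<open>x0\<close> determines
  what \<open>xa\<close> has to hit, and \<open>x0\<close> with \<open>xa\<close> determines what
  \<open>xb\<close> has to hit; this is the reason for separate rounds. Second, vertex degrees may
  differ by constant factors, so the critical rate has no formula. It is defined implicitly, by
  requiring that the expected number of vertices isolated by the first three sets is a small power
  of \<open>n\<close>. The same sum then controls the small vertices: summed over one of them it is
  nearly constant, while a second one nearby costs a fixed negative power of \<open>n\<close>. The
  rates of \<open>xa\<close> and \<open>xb\<close> are a small multiple of that of
  \<open>x0\<close>, so that they barely affect the sum.\<close>

fun adjacent_in :: "'a list \<Rightarrow> 'a \<Rightarrow> 'a \<Rightarrow> bool" where
  "adjacent_in [] x y \<longleftrightarrow> False"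
| "adjacent_in [a] x y \<longleftrightarrow> False"
| "adjacent_in (a # b # l) x y \<longleftrightarrow> x = a \<and> y = b \<or> adjacent_in (b # l) x y"

lemma adjacent_in_mem: "adjacent_in l x y \<Longrightarrow> x \<in> set l \<and> y \<in> set l"
  by (induction l x y rule: adjacent_in.induct) auto

lemma adjacent_in_append:
  "adjacent_in (as @ bs) x y \<longleftrightarrow>
     adjacent_in as x y \<or> adjacent_in bs x y \<or> as \<noteq> [] \<and> bs \<noteq> [] \<and> x = last as \<and> y = hd bs"
proof (induction as x y rule: adjacent_in.induct)
  case (2 a x y) then show ?case by (cases bs) auto
qed auto

lemma adjacent_in_rev: "adjacent_in (rev l) x y \<longleftrightarrow> adjacent_in l y x"
proof (induction l y x rule: adjacent_in.induct)
  case (3 a b l x y)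
  have "adjacent_in (rev (a # b # l)) y x = adjacent_in (rev (b # l) @ [a]) y x" by simp
  also have "\<dots> \<longleftrightarrow> adjacent_in (rev (b # l)) y x \<or> y = b \<and> x = a"
    by (subst adjacent_in_append) (simp add: last_rev)
  finally show ?case using 3 by auto
qed auto

lemma adjacent_in_nth: "Suc i < length l \<Longrightarrow> adjacent_in l (l ! i) (l ! Suc i)"
proof (induction l arbitrary: i)
  case (Cons a l) then show ?case by (cases i; cases l) auto
qed auto

lemma adjacent_in_nthD:
  "adjacent_in l x y \<Longrightarrow> \<exists>i. Suc i < length l \<and> x = l ! i \<and> y = l ! Suc i"
proof (induction l x y rule: adjacent_in.induct)
  case (3 a b l x y)
  show ?case
  proof (cases "x = a \<and> y = b")
    case True then show ?thesis by (intro exI[of _ 0]) auto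
  next
    case False
    then obtain i where "Suc i < length (b # l)" "x = (b # l) ! i" "y = (b # l) ! Suc i"
      using 3 by auto
    then show ?thesis by (intro exI[of _ "Suc i"]) auto
  qed
qed auto

lemma adjacent_in_unique_succ:
  "distinct l \<Longrightarrow> adjacent_in l x y \<Longrightarrow> adjacent_in l x z \<Longrightarrow> y = z"
  using adjacent_in_nthD[of l x y] adjacent_in_nthD[of l x z] nth_eq_iff_index_eq[of l] by force

lemma adjacent_in_unique_pred:
  "distinct l \<Longrightarrow> adjacent_in l x z \<Longrightarrow> adjacent_in l y z \<Longrightarrow> x = y"
  using adjacent_in_nthD[of l x z] adjacent_in_nthD[of l y z] nth_eq_iff_index_eq[of l] by force

definition gpath :: "'a set set \<Rightarrow> 'a list \<Rightarrow> bool" where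
  "gpath D p \<longleftrightarrow> p \<noteq> [] \<and> distinct p \<and> (\<forall>x y. adjacent_in p x y \<longrightarrow> {x, y} \<in> D)"

definition gcycle :: "'a set set \<Rightarrow> 'a list \<Rightarrow> bool" where
  "gcycle D p \<longleftrightarrow> gpath D p \<and> 3 \<le> length p \<and> {last p, hd p} \<in> D"

text \<open>Only the vertex set and the start are fixed, not a path, so that ends obtained by
  different rotations, even with different additional hyperedges, can be compared and
  collected.\<close>

definition Ends :: "'a set set \<Rightarrow> 'a set \<Rightarrow> 'a \<Rightarrow> 'a set" where
  "Ends D U v = {last p | p. gpath D p \<and> set p = U \<and> hd p = v}"

definition Nb :: "'a set set \<Rightarrow> 'a set \<Rightarrow> 'a set" where
  "Nb D S = {w. \<exists>v\<in>S. {v, w} \<in> D}"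

lemma gpath_mono: "gpath D p \<Longrightarrow> D \<subseteq> D' \<Longrightarrow> gpath D' p"
  by (auto simp: gpath_def)

lemma gpath_rev: "gpath D (rev p) \<longleftrightarrow> gpath D p"
  unfolding gpath_def by (auto simp: adjacent_in_rev) (metis insert_commute)+

lemma gpath_snoc: "gpath D p \<Longrightarrow> {last p, w} \<in> D \<Longrightarrow> w \<notin> set p \<Longrightarrow> gpath D (p @ [w])"
  unfolding gpath_def by (auto simp: adjacent_in_append)

lemma gpath_rotate:
  assumes "gpath D (xs @ x # ys)" and "ys \<noteq> []" and "{last ys, x} \<in> D"
  shows "gpath D (xs @ x # rev ys)"
proof -
  have 1: "adjacent_in (x # ys) a b" if "adjacent_in ys a b" for a b
    using that by (cases ys) auto
  have "{a, b} \<in> D" if "adjacent_in (xs @ x # rev ys) a b" for a b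
  proof -
    have "adjacent_in xs a b \<or> (xs \<noteq> [] \<and> a = last xs \<and> b = x) \<or> adjacent_in ys b a
      \<or> (a = x \<and> b = last ys)"
      using that assms(2) adjacent_in_append[of "xs" "x # rev ys" a b]
        adjacent_in_append[of "[x]" "rev ys" a b] by (auto simp: adjacent_in_rev hd_rev)
    then show ?thesis
      using assms 1 unfolding gpath_def
      by (auto simp: adjacent_in_append) (metis insert_commute)+
  qed
  then show ?thesis using assms(1) by (auto simp: gpath_def)
qed

lemma gcycle_rotate1:
  assumes "gcycle D (x # ys)"
  shows "gcycle D (ys @ [x])"
proof -
  have ys: "ys \<noteq> []" using assms by (auto simp: gcycle_def)
  have "adjacent_in (x # ys) a b" if "adjacent_in ys a b" for a b
    using that by (cases ys) auto
  moreover have "adjacent_in (x # ys) x (hd ys)" using ys by (cases ys) auto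
  ultimately show ?thesis
    using assms ys unfolding gcycle_def gpath_def
    by (auto simp: adjacent_in_append insert_commute)
qed

lemma gcycle_open:
  assumes "gcycle D p" and "u \<in> set p"
  shows "\<exists>q. gpath D q \<and> set q = set p \<and> length q = length p \<and> last q = u"
proof -
  obtain as bs where p: "p = as @ u # bs" using assms(2) by (auto dest: split_list)
  have "gcycle D (bs @ as @ [u])"
    using assms(1) unfolding p
  proof (induction as arbitrary: bs)
    case Nil then show ?case using gcycle_rotate1 by force
  next
    case (Cons a as)
    from Cons.prems have "gcycle D (as @ u # (bs @ [a]))"
      using gcycle_rotate1[of D a "as @ u # bs"] by simp
    from Cons.IH[OF this] show ?case by simp
  qed
  then show ?thesis unfolding gcycle_def p by (intro exI[of _ "bs @ as @ [u]"]) auto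
qed

section \<open>Posa rotations\<close>

inductive rotations :: "'a set set \<Rightarrow> 'a list \<Rightarrow> 'a list \<Rightarrow> bool" for D p where
  rotations_refl: "rotations D p p"
| rotations_step: "rotations D p (xs @ x # ys) \<Longrightarrow> ys \<noteq> [] \<Longrightarrow> {last ys, x} \<in> D
    \<Longrightarrow> rotations D p (xs @ x # rev ys)"

lemma rotations_gpath:
  "rotations D p q \<Longrightarrow> gpath D p \<Longrightarrow> gpath D q \<and> set q = set p \<and> hd q = hd p"
proof (induction rule: rotations.induct)
  case (rotations_step xs x ys)
  then show ?case using gpath_rotate[of D xs x ys] by (auto simp: hd_append)
qed auto

text \<open>Rotating destroys only the path edge into the new end vertex.\<close>

lemma rotations_adjacent:
  assumes "rotations D p q" and "adjacent_in p a b"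
  shows "adjacent_in q a b \<or> adjacent_in q b a \<or>
    (\<exists>q'. rotations D p q' \<and> (a = last q' \<or> b = last q'))"
  using assms
proof (induction arbitrary: a b rule: rotations.induct)
  case (rotations_step xs x ys)
  let ?q' = "xs @ x # rev ys"
  have r: "rotations D p ?q'" using rotations_step by (auto intro: rotations.rotations_step)
  have l: "last ?q' = hd ys" using rotations_step(2) by (simp add: last_rev)
  have split: "adjacent_in (xs @ x # zs) a b \<longleftrightarrow> adjacent_in xs a b \<or> adjacent_in zs a b \<or>
     (xs \<noteq> [] \<and> a = last xs \<and> b = x) \<or> (a = x \<and> zs \<noteq> [] \<and> b = hd zs)" for zs a b
    using adjacent_in_append[of xs "x # zs" a b] adjacent_in_append[of "[x]" zs a b] by auto
  have keep: "adjacent_in ?q' a b \<or> adjacent_in ?q' b a \<or> b = hd ys"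
    if "adjacent_in (xs @ x # ys) a b" for a b
    using that unfolding split by (auto simp: adjacent_in_rev)
  from rotations_step.IH[OF rotations_step.prems] keep[of a b] keep[of b a] r l
  show ?case by metis
qed auto

lemma card_succ_le:
  assumes "finite A" and "distinct p"
  shows "card {w. \<exists>y\<in>A. adjacent_in p y w} \<le> card A"
    and "card {w. \<exists>y\<in>A. adjacent_in p w y} \<le> card A"
proof -
  have "{w. \<exists>y\<in>A. adjacent_in p y w} \<subseteq> (\<lambda>y. THE w. adjacent_in p y w) ` A"
  proof clarify
    fix w y assume "y \<in> A" and a: "adjacent_in p y w"
    have "(THE w. adjacent_in p y w) = w"
      using a by (rule the_equality) (rule adjacent_in_unique_succ[OF assms(2) _ a])
    then show "w \<in> (\<lambda>y. THE w. adjacent_in p y w) ` A" using \<open>y \<in> A\<close> by blast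
  qed
  then show "card {w. \<exists>y\<in>A. adjacent_in p y w} \<le> card A"
    using assms(1) by (rule surj_card_le[rotated])
  have "{w. \<exists>y\<in>A. adjacent_in p w y} \<subseteq> (\<lambda>y. THE w. adjacent_in p w y) ` A"
  proof clarify
    fix w y assume "y \<in> A" and a: "adjacent_in p w y"
    have "(THE w. adjacent_in p w y) = w"
      using a by (rule the_equality) (rule adjacent_in_unique_pred[OF assms(2) _ a])
    then show "w \<in> (\<lambda>y. THE w. adjacent_in p w y) ` A" using \<open>y \<in> A\<close> by blast
  qed
  then show "card {w. \<exists>y\<in>A. adjacent_in p w y} \<le> card A"
    using assms(1) by (rule surj_card_le[rotated])
qed

lemma adjacent_in_succ_exists:
  assumes "w \<in> set p" and "w \<noteq> last p" shows "\<exists>z. adjacent_in p w z"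
proof -
  obtain as bs where p: "p = as @ w # bs" using assms(1) by (auto dest: split_list)
  then have "bs \<noteq> []" using assms(2) by auto
  then show ?thesis using p by (cases bs) (auto simp: adjacent_in_append)
qed

lemma adjacent_in_pred_exists:
  assumes "w \<in> set p" and "w \<noteq> hd p" shows "\<exists>z. adjacent_in p z w"
  using adjacent_in_succ_exists[of w "rev p"] assms
  by (auto simp: adjacent_in_rev last_rev)

lemma not_adjacent_in_last: "distinct p \<Longrightarrow> \<not> adjacent_in p (last p) w"
proof
  assume d: "distinct p" and a: "adjacent_in p (last p) w"
  then obtain i where i: "Suc i < length p" "last p = p ! i"
    by (auto dest: adjacent_in_nthD)
  have ne: "p \<noteq> []" using i by auto
  then have "p ! (length p - 1) = p ! i" using i by (simp add: last_conv_nth)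
  then show False using d i by (subst (asm) nth_eq_iff_index_eq) auto
qed

lemma not_adjacent_in_hd: "distinct p \<Longrightarrow> \<not> adjacent_in p w (hd p)"
  using not_adjacent_in_last[of "rev p" w] by (cases "p = []") (auto simp: adjacent_in_rev last_rev)

text \<open>\<open>R\<close> consists of all ends reached by rotations. A neighbour of
  \<open>R\<close> outside \<open>R\<close> must be next to a vertex of \<open>R\<close> on the
  original path, so predecessors and successors of \<open>R\<close> on \<open>p\<close> cover all
  such neighbours.\<close>

theorem posa:
  assumes p: "gpath D p" and loopfree: "\<And>v. {v} \<notin> D"
    and stuck: "\<And>q w. gpath D q \<Longrightarrow> set q = set p \<Longrightarrow> {last q, w} \<in> D \<Longrightarrow> w \<in> set p"
  shows "\<exists>R \<subseteq> Ends D (set p) (hd p). R \<noteq> {} \<and> card (Nb D R - R) < 2 * card R"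
proof -
  define R where "R = {last q | q. rotations D p q}"
  have dp: "distinct p" using p by (simp add: gpath_def)
  have rot: "gpath D q" "set q = set p" "hd q = hd p" if "rotations D p q" for q
    using rotations_gpath[OF that p] by auto
  have RE: "R \<subseteq> Ends D (set p) (hd p)" using rot by (auto simp: R_def Ends_def)
  have lastR: "last p \<in> R" by (auto simp: R_def intro: rotations_refl)
  have Rsub: "R \<subseteq> set p"
    using rot by (auto simp: R_def gpath_def) (metis last_in_set)
  then have finR: "finite R" by (rule finite_subset) simp
  have key: "\<exists>y\<in>R. adjacent_in p y w \<or> adjacent_in p w y" if w: "w \<in> Nb D R - R" for w
  proof (rule ccontr)
    assume no: "\<not> ?thesis"
    obtain q where q: "rotations D p q" "{last q, w} \<in> D" using w by (auto simp: Nb_def R_def)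
    note qq = rot[OF q(1)]
    have wp: "w \<in> set p" using stuck[OF qq(1,2) q(2)] .
    have dq: "distinct q" using qq(1) by (simp add: gpath_def)
    have wl: "w \<noteq> last q" using w q(1) by (auto simp: R_def)
    obtain xs ys where qs: "q = xs @ w # ys" using wp qq(2) by (metis split_list)
    then have ys: "ys \<noteq> []" and lys: "last q = last ys" using wl by auto
    define y where "y = hd ys"
    have "rotations D p (xs @ w # rev ys)"
      using q unfolding lys unfolding qs by (rule rotations_step[OF _ ys])
    then have yR: "y \<in> R" unfolding R_def y_def
      using ys by (auto intro!: exI[of _ "xs @ w # rev ys"] simp: last_rev)
    have qwy: "adjacent_in q w y"
      unfolding qs y_def using ys by (cases ys) (auto simp: adjacent_in_append)
    \<comment> \<open>The neighbours of \<open>w\<close> on \<open>p\<close> lie outside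
      \<open>R\<close>, so their edges to \<open>w\<close> were never broken. But the successor
      \<open>y\<close> of \<open>w\<close> on \<open>q\<close> lies in \<open>R\<close>; hence both
      of them would have to be the unique predecessor of \<open>w\<close> on
      \<open>q\<close>.\<close>
    have pres: "z = y \<or> adjacent_in q z w" if "adjacent_in p w z \<or> adjacent_in p z w" for z
    proof -
      have "z \<notin> R" "w \<notin> R" using no that w by auto
      then have "adjacent_in q w z \<or> adjacent_in q z w"
        using that rotations_adjacent[OF q(1), of w z] rotations_adjacent[OF q(1), of z w]
        by (auto simp: R_def)
      then show ?thesis using adjacent_in_unique_succ[OF dq qwy] by auto
    qed
    have wlp: "w \<noteq> last p" using lastR w by auto
    then obtain z2 where z2: "adjacent_in p w z2" using adjacent_in_succ_exists wp by metis
    have z2y: "z2 \<noteq> y" using no yR z2 by auto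
    then have z2q: "adjacent_in q z2 w" using pres z2 by auto
    have "w \<noteq> hd p" using z2q qq(3) not_adjacent_in_hd[OF dq] by metis
    then obtain z1 where z1: "adjacent_in p z1 w" using adjacent_in_pred_exists wp by metis
    have "z1 \<noteq> y" using no yR z1 by auto
    then have "adjacent_in q z1 w" using pres z1 by auto
    then have "z1 = z2" using z2q adjacent_in_unique_pred[OF dq] by metis
    then obtain i j where "Suc i < length p" "z1 = p ! i" "w = p ! Suc i"
      "Suc j < length p" "w = p ! j" "z1 = p ! Suc j"
      using z1 z2 by (metis adjacent_in_nthD)
    moreover from this have "i = Suc j" "Suc i = j"
      using dp nth_eq_iff_index_eq[OF dp, of i "Suc j"] nth_eq_iff_index_eq[OF dp, of "Suc i" j] by simp_all
    ultimately show False by simp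
  qed
  \<comment> \<open>\<open>last p\<close> lies in \<open>R\<close> and has no successor; removing it
    here makes the final inequality strict.\<close>
  have sub: "Nb D R - R \<subseteq> {w. \<exists>y\<in>R - {last p}. adjacent_in p y w} \<union> {w. \<exists>y\<in>R. adjacent_in p w y}"
    using key not_adjacent_in_last[OF dp] by blast
  have fin: "finite {w. \<exists>y\<in>A. adjacent_in p y w}" "finite {w. \<exists>y\<in>A. adjacent_in p w y}" for A
    by (rule finite_subset[of _ "set p"]; auto dest: adjacent_in_mem)+
  have "card (Nb D R - R) \<le> card ({w. \<exists>y\<in>R - {last p}. adjacent_in p y w} \<union> {w. \<exists>y\<in>R. adjacent_in p w y})"
    using sub fin by (intro card_mono) auto
  also have "\<dots> \<le> card (R - {last p}) + card R"
    by (rule order.trans[OF card_Un_le])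
      (intro add_mono card_succ_le dp finite_Diff finR)
  also have "\<dots> < 2 * card R"
    using card_Diff1_less[OF finR lastR] by simp
  finally show ?thesis using RE lastR by blast
qed

section \<open>Labelled hyperedges\<close>

text \<open>A set of labelled hyperedges assigns to each of its hyperedges a pair of vertices contained
  in it; a Hamilton cycle in the graph of the labels is then a Berge Hamilton cycle.\<close>

definition labelled :: "'a set set \<Rightarrow> ('a set \<times> 'a set) set" where
  "labelled E = {(e, q). e \<in> E \<and> q \<subseteq> e \<and> card q = 2}"

definition labelling :: "'a set set \<Rightarrow> ('a set \<times> 'a set) set \<Rightarrow> bool" where
  "labelling E L \<longleftrightarrow> L \<subseteq> labelled E \<and> inj_on fst L"

lemma labelling_insert:
  assumes "labelling E L" and "h \<in> E" "h \<notin> fst ` L" "q \<subseteq> h" "card q = 2"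
  shows "labelling E (insert (h, q) L)"
  using assms by (auto simp: labelling_def labelled_def)

lemma gcycle_berge:
  assumes c: "gcycle (snd ` L) p" and L: "labelling E L" and V: "set p = V"
  shows "has_berge_hamilton_cycle V E"
proof -
  define k where "k = length p"
  have d: "distinct p" and k3: "3 \<le> k" and pne: "p \<noteq> []"
    using c by (auto simp: gcycle_def gpath_def k_def)
  define nx where "nx i = (if Suc i = k then 0 else Suc i)" for i
  define pr where "pr i = {p ! i, p ! nx i}" for i
  have nxk: "nx i < k" if "i < k" for i using that k3 by (auto simp: nx_def)
  have prD: "pr i \<in> snd ` L" if "i < k" for i
  proof (cases "Suc i = k")
    case True
    then have "pr i = {last p, hd p}"
      using pne by (simp add: pr_def nx_def last_conv_nth hd_conv_nth k_def[symmetric]) (use True in auto)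
    then show ?thesis using c by (simp add: gcycle_def)
  next
    case False
    then have "adjacent_in p (p ! i) (p ! Suc i)" using that by (intro adjacent_in_nth) (auto simp: k_def)
    then show ?thesis using c False by (auto simp: gcycle_def gpath_def pr_def nx_def)
  qed
  \<comment> \<open>This needs length at least three: a closed walk on two vertices would use the
    same pair twice.\<close>
  have prinj: "i = j" if "pr i = pr j" "i < k" "j < k" for i j
  proof (rule ccontr)
    assume ne: "i \<noteq> j"
    have eq: "p ! a = p ! b \<longleftrightarrow> a = b" if "a < k" "b < k" for a b
      using d that by (simp add: nth_eq_iff_index_eq k_def)
    from that(1) have "p ! i = p ! j \<or> (p ! i = p ! nx j \<and> p ! j = p ! nx i)"
      unfolding pr_def by (auto simp: doubleton_eq_iff)
    then have "i = nx j \<and> j = nx i" 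
      using ne eq[OF that(2,3)] eq[OF that(2) nxk[OF that(3)]] eq[OF that(3) nxk[OF that(2)]] by blast
    moreover have "nx a = Suc a \<or> (Suc a = k \<and> nx a = 0)" for a by (simp add: nx_def)
    from this[of i] this[of j] have "\<not> (i = nx j \<and> j = nx i)"
      using k3 by linarith
    ultimately show False by simp
  qed
  \<comment> \<open>Several hyperedges may carry the same pair. Any choice works: each hyperedge has
    only one label, so distinct pairs of the cycle receive distinct hyperedges.\<close>
  define f where "f q = (SOME e. (e, q) \<in> L)" for q
  have f: "(f q, q) \<in> L" if "q \<in> snd ` L" for q
    using that unfolding f_def by (metis (no_types, lifting) imageE prod.collapse someI)
  define es where "es = map (\<lambda>i. f (pr i)) [0..<k]"
  define vs where "vs = p @ [hd p]"
  have vsn: "vs ! i = p ! i" "vs ! Suc i = p ! nx i" if "i < k" for i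
    using that pne by (auto simp: vs_def nth_append nx_def k_def hd_conv_nth)
  have mem: "f (pr i) \<in> E \<and> pr i \<subseteq> f (pr i)" if "i < k" for i
    using f[OF prD[OF that]] L by (auto simp: labelling_def labelled_def)
  have "inj_on (\<lambda>i. f (pr i)) {..<k}"
  proof (rule inj_onI)
    fix i j assume ij: "i \<in> {..<k}" "j \<in> {..<k}" "f (pr i) = f (pr j)"
    then have "(f (pr i), pr i) \<in> L" "(f (pr j), pr j) \<in> L"
      using f[OF prD, of i] f[OF prD, of j] by simp_all
    then have "(f (pr i), pr i) = (f (pr j), pr j)"
      using L ij(3) inj_onD[of fst L "(f (pr i), pr i)" "(f (pr j), pr j)"] by (simp add: labelling_def)
    then have "pr i = pr j" by simp
    then show "i = j" using prinj ij by auto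
  qed
  then have "distinct es" by (simp add: es_def distinct_map atLeast0LessThan)
  then have "berge_cycle V E vs es"
    unfolding berge_cycle_def using k3 d V pne mem vsn
    by (auto simp: es_def vs_def[symmetric] k_def[symmetric] pr_def)
       (auto simp: vs_def k_def)
  then show ?thesis unfolding has_berge_hamilton_cycle_def
    using V by (intro exI[of _ vs] exI[of _ es]) (auto simp: vs_def)
qed

text \<open>Hyperedges which, once added with a suitable label, lengthen a longest path, provide a new
  path end in \<open>B\<close>, or close a cycle with vertex set \<open>U\<close> (together with a hyperedge of \<open>X\<close>).\<close>

definition Fout :: "'a set \<Rightarrow> 'a set set \<Rightarrow> ('a set \<times> 'a set) set \<Rightarrow> nat \<Rightarrow> 'a set set" where
  "Fout V E L k = {h \<in> E - fst ` L. \<exists>q \<subseteq> h. card q = 2 \<and>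
     (\<exists>p. gpath (insert q (snd ` L)) p \<and> set p \<subseteq> V \<and> length p = Suc k)}"

definition Frot :: "'a set set \<Rightarrow> ('a set \<times> 'a set) set \<Rightarrow> 'a set \<Rightarrow> 'a \<Rightarrow> 'a set \<Rightarrow> 'a set set" where
  "Frot E L U v B = {h \<in> E - fst ` L. \<exists>q \<subseteq> h. card q = 2 \<and> Ends (insert q (snd ` L)) U v \<inter> B \<noteq> {}}"

definition Fclose :: "'a set set \<Rightarrow> ('a set \<times> 'a set) set \<Rightarrow> 'a set \<Rightarrow> 'a set set \<Rightarrow> 'a set set" where
  "Fclose E L U X = {f \<in> E - fst ` L. \<exists>h \<in> X - fst ` L. h \<noteq> f \<and>
     (\<exists>q \<subseteq> h. \<exists>q' \<subseteq> f. card q = 2 \<and> card q' = 2 \<and>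
       (\<exists>p. gcycle (insert q' (insert q (snd ` L))) p \<and> set p = U))}"

section \<open>Dirac hypergraphs\<close>

text \<open>\<open>eps_n\<close> pays for removing a vertex from its own neighbourhood, and
  \<open>n6\<close> makes \<open>n / 2\<close> at least three, the length needed for a
  cycle.\<close>

locale dirac_hypergraph =
  fixes V :: "'a set" and E :: "'a set set" and r :: nat and \<epsilon> :: real
  assumes unif: "uniform_hypergraph r V E" and r3: "3 \<le> r" and eps: "0 < \<epsilon>" "\<epsilon> \<le> 1 / 2"
    and dirac: "\<And>v. v \<in> V \<Longrightarrow>
      (1 / 2 + \<epsilon>) * real (card V) \<le>
      real (card {u \<in> V. \<epsilon> * real (card V) ^ (r - 2) \<le> real (codegree E u v)})"
    and eps_n: "2 \<le> \<epsilon> * real (card V)" and n6: "6 \<le> card V"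
begin

abbreviation n :: nat where "n \<equiv> card V"

text \<open>\<open>codegree E v v\<close> is the degree of \<open>v\<close>, so the Dirac condition
  may count \<open>v\<close> itself; excluding it turns the surplus \<epsilon> into
  \<open>\<epsilon> / 2\<close>.\<close>

definition N :: "'a \<Rightarrow> 'a set" where
  "N v = {u \<in> V. u \<noteq> v \<and> \<epsilon> * real n ^ (r - 2) \<le> real (codegree E u v)}"

lemma finV [simp]: "finite V" using unif by (simp add: uniform_hypergraph_def)

lemma E_sub: "e \<in> E \<Longrightarrow> e \<subseteq> V" and E_card: "e \<in> E \<Longrightarrow> card e = r"
  using unif by (auto simp: uniform_hypergraph_def)

lemma finE [simp]: "finite E"
  by (rule finite_subset[of _ "Pow V"]) (use E_sub in auto)

lemma fin_edge [simp]: "e \<in> E \<Longrightarrow> finite e"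
  using E_sub finV finite_subset by metis

lemma N_sub: "N v \<subseteq> V" and N_irrefl: "v \<notin> N v" by (auto simp: N_def)

lemma finN [simp]: "finite (N v)" using N_sub finV finite_subset by metis

lemma N_codegree: "x \<in> N w \<Longrightarrow> \<epsilon> * real n ^ (r - 2) \<le> real (card {e \<in> E. {w, x} \<subseteq> e})"
  by (auto simp: N_def codegree_def degree_def conj_commute)

lemma card_N: "v \<in> V \<Longrightarrow> (1 / 2 + \<epsilon> / 2) * real n \<le> real (card (N v))"
proof -
  assume v: "v \<in> V"
  let ?A = "{u \<in> V. \<epsilon> * real n ^ (r - 2) \<le> real (codegree E u v)}"
  have "N v = ?A - {v}" by (auto simp: N_def)
  then have "card ?A \<le> card (N v) + 1"
    using card_Diff1_le[of ?A v] by (cases "v \<in> ?A") (auto simp: card_Diff_singleton)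
  then have "real (card ?A) \<le> real (card (N v)) + 1" by linarith
  then show ?thesis using dirac[OF v] eps_n by (simp add: algebra_simps)
qed

text \<open>Double counting: every pair in \<open>Z\<close> lies in many hyperedges, all of which
  belong to \<open>F\<close> or \<open>D\<close> except possibly one, and a hyperedge contains at
  most \<open>r * r\<close> ordered pairs. In the applications \<open>D\<close> is the set of
  hyperedges already labelled; the exception \<open>h\<close> is the one used for a rotation, which
  must not be reused to close the cycle.\<close>

lemma pairs_to_edges:
  assumes Z: "\<And>w x. (w, x) \<in> Z \<Longrightarrow> w \<in> V \<and> x \<in> N w"
    and F: "\<And>w x. (w, x) \<in> Z \<Longrightarrow> \<exists>h. \<forall>e\<in>E. {w, x} \<subseteq> e \<longrightarrow> e \<notin> D \<longrightarrow> e \<noteq> h \<longrightarrow> e \<in> F"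
    and fin: "finite F" "finite D"
  shows "real (card Z) * (\<epsilon> * real n ^ (r - 2) - 1) \<le> real (r\<^sup>2) * (real (card F) + real (card D))"
proof -
  let ?G = "E \<inter> (F \<union> D)"
  have finZ: "finite Z" by (rule finite_subset[of _ "V \<times> V"]) (use Z N_sub in auto)
  have "real (card Z) * (\<epsilon> * real n ^ (r - 2) - 1) = (\<Sum>z\<in>Z. \<epsilon> * real n ^ (r - 2) - 1)" by simp
  also have "\<dots> \<le> (\<Sum>z\<in>Z. real (card {e \<in> ?G. {fst z, snd z} \<subseteq> e}))"
  proof (rule sum_mono)
    fix z assume z: "z \<in> Z"
    then obtain w x where [simp]: "z = (w, x)" by (cases z) auto
    obtain h where h: "\<forall>e\<in>E. {w, x} \<subseteq> e \<longrightarrow> e \<notin> D \<longrightarrow> e \<noteq> h \<longrightarrow> e \<in> F"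
      using F[of w x] z by auto
    have "{e \<in> E. {w, x} \<subseteq> e} \<subseteq> insert h {e \<in> ?G. {w, x} \<subseteq> e}" using h by auto
    then have "card {e \<in> E. {w, x} \<subseteq> e} \<le> Suc (card {e \<in> ?G. {w, x} \<subseteq> e})"
    proof -
      assume "{e \<in> E. {w, x} \<subseteq> e} \<subseteq> insert h {e \<in> ?G. {w, x} \<subseteq> e}"
      then have "card {e \<in> E. {w, x} \<subseteq> e} \<le> card (insert h {e \<in> ?G. {w, x} \<subseteq> e})"
        using finE by (intro card_mono) auto
      also have "\<dots> \<le> Suc (card {e \<in> ?G. {w, x} \<subseteq> e})" by (simp add: card_insert_if)
      finally show ?thesis .
    qed
    moreover have "x \<in> N w" using Z z by auto
    ultimately show "\<epsilon> * real n ^ (r - 2) - 1 \<le> real (card {e \<in> ?G. {fst z, snd z} \<subseteq> e})"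
      using N_codegree[of x w] by simp
  qed
  also have "\<dots> = real (\<Sum>e\<in>?G. card {z \<in> Z. {fst z, snd z} \<subseteq> e})"
    using sum_multicount_gen[OF finZ, of ?G "\<lambda>z e. {fst z, snd z} \<subseteq> e"
        "\<lambda>e. card {z \<in> Z. {fst z, snd z} \<subseteq> e}"] finE
    by (simp flip: of_nat_sum)
  also have "\<dots> \<le> real (\<Sum>e\<in>?G. r\<^sup>2)"
  proof (intro of_nat_mono sum_mono)
    fix e assume e: "e \<in> ?G"
    have "card {z \<in> Z. {fst z, snd z} \<subseteq> e} \<le> card (e \<times> e)"
      by (rule card_mono) (use e fin_edge in auto)
    then show "card {z \<in> Z. {fst z, snd z} \<subseteq> e} \<le> r\<^sup>2"
      using e E_card by (simp add: card_cartesian_product power2_eq_square)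
  qed
  also have "\<dots> = real (r\<^sup>2) * real (card ?G)" by simp
  also have "\<dots> \<le> real (r\<^sup>2) * (real (card F) + real (card D))"
  proof (rule mult_left_mono)
    have "card ?G \<le> card (F \<union> D)" using fin by (intro card_mono) auto
    also have "\<dots> \<le> card F + card D" by (rule card_Un_le)
    finally show "real (card ?G) \<le> real (card F) + real (card D)" by linarith
  qed simp
  finally show ?thesis .
qed

end

lemma EndsI:
  "gpath D p \<Longrightarrow> set p = U \<Longrightarrow> hd p = v \<Longrightarrow> last p = w \<Longrightarrow> w \<in> Ends D U v"
  by (auto simp: Ends_def)

lemma Ends_sub: "Ends D U v \<subseteq> U"
  by (auto simp: Ends_def gpath_def)

section \<open>Longest paths and boosters\<close>

context dirac_hypergraph
begin

definition expanding :: "real \<Rightarrow> 'a set set \<Rightarrow> bool" where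
  "expanding c D \<longleftrightarrow> (\<forall>S\<subseteq>V. S \<noteq> {} \<longrightarrow> real (card S) \<le> c * real n \<longrightarrow> 2 * card S \<le> card (Nb D S - S))"

text \<open>Collects all that is asked of \<open>Xa\<close> and \<open>Xb\<close> in the extremal
  argument. \<open>Fclose\<close> refers to \<open>Xa\<close> and is therefore hit by
  \<open>Xb\<close>. Quantifying over all \<open>U\<close>, \<open>v\<close> and \<open>B\<close>
  costs only a factor of exponential size in \<open>n\<close>.\<close>

definition boosted :: "real \<Rightarrow> 'a set set \<Rightarrow> 'a set set \<Rightarrow> ('a set \<times> 'a set) set \<Rightarrow> bool" where
  "boosted \<theta> Xa Xb L \<longleftrightarrow>
     (\<forall>k. \<theta> * real n ^ r \<le> real (card (Fout V E L k)) \<longrightarrow> Fout V E L k \<inter> Xb \<noteq> {}) \<and>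
     (\<forall>U\<subseteq>V. \<forall>v\<in>V. \<forall>B\<subseteq>V. \<theta> * real n ^ r \<le> real (card (Frot E L U v B)) \<longrightarrow> Frot E L U v B \<inter> Xa \<noteq> {}) \<and>
     (\<forall>U\<subseteq>V. \<theta> * real n ^ r \<le> real (card (Fclose E L U Xa)) \<longrightarrow> Fclose E L U Xa \<inter> Xb \<noteq> {})"

lemma finF [simp]: "finite (Fout V E L k)" "finite (Frot E L U v B)" "finite (Fclose E L U X)"
  by (auto simp: Fout_def Frot_def Fclose_def)

text \<open>Take a longest path among those using at most three additional hyperedges per vertex.
  Lengthening it by one vertex needs at most three more: one of \<open>Xa\<close> to rotate, one of
  \<open>Xb\<close> to close a cycle and one of \<open>Xb\<close> to leave that cycle. The
  assumption \<open>theta\<close> says that \<open>z\<close> pairs of Dirac neighbours always yield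
  a booster set above the threshold, even after discarding the at most \<open>m\<close> labelled
  hyperedges.\<close>

theorem boosted_hamiltonian:
  fixes m c \<theta> :: real
  assumes c: "0 < c"
    and \<Gamma>: "\<Gamma> \<subseteq> E" "Xa \<subseteq> \<Gamma>" "Xb \<subseteq> \<Gamma>"
    and L0: "labelling \<Gamma> L0" "expanding c (snd ` L0)"
    and L0m: "real (card L0) + 3 * real n + 3 \<le> m"
    and theta: "real (r\<^sup>2) * (\<theta> * real n ^ r + m) \<le> c * \<epsilon> / 8 * (real n)\<^sup>2 * (\<epsilon> * real n ^ (r - 2) - 1)"
    and boost: "\<And>L. L0 \<subseteq> L \<Longrightarrow> labelling \<Gamma> L \<Longrightarrow> card (L - L0) \<le> 3 * n + 3 \<Longrightarrow> boosted \<theta> Xa Xb L"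
  shows "has_berge_hamilton_cycle V \<Gamma>"
proof -
  have fin\<Gamma>: "finite \<Gamma>" by (rule finite_subset[OF \<Gamma>(1) finE])
  have finL: "finite L" if "labelling \<Gamma> L" for L
  proof (rule finite_subset[of _ "\<Gamma> \<times> Pow V"])
    show "L \<subseteq> \<Gamma> \<times> Pow V"
      using that \<Gamma>(1) E_sub by (fastforce simp: labelling_def labelled_def)
  qed (use fin\<Gamma> in auto)
  have labV: "q \<subseteq> V" "card q = 2" if "labelling \<Gamma> L" "q \<in> snd ` L" for L q
    using that \<Gamma>(1) E_sub by (fastforce simp: labelling_def labelled_def)+
  have cardL: "real (card (fst ` L)) \<le> m"
    if "L0 \<subseteq> L" "labelling \<Gamma> L" "card (L - L0) \<le> 3 * n + 3" for L
  proof -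
    have "card (fst ` L) \<le> card L" using finL[OF that(2)] by (rule card_image_le)
    also have "\<dots> = card (L - L0) + card L0"
      using that finL by (metis card_Diff_subset card_mono finite_subset le_add_diff_inverse2)
    finally show ?thesis using that(3) L0m by linarith
  qed
  \<comment> \<open>Two exceptional sets of fewer than \<open>z\<close> pairs occur below. Spread
    over more than \<open>c * real n\<close> ends, together they cost at most
    \<open>\<epsilon> / 4 * real n\<close> per end, half of the surplus in
    \<open>card_N\<close>.\<close>
  define z where "z = c * \<epsilon> / 8 * (real n)\<^sup>2"
  have en1: "0 < \<epsilon> * real n ^ (r - 2) - 1"
  proof -
    have "real n ^ 1 \<le> real n ^ (r - 2)" using r3 n6 by (intro power_increasing) auto
    then have "\<epsilon> * real n \<le> \<epsilon> * real n ^ (r - 2)" using eps by simp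
    then show ?thesis using eps_n by linarith
  qed
  have many: "\<theta> * real n ^ r \<le> real (card F)"
    if "\<And>w x. (w, x) \<in> Z \<Longrightarrow> w \<in> V \<and> x \<in> N w"
      and "\<And>w x. (w, x) \<in> Z \<Longrightarrow> \<exists>h. \<forall>e\<in>E. {w, x} \<subseteq> e \<longrightarrow> e \<notin> fst ` L \<longrightarrow> e \<noteq> h \<longrightarrow> e \<in> F"
      and "z \<le> real (card Z)" and "finite F"
      and "L0 \<subseteq> L" "labelling \<Gamma> L" "card (L - L0) \<le> 3 * n + 3"
    for Z L F
  proof -
    have "real (r\<^sup>2) * (\<theta> * real n ^ r + m) \<le> z * (\<epsilon> * real n ^ (r - 2) - 1)"
      using theta by (simp add: z_def)
    also have "\<dots> \<le> real (card Z) * (\<epsilon> * real n ^ (r - 2) - 1)"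
      using that(3) en1 by (intro mult_right_mono) auto
    also have "\<dots> \<le> real (r\<^sup>2) * (real (card F) + real (card (fst ` L)))"
      using pairs_to_edges[of Z "fst ` L" F] that finL by simp
    also have "\<dots> \<le> real (r\<^sup>2) * (real (card F) + m)"
      using cardL that by (intro mult_left_mono) auto
    finally have "\<theta> * real n ^ r + m \<le> real (card F) + m"
      using r3 by (subst (asm) mult_le_cancel_left_pos) auto
    then show ?thesis by simp
  qed
  define St where "St L p \<longleftrightarrow> L0 \<subseteq> L \<and> labelling \<Gamma> L \<and> card (L - L0) \<le> 3 * length p \<and>
     gpath (snd ` L) p \<and> set p \<subseteq> V" for L and p :: "'a list"
  have lenn: "length p \<le> n" if "St L p" for L p
    using that card_mono[of V "set p"] by (auto simp: St_def gpath_def distinct_card)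
  obtain v0 where "v0 \<in> V" using n6 by fastforce
  then have "St L0 [v0]" using L0 by (simp add: St_def gpath_def)
  then obtain L p where St: "St L p" and max: "\<And>L' p'. St L' p' \<Longrightarrow> length p' \<le> length p"
    using ex_has_greatest_nat[of "\<lambda>(L, p). St L p" "(L0, [v0])" "\<lambda>(L, p). length p" "Suc n"] lenn
    by fastforce
  define D where "D = snd ` L"
  define U where "U = set p"
  define k where "k = length p"
  note kn = lenn[OF St, folded k_def]
  have L: "L0 \<subseteq> L" "labelling \<Gamma> L" "card (L - L0) \<le> 3 * k" and p: "gpath D p" and UV: "U \<subseteq> V"
    using St by (auto simp: St_def D_def U_def k_def)
  have cLn: "card (L - L0) \<le> 3 * n + 3" using L kn by simp
  have cardU: "card U = k" using p by (simp add: U_def k_def gpath_def distinct_card)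
  have finU: "finite U" by (simp add: U_def)
  have loopfree: "{v} \<notin> D" for v using labV(2)[OF L(2), of "{v}"] by (auto simp: D_def)
  have lenq: "length q = k" if "gpath D' q" "set q = U" for D' q
    using that cardU by (auto simp: gpath_def dest: distinct_card)
  have stuck: "w \<in> U" if "gpath D q" "set q = U" "{last q, w} \<in> D" for q w
  proof (rule ccontr)
    assume "w \<notin> U"
    then have "gpath D (q @ [w])" using that by (intro gpath_snoc) auto
    moreover have "w \<in> V" using labV(1)[OF L(2)] that(3) by (auto simp: D_def)
    ultimately have "St L (q @ [w])"
      using L lenq[OF that(1,2)] that(2) UV by (auto simp: St_def D_def)
    then have "length (q @ [w]) \<le> k" unfolding k_def by (rule max)
    then show False using lenq[OF that(1,2)] by simp
  qed
  have fE: "finite (Ends D' U v)" for D' v using Ends_sub finU by (rule finite_subset)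
  \<comment> \<open>By maximality every path on \<open>U\<close> is stuck, so Posa's lemma gives a
    set with few outside neighbours; the graph contains the expander, hence that set is too large
    for \<open>expanding\<close>.\<close>
  have big: "c * real n < real (card (Ends D U (hd q)))" if q: "gpath D q" "set q = U" for q
  proof -
    obtain R where R: "R \<subseteq> Ends D U (hd q)" "R \<noteq> {}" "card (Nb D R - R) < 2 * card R"
      using posa[OF q(1) loopfree] stuck q(2) by metis
    have RV: "R \<subseteq> V" using R(1) Ends_sub UV by fast
    have "finite (Nb D R - R)"
      by (rule finite_subset[of _ V]) (use labV(1)[OF L(2)] in \<open>auto simp: Nb_def D_def\<close>)
    then have "card (Nb (snd ` L0) R - R) \<le> card (Nb D R - R)"
      using L(1) by (intro card_mono) (auto simp: Nb_def D_def)
    then have "\<not> real (card R) \<le> c * real n"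
      using L0(2) R(2,3) RV unfolding expanding_def by (meson leD le_less_trans order.trans)
    moreover have "card R \<le> card (Ends D U (hd q))" using R(1) fE by (intro card_mono) auto
    ultimately show ?thesis by linarith
  qed
  define Vs where "Vs = Ends D U (hd p)"
  have bigVs: "c * real n < real (card Vs)" unfolding Vs_def using big[OF p] by (simp add: U_def)
  have VsU: "Vs \<subseteq> U" unfolding Vs_def by (rule Ends_sub)
  have bigE: "c * real n < real (card (Ends D U v))" if v: "v \<in> Vs" for v
  proof -
    obtain q where q: "gpath D q" "set q = U" "last q = v" using v by (auto simp: Vs_def Ends_def)
    then have "gpath D (rev q)" "hd (rev q) = v" by (simp_all add: gpath_rev hd_rev)
    then show ?thesis using big[of "rev q"] q(2) by simp
  qed
  have improve: False if "gpath (snd ` L') q" "length q = Suc k" "set q \<subseteq> V" "L0 \<subseteq> L'"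
    "labelling \<Gamma> L'" "card (L' - L0) \<le> 3 * k + 3" for L' q
  proof -
    have "St L' q" using that by (simp add: St_def)
    then have "length q \<le> k" unfolding k_def by (rule max)
    then show False using that(2) by simp
  qed
  have hitout: False if FX: "Fout V E L' k \<inter> Xb \<noteq> {}" and L': "L0 \<subseteq> L'" "labelling \<Gamma> L'" "card (L' - L0) \<le> 3 * k + 2"
    for L'
  proof -
    obtain h q p' where h: "h \<in> Xb" "h \<notin> fst ` L'" "q \<subseteq> h" "card q = 2"
      "gpath (insert q (snd ` L')) p'" "set p' \<subseteq> V" "length p' = Suc k"
      using FX by (auto simp: Fout_def)
    let ?L = "insert (h, q) L'"
    have "labelling \<Gamma> ?L" using L' h \<Gamma> by (intro labelling_insert) auto
    moreover have "card (?L - L0) \<le> 3 * k + 3"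
      using L' card_insert_le_m1[of "Suc (card (L' - L0))" "L' - L0" "(h, q)"]
      by (simp add: insert_Diff_if)
    ultimately show False using improve[of ?L p'] h L' by auto
  qed
  \<comment> \<open>Otherwise a hyperedge of \<open>Xb\<close> would append a vertex outside
    \<open>U\<close> to one of the paths.\<close>
  have out: "real (card {(w, y). w \<in> Ends D U v \<and> y \<in> N w - U}) < z" if v: "v \<in> Vs" for v
  proof (rule ccontr)
    let ?Z = "{(w, y). w \<in> Ends D U v \<and> y \<in> N w - U}"
    assume "\<not> ?thesis"
    then have "\<theta> * real n ^ r \<le> real (card (Fout V E L k))"
    proof (intro many[of ?Z L])
      fix w y assume wy: "(w, y) \<in> ?Z"
      then obtain q where q: "gpath D q" "set q = U" "last q = w" by (auto simp: Ends_def)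
      have "gpath (insert {w, y} D) (q @ [y])"
        using q wy by (intro gpath_snoc gpath_mono[OF q(1)]) auto
      moreover have "set (q @ [y]) \<subseteq> V" using q wy UV N_sub by auto
      moreover have "card {w, y} = 2" using wy N_irrefl[of w] by (subst card_2_iff) auto
      moreover have "length (q @ [y]) = Suc k" using lenq[OF q(1,2)] by simp
      ultimately have "\<forall>e\<in>E. {w, y} \<subseteq> e \<longrightarrow> e \<notin> fst ` L \<longrightarrow> e \<in> Fout V E L k"
        unfolding Fout_def D_def by blast
      then show "\<exists>h. \<forall>e\<in>E. {w, y} \<subseteq> e \<longrightarrow> e \<notin> fst ` L \<longrightarrow> e \<noteq> h \<longrightarrow> e \<in> Fout V E L k" by blast
    qed (use Ends_sub[of D U v] UV L cLn in auto)
    then have "Fout V E L k \<inter> Xb \<noteq> {}" using boost[OF L(1,2) cLn] by (simp add: boosted_def)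
    then show False by (rule hitout) (use L in auto)
  qed
  define Good where "Good v = {y \<in> U. \<exists>h\<in>Xa - fst ` L. \<exists>q\<subseteq>h. card q = 2 \<and> y \<in> Ends (insert q D) U v}" for v
  \<comment> \<open>For an end \<open>w\<close>, a Dirac neighbour \<open>x\<close> of
    \<open>w\<close> on the path makes the successor of \<open>x\<close> a new end. Successors are
    injective, so if few neighbours lie outside \<open>U\<close> and few successors are bad, then on
    average over \<open>w\<close> almost \<open>card (N w)\<close> vertices are good.\<close>
  have good: "(1 / 2 + \<epsilon> / 4) * real n \<le> real (card (Good v))" if v: "v \<in> Vs" for v
  proof -
    let ?R = "Ends D U v"
    define P where "P w = (SOME q. gpath D q \<and> set q = U \<and> hd q = v \<and> last q = w)" for w
    have P: "gpath D (P w) \<and> set (P w) = U \<and> hd (P w) = v \<and> last (P w) = w" if "w \<in> ?R" for w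
      unfolding P_def by (rule someI_ex) (use that in \<open>auto simp: Ends_def\<close>)
    define sc where "sc w x = (SOME y. adjacent_in (P w) x y)" for w x
    have sc: "adjacent_in (P w) x (sc w x)" if "w \<in> ?R" "x \<in> N w \<inter> U" for w x
      unfolding sc_def
      by (rule someI_ex) (use that P[OF that(1)] N_irrefl[of w] in \<open>auto intro!: adjacent_in_succ_exists\<close>)
    have scinj: "inj_on (sc w) (N w \<inter> U)" if "w \<in> ?R" for w
    proof (rule inj_onI)
      fix x y assume xy: "x \<in> N w \<inter> U" "y \<in> N w \<inter> U" "sc w x = sc w y"
      have "distinct (P w)" using P[OF that] by (simp add: gpath_def)
      then show "x = y"
        using adjacent_in_unique_pred sc[OF that xy(1)] sc[OF that xy(2)] xy(3) by metis
    qed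
    have scU: "sc w x \<in> U" if "w \<in> ?R" "x \<in> N w \<inter> U" for w x
      using adjacent_in_mem[OF sc[OF that]] P[OF that(1)] by auto
    \<comment> \<open>A hyperedge of \<open>Xa\<close> in \<open>Frot E L U v Bad\<close> would make
      a vertex of \<open>Bad\<close> good. Hence \<open>Xa\<close> misses this set, which by
      \<open>boosted\<close> is below the threshold, and few rotations lead into
      \<open>Bad\<close>.\<close>
    define Bad where "Bad = U - Good v"
    have "Frot E L U v Bad \<inter> Xa = {}"
      unfolding Frot_def Bad_def Good_def D_def by blast
    moreover have "Bad \<subseteq> V" "v \<in> V" using UV v VsU by (auto simp: Bad_def)
    ultimately have noF: "real (card (Frot E L U v Bad)) < \<theta> * real n ^ r"
      using boost[OF L(1,2) cLn] UV unfolding boosted_def by (meson not_le)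
    let ?Z = "{(w, x). w \<in> ?R \<and> x \<in> {x \<in> N w \<inter> U. sc w x \<in> Bad}}"
    have bad: "real (card ?Z) < z"
    proof (rule ccontr)
      assume "\<not> ?thesis"
      then have "\<theta> * real n ^ r \<le> real (card (Frot E L U v Bad))"
      proof (intro many[of ?Z L])
        fix w x assume "(w, x) \<in> ?Z"
        then have w: "w \<in> ?R" and x: "x \<in> N w \<inter> U" and b: "sc w x \<in> Bad" by auto
        obtain i where i: "Suc i < length (P w)" "x = P w ! i" "sc w x = P w ! Suc i"
          using adjacent_in_nthD[OF sc[OF w x]] by auto
        define ys where "ys = drop (Suc i) (P w)"
        have Pw: "P w = take i (P w) @ x # ys"
          unfolding ys_def i(2) by (rule id_take_nth_drop) (use i in auto)
        have ys: "ys \<noteq> []" "hd ys = sc w x" "last ys = w"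
          using i P[OF w] by (auto simp: ys_def hd_drop_conv_nth)
        have "gpath (insert {w, x} D) (take i (P w) @ x # rev ys)"
        proof (rule gpath_rotate)
          show "gpath (insert {w, x} D) (take i (P w) @ x # ys)"
            unfolding Pw[symmetric] using P[OF w] by (auto intro: gpath_mono[of D])
        qed (use ys in auto)
        moreover have "set (take i (P w) @ x # rev ys) = U"
          using P[OF w] arg_cong[OF Pw, of set] by auto
        moreover have "hd (take i (P w) @ x # rev ys) = v"
          using P[OF w] arg_cong[OF Pw, of hd] by (cases "take i (P w)") auto
        moreover have "last (take i (P w) @ x # rev ys) = sc w x" using ys by (simp add: last_rev)
        ultimately have "sc w x \<in> Ends (insert {w, x} D) U v" by (rule EndsI)
        moreover have "card {w, x} = 2" using x N_irrefl[of w] by (subst card_2_iff) auto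
        ultimately have "\<forall>e\<in>E. {w, x} \<subseteq> e \<longrightarrow> e \<notin> fst ` L \<longrightarrow> e \<in> Frot E L U v Bad"
          using b unfolding Frot_def D_def by blast
        then show "\<exists>h. \<forall>e\<in>E. {w, x} \<subseteq> e \<longrightarrow> e \<notin> fst ` L \<longrightarrow> e \<noteq> h \<longrightarrow> e \<in> Frot E L U v Bad" by blast
      qed (use Ends_sub[of D U v] UV L cLn in auto)
      then show False using noF by simp
    qed
    have finR: "finite ?R" by (rule fE)
    have cS: "card {(w, x). w \<in> ?R \<and> x \<in> A w} = (\<Sum>w\<in>?R. card (A w))" if "\<And>w. finite (A w)" for A
    proof -
      have "{(w, x). w \<in> ?R \<and> x \<in> A w} = Sigma ?R A" by auto
      then show ?thesis using finR that by simp
    qed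
    have "(1 / 2 + \<epsilon> / 2) * real n * real (card ?R) = (\<Sum>w\<in>?R. (1 / 2 + \<epsilon> / 2) * real n)" by simp
    also have "\<dots> \<le> (\<Sum>w\<in>?R. real (card (N w)))"
      using Ends_sub[of D U v] UV by (intro sum_mono card_N) auto
    also have "\<dots> \<le> (\<Sum>w\<in>?R. real (card (N w - U)) + real (card {x \<in> N w \<inter> U. sc w x \<in> Bad}) + real (card (Good v)))"
    proof (rule sum_mono)
      fix w assume w: "w \<in> ?R"
      have "N w \<subseteq> (N w - U) \<union> {x \<in> N w \<inter> U. sc w x \<in> Bad} \<union> {x \<in> N w \<inter> U. sc w x \<in> Good v}"
        using scU[OF w] by (auto simp: Bad_def)
      then have "card (N w) \<le> card ((N w - U) \<union> {x \<in> N w \<inter> U. sc w x \<in> Bad} \<union> {x \<in> N w \<inter> U. sc w x \<in> Good v})"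
        by (intro card_mono) auto
      also have "\<dots> \<le> card ((N w - U) \<union> {x \<in> N w \<inter> U. sc w x \<in> Bad}) + card {x \<in> N w \<inter> U. sc w x \<in> Good v}"
        by (rule card_Un_le)
      also have "\<dots> \<le> card (N w - U) + card {x \<in> N w \<inter> U. sc w x \<in> Bad} + card {x \<in> N w \<inter> U. sc w x \<in> Good v}"
        by (intro add_mono card_Un_le) auto
      also have "card {x \<in> N w \<inter> U. sc w x \<in> Good v} \<le> card (Good v)"
      proof (rule card_inj_on_le[of "sc w"])
        show "inj_on (sc w) {x \<in> N w \<inter> U. sc w x \<in> Good v}"
          using scinj[OF w] by (rule inj_on_subset) auto
      qed (use finU in \<open>auto simp: Good_def\<close>)
      finally show "real (card (N w)) \<le> real (card (N w - U)) + real (card {x \<in> N w \<inter> U. sc w x \<in> Bad}) + real (card (Good v))"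
        by linarith
    qed
    also have "\<dots> = real (card {(w, y). w \<in> ?R \<and> y \<in> N w - U}) + real (card ?Z) + real (card ?R) * real (card (Good v))"
      by (subst (1 2) cS) (auto simp: sum.distrib)
    also have "\<dots> \<le> z + z + real (card ?R) * real (card (Good v))"
      using out[OF v] bad by linarith
    also have "\<dots> \<le> real (card ?R) * (\<epsilon> / 4 * real n) + real (card ?R) * real (card (Good v))"
    proof -
      have "z + z = c * real n * (\<epsilon> / 4 * real n)" by (simp add: z_def power2_eq_square)
      also have "\<dots> \<le> real (card ?R) * (\<epsilon> / 4 * real n)"
        using bigE[OF v] eps by (intro mult_right_mono) auto
      finally show ?thesis by simp
    qed
    finally have "real (card ?R) * ((1 / 2 + \<epsilon> / 4) * real n) \<le> real (card ?R) * real (card (Good v))"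
      by (simp add: algebra_simps)
    moreover have "0 < c * real n" using c n6 by simp
    then have "0 < real (card ?R)" using bigE[OF v] by linarith
    ultimately show ?thesis by simp
  qed
  have GoodU: "Good v \<subseteq> U" for v by (auto simp: Good_def)
  have Ubig: "(1 / 2 + \<epsilon> / 4) * real n \<le> real k"
  proof -
    have "Vs \<noteq> {}" using bigVs c n6 by (metis card.empty less_eq_real_def mult_nonneg_nonneg not_le of_nat_0 of_nat_0_le_iff)
    then obtain v where "v \<in> Vs" by auto
    then have "(1 / 2 + \<epsilon> / 4) * real n \<le> real (card (Good v))" by (rule good)
    also have "\<dots> \<le> real k" using card_mono[OF finU GoodU] cardU by simp
    finally show ?thesis .
  qed
  have k3: "3 \<le> k"
  proof -
    have "3 \<le> 1 / 2 * real n" using n6 by simp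
    also have "\<dots> \<le> (1 / 2 + \<epsilon> / 4) * real n" using eps by (intro mult_right_mono) auto
    finally show ?thesis using Ubig by linarith
  qed
  have close: "Fclose E L U Xa \<inter> Xb \<noteq> {}"
  proof -
    let ?Z = "Sigma Vs (\<lambda>v. N v \<inter> Good v)"
    have finVs: "finite Vs" unfolding Vs_def by (rule fE)
    \<comment> \<open>Both sets exceed half of the vertices, so their surpluses
      \<open>\<epsilon> / 2\<close> and \<open>\<epsilon> / 4\<close> reappear in the
      intersection.\<close>
    have each: "\<epsilon> / 2 * real n \<le> real (card (N v \<inter> Good v))" if v: "v \<in> Vs" for v
    proof -
      have "v \<in> V" using v VsU UV by auto
      have "card (N v) + card (Good v) = card (N v \<union> Good v) + card (N v \<inter> Good v)"
        by (intro card_Un_Int finN finite_subset[OF GoodU finU])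
      moreover have "card (N v \<union> Good v) \<le> n" using N_sub[of v] GoodU[of v] UV by (intro card_mono) auto
      ultimately have "real (card (N v)) + real (card (Good v)) \<le> real n + real (card (N v \<inter> Good v))"
        by linarith
      moreover have "0 \<le> \<epsilon> * real n" using eps by simp
      ultimately show ?thesis using card_N[OF \<open>v \<in> V\<close>] good[OF v] by (simp add: algebra_simps)
    qed
    have "z \<le> c * real n * (\<epsilon> / 2 * real n)" using c eps by (simp add: z_def power2_eq_square)
    also have "\<dots> \<le> real (card Vs) * (\<epsilon> / 2 * real n)"
      using bigVs eps by (intro mult_right_mono) auto
    also have "\<dots> = (\<Sum>v\<in>Vs. \<epsilon> / 2 * real n)" by simp
    also have "\<dots> \<le> (\<Sum>v\<in>Vs. real (card (N v \<inter> Good v)))" by (intro sum_mono each)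
    also have "\<dots> = real (card ?Z)" using finVs by (simp flip: of_nat_sum)
    finally have zZ: "z \<le> real (card ?Z)" .
    have "\<theta> * real n ^ r \<le> real (card (Fclose E L U Xa))"
    proof (rule many[OF _ _ zZ])
      fix v y assume "(v, y) \<in> ?Z"
      then have v: "v \<in> Vs" and y: "y \<in> N v" "y \<in> Good v" by auto
      obtain h q p' where h: "h \<in> Xa - fst ` L" "q \<subseteq> h" "card q = 2" "gpath (insert q D) p'" "set p' = U" "hd p' = v" "last p' = y"
        using y(2) by (auto simp: Good_def Ends_def)
      have cyc: "gcycle (insert {v, y} (insert q D)) p'"
        using h k3 lenq[OF h(4,5)] by (auto simp: gcycle_def insert_commute intro: gpath_mono[OF h(4)])
      have c2: "card {v, y} = 2" using y N_irrefl[of v] by (subst card_2_iff) auto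
      have "e \<in> Fclose E L U Xa" if e: "e \<in> E" "{v, y} \<subseteq> e" "e \<notin> fst ` L" "e \<noteq> h" for e
        unfolding Fclose_def
      proof (intro CollectI conjI bexI[of _ h])
        show "\<exists>q\<subseteq>h. \<exists>q'\<subseteq>e. card q = 2 \<and> card q' = 2 \<and>
          (\<exists>p. gcycle (insert q' (insert q (snd ` L))) p \<and> set p = U)"
          using h c2 e cyc by (intro exI[of _ q] exI[of _ "{v, y}"] conjI exI[of _ p']) (auto simp: D_def)
      qed (use e h in auto)
      then show "\<exists>h. \<forall>e\<in>E. {v, y} \<subseteq> e \<longrightarrow> e \<notin> fst ` L \<longrightarrow> e \<noteq> h \<longrightarrow> e \<in> Fclose E L U Xa" by blast
    qed (use VsU UV L cLn in auto)
    then show ?thesis using boost[OF L(1,2) cLn] UV by (simp add: boosted_def)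
  qed
  then obtain f h q q' pc where f: "f \<in> Xb" "f \<notin> fst ` L" and h: "h \<in> Xa" "h \<notin> fst ` L" "h \<noteq> f"
    and q: "q \<subseteq> h" "card q = 2" "q' \<subseteq> f" "card q' = 2"
    and pc: "gcycle (insert q' (insert q (snd ` L))) pc" "set pc = U"
    unfolding Fclose_def by blast
  define L2 where "L2 = insert (f, q') (insert (h, q) L)"
  have L2: "L0 \<subseteq> L2" "labelling \<Gamma> L2"
    using L f h q \<Gamma> unfolding L2_def by (auto intro!: labelling_insert)
  have cL2: "card (L2 - L0) \<le> 3 * k + 2"
  proof -
    have "card (L2 - L0) \<le> card (insert (f, q') (insert (h, q) (L - L0)))"
      using finL[OF L(2)] by (intro card_mono) (auto simp: L2_def)
    also have "\<dots> \<le> Suc (Suc (card (L - L0)))"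
      using finL[OF L(2)] by (simp add: card_insert_if)
    finally show ?thesis using L(3) by simp
  qed
  have pc2: "gcycle (snd ` L2) pc" using pc by (simp add: L2_def)
  show ?thesis
  proof (cases "U = V")
    case True
    then show ?thesis using gcycle_berge[OF pc2 L2(2)] pc(2) by simp
  next
    case False
    define W where "W = V - U"
    have W: "W \<noteq> {}" "finite W" using False UV by (auto simp: W_def)
    have cW: "card W = n - k" unfolding W_def using finU UV cardU by (simp add: card_Diff_subset)
    have openc: "\<exists>q. gpath (insert {u, y} D') (q @ [y]) \<and> set (q @ [y]) \<subseteq> V \<and> length (q @ [y]) = Suc k"
      if uU: "u \<in> U" and "y \<in> W" "snd ` L2 \<subseteq> D'" for u y D'
    proof -
      obtain q where q: "gpath (snd ` L2) q" "set q = U" "length q = length pc" "last q = u"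
        using gcycle_open[OF pc2, of u] uU unfolding pc(2) by blast
      have "gpath (insert {u, y} D') (q @ [y])"
        using q that by (intro gpath_snoc gpath_mono[OF q(1)]) (auto simp: W_def)
      moreover have "length pc = k" using pc2 pc(2) lenq[of "snd ` L2" pc] by (auto simp: gcycle_def)
      ultimately show ?thesis using q that pc(2) UV by (intro exI[of _ q]) (auto simp: W_def)
    qed
    show ?thesis
    \<comment> \<open>Few vertices outside \<open>U\<close> would give too few pairs for the
      threshold, but then the expander itself has an edge leaving \<open>W\<close>, at no extra
      cost. If \<open>W\<close> is large, each of its vertices has many Dirac neighbours in
      \<open>U\<close>, as \<open>U\<close> has more than half of the vertices.\<close>
    proof (cases "real (card W) \<le> c * real n")
      case True
      then have "2 * card W \<le> card (Nb (snd ` L0) W - W)"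
        using L0(2) W by (auto simp: expanding_def W_def)
      then have "Nb (snd ` L0) W - W \<noteq> {}" using W by (metis card.empty card_0_eq le_zero_eq mult_is_0 zero_neq_numeral)
      then obtain u y where uy: "y \<in> W" "u \<notin> W" "{y, u} \<in> snd ` L0" by (auto simp: Nb_def)
      then have "u \<in> U" using labV(1)[OF L0(1)] by (auto simp: W_def)
      then obtain q where "gpath (insert {u, y} (snd ` L2)) (q @ [y])" "set (q @ [y]) \<subseteq> V" "length (q @ [y]) = Suc k"
        using openc uy by blast
      moreover have "insert {u, y} (snd ` L2) = snd ` L2"
        using uy(3) L2(1) by (auto simp: insert_commute)
      ultimately have False using improve[of L2 "q @ [y]"] L2 cL2 by auto
      then show ?thesis ..
    next
      case bigW: False
      let ?Z = "Sigma W (\<lambda>w. N w \<inter> U)"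
      have each: "\<epsilon> / 2 * real n \<le> real (card (N w \<inter> U))" if w: "w \<in> W" for w
      proof -
        have "w \<in> V" using w by (auto simp: W_def)
        have "card (N w) \<le> card ((N w \<inter> U) \<union> W)"
          using W N_sub by (intro card_mono) (auto simp: W_def)
        also have "\<dots> \<le> card (N w \<inter> U) + card W" by (rule card_Un_le)
        finally have "real (card (N w)) \<le> real (card (N w \<inter> U)) + (real n - real k)"
          using cW kn by linarith
        moreover have "0 \<le> \<epsilon> * real n" using eps by simp
        ultimately show ?thesis using card_N[OF \<open>w \<in> V\<close>] Ubig by (simp add: algebra_simps)
      qed
      have "z \<le> c * real n * (\<epsilon> / 2 * real n)" using c eps by (simp add: z_def power2_eq_square)
      also have "\<dots> \<le> real (card W) * (\<epsilon> / 2 * real n)"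
        using bigW eps by (intro mult_right_mono) auto
      also have "\<dots> = (\<Sum>v\<in>W. \<epsilon> / 2 * real n)" by simp
      also have "\<dots> \<le> (\<Sum>v\<in>W. real (card (N v \<inter> U)))" by (intro sum_mono each)
      also have "\<dots> = real (card ?Z)" using W by (simp flip: of_nat_sum)
      finally have zZ: "z \<le> real (card ?Z)" .
      have "\<theta> * real n ^ r \<le> real (card (Fout V E L2 k))"
      proof (rule many[OF _ _ zZ])
        fix w u assume "(w, u) \<in> ?Z"
        then have w: "w \<in> W" and u: "u \<in> N w" "u \<in> U" by auto
        obtain q where q: "gpath (insert {u, w} (snd ` L2)) (q @ [w])" "set (q @ [w]) \<subseteq> V" "length (q @ [w]) = Suc k"
          using openc u w by blast
        have "card {u, w} = 2" using u N_irrefl[of w] by (subst card_2_iff) auto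
        then have "\<forall>e\<in>E. {w, u} \<subseteq> e \<longrightarrow> e \<notin> fst ` L2 \<longrightarrow> e \<in> Fout V E L2 k"
          using q unfolding Fout_def insert_commute[of w u] by blast
        then show "\<exists>h. \<forall>e\<in>E. {w, u} \<subseteq> e \<longrightarrow> e \<notin> fst ` L2 \<longrightarrow> e \<noteq> h \<longrightarrow> e \<in> Fout V E L2 k" by blast
      qed (use L2 cL2 kn in \<open>auto simp: W_def\<close>)
      then have "Fout V E L2 k \<inter> Xb \<noteq> {}"
        using boost[OF L2] cL2 kn by (simp add: boosted_def)
      then have False by (rule hitout) (use L2 cL2 in auto)
      then show ?thesis ..
    qed
  qed
qed

end

section \<open>Hall's theorem and the sparse expander\<close>

text \<open>Induction on the index set. If a proper nonempty subfamily is tight, represent it first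
  and the rest outside its union. Otherwise every proper nonempty subfamily has an element to spare,
  and any representative of one index can be removed.\<close>

lemma hall:
  assumes "finite I" and "\<And>i. i \<in> I \<Longrightarrow> finite (A i)"
    and "\<And>J. J \<subseteq> I \<Longrightarrow> card J \<le> card (\<Union>(A ` J))"
  shows "\<exists>f. inj_on f I \<and> (\<forall>i\<in>I. f i \<in> A i)"
  using assms
proof (induction "card I" arbitrary: I A rule: less_induct)
  case (less I A)
  note IH = less.hyps and finI = less.prems(1) and finA = less.prems(2) and H = less.prems(3)
  have finU: "finite (\<Union>(A ` J))" if "J \<subseteq> I" for J
    using that finA finI by (auto intro: finite_subset)
  show ?case
  proof (cases "I = {}")
    case False
    show ?thesis
    proof (cases "\<exists>J. J \<subseteq> I \<and> J \<noteq> {} \<and> J \<noteq> I \<and> card (\<Union>(A ` J)) \<le> card J")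
      case True
      then obtain J where J: "J \<subseteq> I" "J \<noteq> {}" "J \<noteq> I" "card (\<Union>(A ` J)) \<le> card J" by blast
      define U where "U = \<Union>(A ` J)"
      have finJ: "finite J" using J(1) finI by (rule finite_subset)
      have "card J < card I" using J finI by (intro psubset_card_mono) auto
      then have "\<exists>f. inj_on f J \<and> (\<forall>i\<in>J. f i \<in> A i)"
        by (rule IH) (use finJ finA H J(1) in \<open>auto intro: order.trans\<close>)
      then obtain f where f: "inj_on f J" "\<forall>i\<in>J. f i \<in> A i" by blast
      have "card (I - J) < card I" using J finI finJ by (intro psubset_card_mono) auto
      then have "\<exists>g. inj_on g (I - J) \<and> (\<forall>i\<in>I - J. g i \<in> A i - U)"
      proof (rule IH)
        fix K assume K: "K \<subseteq> I - J"
        have finK: "finite K" using K finI finite_subset by blast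
        have "card J + card K = card (J \<union> K)" using K finJ finK by (intro card_Un_disjoint[symmetric]) auto
        also have "\<dots> \<le> card (\<Union>(A ` (J \<union> K)))" using K J(1) by (intro H) auto
        also have "\<Union>(A ` (J \<union> K)) = U \<union> (\<Union>i\<in>K. A i - U)" by (auto simp: U_def)
        also have "card \<dots> \<le> card U + card (\<Union>i\<in>K. A i - U)" by (rule card_Un_le)
        finally show "card K \<le> card (\<Union>i\<in>K. A i - U)" using J(4) by (simp add: U_def)
      qed (use finI finA in auto)
      then obtain g where g: "inj_on g (I - J)" "\<forall>i\<in>I - J. g i \<in> A i - U" by blast
      define h where "h i = (if i \<in> J then f i else g i)" for i
      have "inj_on h I"
      proof (rule inj_onI)
        fix x y assume xy: "x \<in> I" "y \<in> I" "h x = h y"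
        have fU: "f i \<in> U" if "i \<in> J" for i using f(2) that by (auto simp: U_def)
        show "x = y"
        proof (cases "x \<in> J"; cases "y \<in> J")
          assume "x \<in> J" "y \<in> J" then show ?thesis using xy f(1) by (simp add: h_def inj_on_eq_iff)
        next
          assume a: "x \<in> J" "y \<notin> J"
          then have "f x = g y" using xy by (simp add: h_def)
          then show ?thesis using fU[OF a(1)] g(2) xy a by (metis DiffE DiffI)
        next
          assume a: "x \<notin> J" "y \<in> J"
          then have "g x = f y" using xy by (simp add: h_def)
          then show ?thesis using fU[OF a(2)] g(2) xy a by (metis DiffE DiffI)
        next
          assume "x \<notin> J" "y \<notin> J" then show ?thesis using xy g(1) by (simp add: h_def inj_on_eq_iff)
        qed
      qed
      moreover have "\<forall>i\<in>I. h i \<in> A i" using f(2) g(2) by (simp add: h_def)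
      ultimately show ?thesis by blast
    next
      case no: False
      obtain i where i: "i \<in> I" using False by auto
      have "card {i} \<le> card (\<Union>(A ` {i}))" using i by (intro H) auto
      then have "A i \<noteq> {}" by auto
      then obtain x where x: "x \<in> A i" by auto
      have "card (I - {i}) < card I" using i finI by (intro psubset_card_mono) auto
      then have "\<exists>g. inj_on g (I - {i}) \<and> (\<forall>j\<in>I - {i}. g j \<in> A j - {x})"
      proof (rule IH)
        fix K assume K: "K \<subseteq> I - {i}"
        show "card K \<le> card (\<Union>j\<in>K. A j - {x})"
        proof (cases "K = {}")
          case False
          have "K \<subseteq> I" "K \<noteq> I" using K i by auto
          then have "\<not> card (\<Union>(A ` K)) \<le> card K" using no False by blast
          moreover have "(\<Union>j\<in>K. A j - {x}) = \<Union>(A ` K) - {x}" by auto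
          then have "card (\<Union>(A ` K)) \<le> Suc (card (\<Union>j\<in>K. A j - {x}))"
            using finU[OF \<open>K \<subseteq> I\<close>] by (auto simp: card_Diff_singleton_if)
          ultimately show ?thesis by linarith
        qed simp
      qed (use finI finA in auto)
      then obtain g where g: "inj_on g (I - {i})" "\<forall>j\<in>I - {i}. g j \<in> A j - {x}" by blast
      have "inj_on (g(i := x)) I"
      proof (rule inj_onI)
        fix a b assume ab: "a \<in> I" "b \<in> I" "(g(i := x)) a = (g(i := x)) b"
        show "a = b"
        proof (cases "a = i"; cases "b = i")
          assume "a \<noteq> i" "b \<noteq> i" then show ?thesis using ab g(1) by (simp add: inj_on_eq_iff)
        next
          assume c: "a = i" "b \<noteq> i" then show ?thesis using ab g(2) by (metis DiffE DiffI fun_upd_apply singletonD singletonI)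
        next
          assume c: "a \<noteq> i" "b = i" then show ?thesis using ab g(2) by (metis DiffE DiffI fun_upd_apply singletonD singletonI)
        qed simp
      qed
      moreover have "\<forall>j\<in>I. (g(i := x)) j \<in> A j" using g(2) x by auto
      ultimately show ?thesis by blast
    qed
  qed auto
qed

text \<open>Hall's condition for \<open>K\<close> copies of each vertex: the degrees over
  \<open>T\<close> sum to at least \<open>r * K * card T\<close>, and each hyperedge meeting
  \<open>T\<close> is counted at most \<open>r\<close> times.\<close>

lemma owners_exist:
  assumes fin: "finite X" "finite S" and r: "\<And>e. e \<in> X \<Longrightarrow> finite e \<and> card e = r" "0 < r"
    and deg: "\<And>v. v \<in> S \<Longrightarrow> r * K \<le> card {e \<in> X. v \<in> e}"
  shows "\<exists>f. inj_on f (S \<times> {..<K}) \<and> (\<forall>v\<in>S. \<forall>i<K. f (v, i) \<in> X \<and> v \<in> f (v, i))"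
proof -
  let ?A = "\<lambda>(v, i::nat). {e \<in> X. v \<in> e}"
  have "\<exists>f. inj_on f (S \<times> {..<K}) \<and> (\<forall>p\<in>S \<times> {..<K}. f p \<in> ?A p)"
  proof (rule hall)
    fix J assume J: "J \<subseteq> S \<times> {..<K}"
    define T where "T = fst ` J"
    have TS: "T \<subseteq> S" using J by (auto simp: T_def)
    then have finT: "finite T" using fin finite_subset by auto
    let ?U = "{e \<in> X. e \<inter> T \<noteq> {}}"
    have U: "\<Union>(?A ` J) = ?U" by (force simp: T_def)
    have "J \<subseteq> T \<times> {..<K}" using J by (force simp: T_def)
    then have "card J \<le> card (T \<times> {..<K})" using finT by (intro card_mono) auto
    then have "r * card J \<le> (\<Sum>v\<in>T. r * K)" using r by (simp add: card_cartesian_product)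
    also have "\<dots> \<le> (\<Sum>v\<in>T. card {e \<in> ?U. v \<in> e})"
    proof (rule sum_mono)
      fix v assume v: "v \<in> T"
      then have "{e \<in> ?U. v \<in> e} = {e \<in> X. v \<in> e}" by auto
      then show "r * K \<le> card {e \<in> ?U. v \<in> e}" using deg v TS by auto
    qed
    also have "\<dots> = (\<Sum>e\<in>?U. card {v \<in> T. v \<in> e})"
      by (rule sum_multicount_gen) (use finT fin in auto)
    also have "\<dots> \<le> (\<Sum>e\<in>?U. r)"
    proof (rule sum_mono)
      fix e assume "e \<in> ?U"
      then show "card {v \<in> T. v \<in> e} \<le> r" using r card_mono[of e "{v \<in> T. v \<in> e}"] by auto
    qed
    also have "\<dots> = r * card ?U" by simp
    finally show "card J \<le> card (\<Union>(?A ` J))" using r U by simp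
  qed (use fin in auto)
  then show ?thesis by fastforce
qed

definition owners :: "'a set set \<Rightarrow> 'a set \<Rightarrow> nat \<Rightarrow> ('a \<Rightarrow> ('a set \<times> 'a set) set) \<Rightarrow> bool" where
  "owners X S K Ow \<longleftrightarrow> labelling X (\<Union>(Ow ` S)) \<and> disjoint_family_on Ow S \<and>
     (\<forall>v\<in>S. finite (Ow v) \<and> card (Ow v) = K \<and> (\<forall>p\<in>Ow v. v \<in> snd p))"

lemma owners_labelled_exist:
  assumes fin: "finite X" "finite S" and r: "\<And>e. e \<in> X \<Longrightarrow> finite e \<and> card e = r" "2 \<le> r"
    and deg: "\<And>v. v \<in> S \<Longrightarrow> r * K \<le> card {e \<in> X. v \<in> e}"
  shows "\<exists>Ow. owners X S K Ow"
proof -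
  have "0 < r" using r(2) by simp
  then obtain f where f: "inj_on f (S \<times> {..<K})" "\<And>v i. v \<in> S \<Longrightarrow> i < K \<Longrightarrow> f (v, i) \<in> X \<and> v \<in> f (v, i)"
    using owners_exist[OF fin r(1) _ deg] by blast
  have "\<exists>w. w \<in> f (v, i) \<and> w \<noteq> v" if "v \<in> S" "i < K" for v i
  proof (rule ccontr)
    assume "\<not> ?thesis"
    then have "f (v, i) \<subseteq> {v}" by auto
    then have "card (f (v, i)) \<le> 1" using card_mono[of "{v}" "f (v, i)"] by auto
    then show False using r f(2)[OF that] by auto
  qed
  then obtain w where w: "\<And>v i. v \<in> S \<Longrightarrow> i < K \<Longrightarrow> w v i \<in> f (v, i) \<and> w v i \<noteq> v" by metis
  define Ow where "Ow v = (\<lambda>i. (f (v, i), {v, w v i})) ` {..<K}" for v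
  have feq: "v = u \<and> i = j" if "v \<in> S" "u \<in> S" "i < K" "j < K" "f (v, i) = f (u, j)" for v u i j
    using inj_onD[OF f(1) that(5)] that by auto
  have "card {v, w v i} = 2" if "v \<in> S" "i < K" for v i
    using w[OF that] by (subst card_2_iff) auto
  then have "\<Union>(Ow ` S) \<subseteq> labelled X"
    using f(2) w by (force simp: Ow_def labelled_def)
  moreover have "inj_on fst (\<Union>(Ow ` S))"
  proof (rule inj_onI)
    fix p q assume "p \<in> \<Union>(Ow ` S)" "q \<in> \<Union>(Ow ` S)" "fst p = fst q"
    then obtain v i u j where "v \<in> S" "i < K" "p = (f (v, i), {v, w v i})" "u \<in> S" "j < K" "q = (f (u, j), {u, w u j})" "f (v, i) = f (u, j)"
      by (auto simp: Ow_def)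
    then show "p = q" using feq[of v u i j] by simp
  qed
  moreover have "disjoint_family_on Ow S"
    unfolding disjoint_family_on_def
  proof (intro ballI impI)
    fix v u assume vu: "v \<in> S" "u \<in> S" "v \<noteq> u"
    show "Ow v \<inter> Ow u = {}"
    proof (rule ccontr)
      assume "Ow v \<inter> Ow u \<noteq> {}"
      then obtain i j where "i < K" "j < K" "f (v, i) = f (u, j)" by (auto simp: Ow_def)
      then show False using feq[of v u i j] vu by blast
    qed
  qed
  moreover have "card (Ow v) = K" if "v \<in> S" for v
  proof -
    have "inj_on (\<lambda>i. (f (v, i), {v, w v i})) {..<K}"
      by (rule inj_onI) (use feq[of v v] that in blast)
    then show ?thesis by (simp add: Ow_def card_image)
  qed
  ultimately have "owners X S K Ow" by (auto simp: owners_def labelling_def Ow_def)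
  then show ?thesis by blast
qed

text \<open>\<open>Q\<close> will be the large family owned in \<open>x0\<close>, and
  \<open>L\<close> the few hyperedges that are enumerated. On a conflict \<open>L\<close> wins,
  since the labels at the small vertices must survive.\<close>

definition extend :: "('a set \<times> 'a set) set \<Rightarrow> ('a set \<times> 'a set) set \<Rightarrow> ('a set \<times> 'a set) set" where
  "extend Q L = {p \<in> Q. fst p \<notin> fst ` L} \<union> L"

lemma labelling_extend:
  assumes "labelling \<Gamma> Q" and "labelling \<Gamma> L"
  shows "labelling \<Gamma> (extend Q L)"
proof -
  have "inj_on fst (extend Q L)"
    unfolding extend_def
  proof (rule inj_onI)
    fix x y assume "x \<in> {p \<in> Q. fst p \<notin> fst ` L} \<union> L" "y \<in> {p \<in> Q. fst p \<notin> fst ` L} \<union> L" "fst x = fst y"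
    then have "x \<in> Q \<and> y \<in> Q \<or> x \<in> L \<and> y \<in> L" by (metis (no_types, lifting) UnE imageI mem_Collect_eq)
    then show "x = y" using assms \<open>fst x = fst y\<close> by (auto simp: labelling_def dest: inj_onD)
  qed
  then show ?thesis using assms by (auto simp: labelling_def extend_def)
qed

text \<open>Brings every labelling met in the extremal argument into the form
  \<open>extend Q M\<close> with a small \<open>M\<close>. Members of \<open>L\<close> beyond
  \<open>extend Q L0\<close> use hyperedges not labelled there, so they override nothing in
  \<open>Q\<close>.\<close>

lemma extend_enlarge:
  assumes "extend Q L0 \<subseteq> L" and "inj_on fst L"
  shows "extend Q (L0 \<union> (L - extend Q L0)) = L"
proof -
  let ?M = "L - extend Q L0"
  have "fst p \<notin> fst ` ?M" if "p \<in> Q" for p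
  proof
    assume "fst p \<in> fst ` ?M"
    then obtain m where m: "m \<in> ?M" "fst m = fst p" by auto
    have "fst p \<in> fst ` extend Q L0"
      using that by (cases "fst p \<in> fst ` L0") (auto simp: extend_def)
    then obtain y where "y \<in> extend Q L0" "fst y = fst m" using m by auto
    then have "y = m" using assms m by (metis DiffD1 inj_onD subsetD)
    then show False using m \<open>y \<in> extend Q L0\<close> by auto
  qed
  then have "extend Q (L0 \<union> ?M) = {p \<in> Q. fst p \<notin> fst ` L0} \<union> (L0 \<union> ?M)"
    by (auto simp: extend_def)
  also have "\<dots> = L" using assms(1) by (auto simp: extend_def)
  finally show ?thesis .
qed

text \<open>The four hyperedges need not be distinct, so shorter chains are excluded as well.\<close>

definition far_apart :: "'a set set \<Rightarrow> 'a set \<Rightarrow> bool" where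
  "far_apart \<Gamma> S \<longleftrightarrow> (\<forall>s\<in>S. \<forall>s'\<in>S. \<forall>e1\<in>\<Gamma>. \<forall>e2\<in>\<Gamma>. \<forall>e3\<in>\<Gamma>. \<forall>e4\<in>\<Gamma>.
     s \<in> e1 \<longrightarrow> e1 \<inter> e2 \<noteq> {} \<longrightarrow> e2 \<inter> e3 \<noteq> {} \<longrightarrow> e3 \<inter> e4 \<noteq> {} \<longrightarrow> s' \<in> e4 \<longrightarrow> s = s')"

section \<open>Expansion of the sparse graph\<close>

context dirac_hypergraph
begin

text \<open>The factor 7 forces a set of large vertices together with its neighbours to be seven
  times its size. Of the six outside neighbours per vertex, three may be near small vertices, one
  compensates for large vertices that are partners of small ones, and two give the
  expansion.\<close>

definition locally_sparse :: "real \<Rightarrow> nat \<Rightarrow> 'a set set \<Rightarrow> bool" where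
  "locally_sparse c k \<Gamma> \<longleftrightarrow> (\<forall>T\<subseteq>V. T \<noteq> {} \<longrightarrow> real (card T) \<le> c * real n \<longrightarrow>
     7 * card {e \<in> \<Gamma>. 2 \<le> card (e \<inter> T)} < k * card T)"

text \<open>Large vertices expand by counting the hyperedges they own inside a locally sparse
  hypergraph, small ones through two private partners each. Being far apart keeps the two
  contributions almost disjoint.\<close>

lemma expander_exists:
  assumes \<Gamma>: "\<Gamma> \<subseteq> E" "X \<subseteq> \<Gamma>" and S: "S \<subseteq> V"
    and Ow: "owners X S (k + 2) Ow"
    and far: "far_apart \<Gamma> (V - S)"
    and sparse: "locally_sparse (7 * c) k \<Gamma>"
    and deg: "min_degree_at_least 2 V \<Gamma>"
  shows "\<exists>L1. labelling \<Gamma> L1 \<and> card L1 \<le> 2 * n \<and> expanding c (snd ` extend (\<Union>(Ow ` S)) L1)"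
proof -
  let ?Sm = "V - S"
  have finG: "finite \<Gamma>" using \<Gamma>(1) finE by (rule finite_subset)
  have ex1: "\<exists>a b. a \<in> \<Gamma> \<and> b \<in> \<Gamma> \<and> a \<noteq> b \<and> s \<in> a \<and> s \<in> b" if "s \<in> V" for s
  proof -
    have "2 \<le> card {e \<in> \<Gamma>. s \<in> e}" using deg that by (simp add: min_degree_at_least_def degree_def)
    then obtain B where "B \<subseteq> {e \<in> \<Gamma>. s \<in> e}" "card B = 2" by (rule obtain_subset_with_card_n)
    then show ?thesis by (force simp: card_2_iff)
  qed
  \<comment> \<open>Uniformity at least three enters here: the second hyperedge at a small vertex
    has a partner other than the one chosen in the first.\<close>
  have ex2: "\<exists>x\<in>e. x \<noteq> s \<and> x \<noteq> t" if "e \<in> \<Gamma>" for e s t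
  proof (rule ccontr)
    assume "\<not> ?thesis"
    then have "e \<subseteq> {s, t}" by auto
    then have "card e \<le> card {s, t}" by (intro card_mono) auto
    also have "\<dots> \<le> 2" by (simp add: card_insert_if)
    finally show False using E_card that \<Gamma>(1) r3 by auto
  qed
  have "\<exists>a b x y. a \<in> \<Gamma> \<and> b \<in> \<Gamma> \<and> a \<noteq> b \<and> s \<in> a \<and> s \<in> b \<and> x \<in> a \<and> y \<in> b \<and> x \<noteq> s \<and> y \<noteq> s \<and> x \<noteq> y"
    if "s \<in> V" for s
  proof -
    obtain a b where ab: "a \<in> \<Gamma>" "b \<in> \<Gamma>" "a \<noteq> b" "s \<in> a" "s \<in> b" using ex1[OF \<open>s \<in> V\<close>] by blast
    obtain x where x: "x \<in> a" "x \<noteq> s" using ex2[OF ab(1)] by blast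
    obtain y where "y \<in> b" "y \<noteq> s" "y \<noteq> x" using ex2[OF ab(2)] by blast
    then show ?thesis using ab x by blast
  qed
  then obtain a b x y where abxy: "\<And>s. s \<in> V \<Longrightarrow> a s \<in> \<Gamma> \<and> b s \<in> \<Gamma> \<and> a s \<noteq> b s \<and> s \<in> a s \<and> s \<in> b s \<and>
      x s \<in> a s \<and> y s \<in> b s \<and> x s \<noteq> s \<and> y s \<noteq> s \<and> x s \<noteq> y s"
    by metis
  have near: "s = s'" if "s \<in> ?Sm" "s' \<in> ?Sm" "e1 \<in> \<Gamma>" "e2 \<in> \<Gamma>" "e3 \<in> \<Gamma>" "e4 \<in> \<Gamma>"
    "s \<in> e1" "z \<in> e1" "z \<in> e2" "u \<in> e2" "u \<in> e3" "z' \<in> e3" "z' \<in> e4" "s' \<in> e4" for s s' e1 e2 e3 e4 u z z'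
    by (rule far[unfolded far_apart_def, rule_format, of s s' e1 e2 e3 e4]) (use that in blast)+
  have meet: "s = s'" if "s \<in> ?Sm" "s' \<in> ?Sm" "e \<in> \<Gamma>" "e' \<in> \<Gamma>" "s \<in> e" "s' \<in> e'" "u \<in> e" "u \<in> e'" for s s' e e' u
    using near[of s s' e e e' e' u u u] that by blast
  define L1 where "L1 = (\<lambda>s. (a s, {s, x s})) ` ?Sm \<union> (\<lambda>s. (b s, {s, y s})) ` ?Sm"
  have L1: "\<exists>s\<in>?Sm. p = (a s, {s, x s}) \<or> p = (b s, {s, y s})" if "p \<in> L1" for p
    using that by (auto simp: L1_def)
  have "labelling \<Gamma> L1"
    unfolding labelling_def
  proof
    have "card {s, x s} = 2" "card {s, y s} = 2" if "s \<in> V" for s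
      using abxy[OF that] by (auto simp: card_2_iff)
    then show "L1 \<subseteq> labelled \<Gamma>" using abxy by (auto simp: L1_def labelled_def)
    show "inj_on fst L1"
    proof (rule inj_onI)
      fix p q assume p: "p \<in> L1" and q: "q \<in> L1" and eq: "fst p = fst q"
      obtain s where s: "s \<in> ?Sm" "p = (a s, {s, x s}) \<or> p = (b s, {s, y s})" using L1[OF p] by blast
      obtain t where t: "t \<in> ?Sm" "q = (a t, {t, x t}) \<or> q = (b t, {t, y t})" using L1[OF q] by blast
      have "s \<in> fst p" "t \<in> fst q" "fst p \<in> \<Gamma>" using s t abxy by auto
      then have "s = t" using meet[of s t "fst p" "fst p" s] s t eq by simp
      then show "p = q" using s t eq abxy[of s] by auto
    qed
  qed
  moreover have "card L1 \<le> 2 * n"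
  proof -
    have c: "card ?Sm \<le> n" by (intro card_mono) auto
    have "card L1 \<le> card ((\<lambda>s. (a s, {s, x s})) ` ?Sm) + card ((\<lambda>s. (b s, {s, y s})) ` ?Sm)"
      unfolding L1_def by (rule card_Un_le)
    also have "\<dots> \<le> card ?Sm + card ?Sm" by (intro add_mono card_image_le) auto
    finally show ?thesis using c by simp
  qed
  moreover have "expanding c (snd ` extend (\<Union>(Ow ` S)) L1)"
    unfolding expanding_def
  proof (intro allI impI)
    define L where "L = extend (\<Union>(Ow ` S)) L1"
    have OwX: "labelling X (\<Union>(Ow ` S))" using Ow by (simp add: owners_def)
    then have "labelling \<Gamma> (\<Union>(Ow ` S))" using \<Gamma> by (auto simp: labelling_def labelled_def)
    then have Llab: "labelling \<Gamma> L" unfolding L_def using \<open>labelling \<Gamma> L1\<close> by (rule labelling_extend)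
    define D where "D = snd ` L"
    have Dedge: "\<exists>e\<in>\<Gamma>. q \<subseteq> e" if q: "q \<in> D" for q
    proof -
      obtain e where "(e, q) \<in> L" using q by (auto simp: D_def)
      then show ?thesis using Llab by (auto simp: labelling_def labelled_def)
    qed
    then have DV: "q \<subseteq> V" if "q \<in> D" for q using that \<Gamma>(1) E_sub by blast
    have NbV: "Nb D A \<subseteq> V" for A using DV by (auto simp: Nb_def)
    have finNb: "finite (Nb D A)" for A using NbV finV by (rule finite_subset)
    define O' where "O' v = {p \<in> Ow v. fst p \<notin> fst ` L1}" for v
    have O'L: "O' v \<subseteq> L" if "v \<in> S" for v using that by (auto simp: O'_def L_def extend_def)
    have finOw: "finite (Ow v)" "card (Ow v) = k + 2" "\<And>p. p \<in> Ow v \<Longrightarrow> v \<in> snd p" if "v \<in> S" for v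
      using Ow that by (auto simp: owners_def)
    \<comment> \<open>An owned hyperedge is lost only if it was also chosen at a small vertex. All
      those at \<open>v\<close> belong to the same small vertex, so at most two are lost; this
      explains \<open>k + 2\<close>.\<close>
    have cO': "k \<le> card (O' v)" if v: "v \<in> S" for v
    proof (cases "\<exists>p\<in>Ow v. fst p \<in> fst ` L1")
      case False
      then have "O' v = Ow v" by (auto simp: O'_def)
      then show ?thesis using finOw v by simp
    next
      case True
      have vfst: "v \<in> fst p \<and> fst p \<in> \<Gamma>" if "p \<in> Ow v" for p
        using that finOw(3)[OF v that] OwX v \<Gamma>(2) by (force simp: labelling_def labelled_def)
      obtain p0 where p0: "p0 \<in> Ow v" "fst p0 \<in> fst ` L1" using True by blast
      then obtain s where s: "s \<in> ?Sm" "fst p0 = a s \<or> fst p0 = b s" using L1 by fastforce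
      have "{p \<in> Ow v. fst p \<in> fst ` L1} \<subseteq> {p \<in> Ow v. fst p = a s} \<union> {p \<in> Ow v. fst p = b s}"
      proof clarsimp
        fix e q e' q' assume p: "(e, q) \<in> Ow v" and "(e, q') \<in> L1" "e \<noteq> b s"
        then obtain t where t: "t \<in> ?Sm" "e = a t \<or> e = b t" using L1 by fastforce
        have "s \<in> fst p0" "t \<in> e" using s t abxy by auto
        then have "s = t" using meet[of s t "fst p0" e v] s t vfst[OF p0(1)] vfst[OF p] by simp
        then show "e = a s" using t \<open>e \<noteq> b s\<close> by simp
      qed
      moreover have "card {p \<in> Ow v. fst p = e} \<le> 1" for e
      proof -
        have "inj_on fst (Ow v)" using OwX v by (auto simp: labelling_def intro: inj_on_subset)
        then have "card {p \<in> Ow v. fst p = e} = card (fst ` {p \<in> Ow v. fst p = e})"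
          by (intro card_image[symmetric]) (auto intro: inj_on_subset)
        also have "\<dots> \<le> card {e}" by (intro card_mono) auto
        finally show ?thesis by simp
      qed
      note le1 = this
      ultimately have "card {p \<in> Ow v. fst p \<in> fst ` L1} \<le> card ({p \<in> Ow v. fst p = a s} \<union> {p \<in> Ow v. fst p = b s})"
        using finOw(1)[OF v] by (intro card_mono) auto
      also have "\<dots> \<le> card {p \<in> Ow v. fst p = a s} + card {p \<in> Ow v. fst p = b s}" by (rule card_Un_le)
      also have "\<dots> \<le> 1 + 1" by (intro add_mono le1)
      finally have "card {p \<in> Ow v. fst p \<in> fst ` L1} \<le> 2" by simp
      moreover have "O' v = Ow v - {p \<in> Ow v. fst p \<in> fst ` L1}" by (auto simp: O'_def)
      ultimately show ?thesis using finOw[OF v] by (simp add: card_Diff_subset)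
    qed
    fix A assume A: "A \<subseteq> V" "A \<noteq> {}" "real (card A) \<le> c * real n"
    have finA: "finite A" using A(1) finV by (rule finite_subset)
    define Al where "Al = A \<inter> S"
    define As where "As = A - S"
    have fin: "finite Al" "finite As" using finA by (auto simp: Al_def As_def)
    have AsSm: "As \<subseteq> ?Sm" using A by (auto simp: As_def)
    have cA: "card A = card Al + card As"
      using card_Int_Diff[OF finA, of S] by (simp add: Al_def As_def)
    \<comment> \<open>The owned hyperedges put \<open>k * card Al\<close> hyperedges with two
      vertices into the closed neighbourhood. It may be seven times as large as \<open>Al\<close>,
      hence local sparsity is assumed up to \<open>7 * c\<close>; beyond that size the claim is
      immediate.\<close>
    have claimA: "7 * card Al \<le> card (Al \<union> Nb D Al)"
    proof (cases "Al = {}")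
      case False
      let ?T = "Al \<union> Nb D Al"
      have finT: "finite ?T" using fin finNb by auto
      show ?thesis
      proof (cases "real (card ?T) \<le> 7 * c * real n")
        case True
        let ?Q = "fst ` (\<Union>(O' ` Al))"
        have sub: "\<Union>(O' ` Al) \<subseteq> \<Union>(Ow ` S)" by (auto simp: O'_def Al_def)
        have "k * card Al = (\<Sum>v\<in>Al. k)" by simp
        also have "\<dots> \<le> (\<Sum>v\<in>Al. card (O' v))" by (intro sum_mono cO') (auto simp: Al_def)
        also have "\<dots> = card (\<Union>(O' ` Al))"
        proof (rule card_UN_disjoint[symmetric])
          show "\<forall>i\<in>Al. finite (O' i)" using finOw(1) by (auto simp: O'_def Al_def)
          have "disjoint_family_on Ow S" using Ow by (simp add: owners_def)
          then show "\<forall>i\<in>Al. \<forall>j\<in>Al. i \<noteq> j \<longrightarrow> O' i \<inter> O' j = {}"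
            unfolding disjoint_family_on_def O'_def Al_def by blast
        qed (use fin in auto)
        also have "\<dots> = card ?Q"
          using OwX sub by (intro card_image[symmetric]) (auto simp: labelling_def intro: inj_on_subset)
        also have "\<dots> \<le> card {e \<in> \<Gamma>. 2 \<le> card (e \<inter> ?T)}"
        proof (rule card_mono)
          show "?Q \<subseteq> {e \<in> \<Gamma>. 2 \<le> card (e \<inter> ?T)}"
          proof
            fix e assume "e \<in> ?Q"
            then obtain v q where v: "v \<in> Al" and p: "(e, q) \<in> O' v" by force
            have "v \<in> S" using v by (simp add: Al_def)
            have pL: "(e, q) \<in> L" using O'L[OF \<open>v \<in> S\<close>] p by auto
            then have e: "e \<in> \<Gamma>" "q \<subseteq> e" "card q = 2" "q \<in> D"
              using Llab by (auto simp: labelling_def labelled_def D_def intro: image_eqI[of _ _ "(e, q)"])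
            have "v \<in> q" using finOw(3)[OF \<open>v \<in> S\<close>, of "(e, q)"] p by (simp add: O'_def)
            then obtain w where "q = {v, w}" using e(3) by (auto simp: card_2_iff)
            then have "q \<subseteq> ?T" using v e(4) by (auto simp: Nb_def)
            then have "card q \<le> card (e \<inter> ?T)" using e finT by (intro card_mono) auto
            then show "e \<in> {e \<in> \<Gamma>. 2 \<le> card (e \<inter> ?T)}" using e by simp
          qed
        qed (use finG in auto)
        finally have "7 * (k * card Al) \<le> 7 * card {e \<in> \<Gamma>. 2 \<le> card (e \<inter> ?T)}" by simp
        also have "\<dots> < k * card ?T"
          by (rule sparse[unfolded locally_sparse_def, rule_format])
            (use True \<open>Al \<noteq> {}\<close> NbV A(1) in \<open>auto simp: Al_def\<close>)
        finally have "k * (7 * card Al) < k * card ?T" by (simp add: mult.left_commute)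
        then show ?thesis by simp
      next
        case False
        then show ?thesis using A(3) cA by linarith
      qed
    qed simp
    define W where "W = x ` ?Sm \<union> y ` ?Sm"
    have W: "\<exists>s\<in>?Sm. \<exists>e\<in>\<Gamma>. s \<in> e \<and> w \<in> e \<and> w \<in> {s, x s, y s}" if "w \<in> ?Sm \<union> W" for w
      using that abxy unfolding W_def by blast
    \<comment> \<open>Two neighbours of \<open>u\<close> that are small vertices or partners of such
      lead back to their small vertices along a chain of four hyperedges. So only one small vertex
      is involved, leaving itself and its two partners.\<close>
    have claimB: "card (Nb D {u} \<inter> (?Sm \<union> W)) \<le> 3" for u
    proof (cases "Nb D {u} \<inter> (?Sm \<union> W) = {}")
      case False
      have wit: "\<exists>s\<in>?Sm. \<exists>e1\<in>\<Gamma>. \<exists>e2\<in>\<Gamma>. s \<in> e1 \<and> w \<in> e1 \<and> w \<in> e2 \<and> u \<in> e2 \<and> w \<in> {s, x s, y s}"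
        if "w \<in> Nb D {u} \<inter> (?Sm \<union> W)" for w
      proof -
        have "{u, w} \<in> D" using that by (simp add: Nb_def)
        then obtain e2 where "e2 \<in> \<Gamma>" "u \<in> e2" "w \<in> e2" using Dedge by blast
        then show ?thesis using W[of w] that by blast
      qed
      obtain w0 where "w0 \<in> Nb D {u} \<inter> (?Sm \<union> W)" using False by blast
      from wit[OF this] obtain s e1 e2 where s: "s \<in> ?Sm" "e1 \<in> \<Gamma>" "e2 \<in> \<Gamma>" "s \<in> e1" "w0 \<in> e1" "w0 \<in> e2" "u \<in> e2"
        by blast
      have "Nb D {u} \<inter> (?Sm \<union> W) \<subseteq> {s, x s, y s}"
      proof
        fix w assume "w \<in> Nb D {u} \<inter> (?Sm \<union> W)"
        from wit[OF this] obtain t e3 e4 where t: "t \<in> ?Sm" "e3 \<in> \<Gamma>" "e4 \<in> \<Gamma>" "t \<in> e3" "w \<in> e3" "w \<in> e4" "u \<in> e4" "w \<in> {t, x t, y t}"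
          by blast
        have "s = t" using near[of s t e1 e2 e4 e3 w0 u w] s t by blast
        then show "w \<in> {s, x s, y s}" using t by simp
      qed
      then have "card (Nb D {u} \<inter> (?Sm \<union> W)) \<le> card {s, x s, y s}" by (intro card_mono) auto
      also have "\<dots> \<le> 3" by (simp add: card_insert_if)
      finally show ?thesis .
    qed simp
    have "Nb D Al \<inter> (?Sm \<union> W) = (\<Union>u\<in>Al. Nb D {u} \<inter> (?Sm \<union> W))" by (auto simp: Nb_def)
    then have "card (Nb D Al \<inter> (?Sm \<union> W)) \<le> (\<Sum>u\<in>Al. card (Nb D {u} \<inter> (?Sm \<union> W)))"
      using card_UN_le[OF fin(1)] by metis
    also have "\<dots> \<le> (\<Sum>u\<in>Al. 3)" by (intro sum_mono claimB)
    finally have claimB': "card (Nb D Al \<inter> (?Sm \<union> W)) \<le> 3 * card Al" by simp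
    define WA where "WA = x ` As \<union> y ` As"
    have xinj: "s = t" if "s \<in> ?Sm" "t \<in> ?Sm" and ne: "{x s, y s} \<inter> {x t, y t} \<noteq> {}" for s t
    proof -
      obtain u where u: "u \<in> {x s, y s}" "u \<in> {x t, y t}" using ne by blast
      have "\<exists>e\<in>\<Gamma>. s \<in> e \<and> u \<in> e" using abxy[of s] that(1) u(1) by auto
      moreover have "\<exists>e\<in>\<Gamma>. t \<in> e \<and> u \<in> e" using abxy[of t] that(2) u(2) by auto
      ultimately show ?thesis using meet[OF that(1,2)] by blast
    qed
    have cWA: "card WA = 2 * card As"
    proof -
      have "inj_on x As"
      proof (rule inj_onI)
        fix s t assume "s \<in> As" "t \<in> As" "x s = x t"
        then show "s = t" using xinj[of s t] AsSm by auto
      qed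
      moreover have "inj_on y As"
      proof (rule inj_onI)
        fix s t assume "s \<in> As" "t \<in> As" "y s = y t"
        then show "s = t" using xinj[of s t] AsSm by auto
      qed
      moreover have "x ` As \<inter> y ` As = {}"
      proof (rule ccontr)
        assume "x ` As \<inter> y ` As \<noteq> {}"
        then obtain s t where st: "s \<in> As" "t \<in> As" "x s = y t" by blast
        then have "s = t" using xinj[of s t] AsSm by blast
        then show False using st abxy[of s] AsSm by auto
      qed
      ultimately show ?thesis using fin unfolding WA_def
        by (subst card_Un_disjoint) (auto simp: card_image)
    qed
    have WSm: "W \<inter> ?Sm = {}"
    proof (rule ccontr)
      assume "W \<inter> ?Sm \<noteq> {}"
      then obtain s t where st: "s \<in> ?Sm" "t \<in> ?Sm" "t = x s \<or> t = y s" by (auto simp: W_def)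
      then have "s = t" using meet[OF st(1,2)] abxy[of s] abxy[of t] by blast
      then show False using st abxy[of s] by auto
    qed
    have WAW: "WA \<subseteq> W" using AsSm by (auto simp: WA_def W_def)
    have WAN: "WA \<subseteq> Nb D A"
    proof
      fix w assume "w \<in> WA"
      then obtain s where s: "s \<in> As" "w = x s \<or> w = y s" by (auto simp: WA_def)
      then have "s \<in> ?Sm" using AsSm by auto
      then have "(a s, {s, x s}) \<in> L" "(b s, {s, y s}) \<in> L" by (auto simp: L_def extend_def L1_def)
      then have "{s, w} \<in> D" using s(2) unfolding D_def by force
      then show "w \<in> Nb D A" using s(1) by (auto simp: Nb_def As_def)
    qed
    let ?B = "Nb D Al - Al - (?Sm \<union> W)"
    have sub: "(WA - Al) \<union> ?B \<subseteq> Nb D A - A"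
      using WAN WAW WSm A(1) by (auto simp: Al_def As_def Nb_def)
    have "6 * card Al \<le> card (Nb D Al - Al)"
    proof -
      have "Al \<union> Nb D Al = Al \<union> (Nb D Al - Al)" by auto
      then have "card (Al \<union> Nb D Al) \<le> card Al + card (Nb D Al - Al)" using card_Un_le by metis
      then show ?thesis using claimA by linarith
    qed
    moreover have "card (Nb D Al - Al) \<le> card ?B + card (Nb D Al \<inter> (?Sm \<union> W))"
    proof -
      have "card (Nb D Al - Al) \<le> card (?B \<union> (Nb D Al \<inter> (?Sm \<union> W)))"
        using finNb by (intro card_mono) auto
      also have "\<dots> \<le> card ?B + card (Nb D Al \<inter> (?Sm \<union> W))" by (rule card_Un_le)
      finally show ?thesis .
    qed
    ultimately have 1: "3 * card Al \<le> card ?B" using claimB' by linarith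
    have finWA: "finite WA" using fin by (simp add: WA_def)
    \<comment> \<open>Partners of small vertices may themselves be large and lie in
      \<open>A\<close>; this loss is absorbed by the third multiple of \<open>card Al\<close> in the
      previous bound.\<close>
    have 2: "2 * card As \<le> card (WA - Al) + card Al"
    proof -
      have "card WA \<le> card ((WA - Al) \<union> Al)" using finWA fin by (intro card_mono) auto
      also have "\<dots> \<le> card (WA - Al) + card Al" by (rule card_Un_le)
      finally show ?thesis using cWA by simp
    qed
    have "card (WA - Al) + card ?B = card ((WA - Al) \<union> ?B)"
      using finWA finNb WAW by (intro card_Un_disjoint[symmetric]) auto
    also have "\<dots> \<le> card (Nb D A - A)" using sub finNb by (intro card_mono) auto
    finally show "2 * card A \<le> card (Nb (snd ` extend (\<Union>(Ow ` S)) L1) A - A)"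
      using 1 2 cA by (simp add: D_def L_def)
  qed
  ultimately show ?thesis by blast
qed

end

section \<open>Independent random subsets\<close>

text \<open>The distribution of a random subset with independent inclusions, as a finite weight.
  Expectations become finite sums, so interchanging them and permuting the ground set are identities
  of sums.\<close>

definition wt :: "real \<Rightarrow> 'e set \<Rightarrow> 'e set \<Rightarrow> real" where
  "wt p E X = p ^ card X * (1 - p) ^ card (E - X)"

definition expec :: "real \<Rightarrow> 'e set \<Rightarrow> ('e set \<Rightarrow> real) \<Rightarrow> real" where
  "expec p E f = (\<Sum>X\<in>Pow E. wt p E X * f X)"

lemma sum_wt:
  assumes "finite E"
  shows "(\<Sum>X\<in>Pow E. (\<Prod>x\<in>X. f x) * (\<Prod>x\<in>E - X. g x)) = (\<Prod>x\<in>E. f x + g x :: real)"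
  using prod_add[OF assms, of f g] by simp

lemma expec_cylinder:
  assumes E: "finite E" and B: "B \<subseteq> E" and F: "F \<subseteq> E" and d: "B \<inter> F = {}"
  shows "expec p E (\<lambda>X. of_bool (B \<subseteq> X \<and> F \<inter> X = {})) = p ^ card B * (1 - p) ^ card F"
proof -
  let ?f = "\<lambda>x. if x \<in> F then 0 else p" and ?g = "\<lambda>x. if x \<in> B then 0 else 1 - p"
  have fin: "finite X" if "X \<subseteq> E" for X using that E finite_subset by auto
  have "wt p E X * of_bool (B \<subseteq> X \<and> F \<inter> X = {}) = (\<Prod>x\<in>X. ?f x) * (\<Prod>x\<in>E - X. ?g x)"
    if X: "X \<in> Pow E" for X
  proof (cases "B \<subseteq> X \<and> F \<inter> X = {}")
    case True
    then have "(\<Prod>x\<in>X. ?f x) = (\<Prod>x\<in>X. p)" "(\<Prod>x\<in>E - X. ?g x) = (\<Prod>x\<in>E - X. 1 - p)"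
      using True by (auto intro!: prod.cong simp del: prod_constant)
    then show ?thesis using True by (simp add: wt_def)
  next
    case False
    then consider y where "y \<in> B" "y \<notin> X" | y where "y \<in> F" "y \<in> X" by auto
    then have "(\<Prod>x\<in>X. ?f x) = 0 \<or> (\<Prod>x\<in>E - X. ?g x) = 0"
    proof cases
      case 1 then show ?thesis using B E by (auto simp: prod_zero_iff)
    next
      case 2 then show ?thesis using X fin[of X] by (auto simp: prod_zero_iff)
    qed
    then show ?thesis using False by auto
  qed
  then have "expec p E (\<lambda>X. of_bool (B \<subseteq> X \<and> F \<inter> X = {})) = (\<Prod>x\<in>E. ?f x + ?g x)"
    unfolding expec_def by (subst sum_wt[OF E, symmetric]) (rule sum.cong, auto)
  also have "\<dots> = (\<Prod>x\<in>E. (if x \<in> B then p else 1) * (if x \<in> F then 1 - p else 1))"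
    by (rule prod.cong) (use d in auto)
  also have "\<dots> = p ^ card B * (1 - p) ^ card F"
    using B F E by (simp add: prod.distrib prod.If_cases Int_absorb1)
  finally show ?thesis .
qed

text \<open>The generating function of the number of elements of \<open>B\<close> missed by
  \<open>X\<close>, a product over the elements. It allows a union of random sets to be integrated
  out one set at a time.\<close>

lemma expec_power_diff:
  assumes E: "finite E" and B: "B \<subseteq> E"
  shows "expec p E (\<lambda>X. c ^ card (B - X)) = (p + (1 - p) * c) ^ card B"
proof -
  let ?g = "\<lambda>x. if x \<in> B then (1 - p) * c else 1 - p"
  have "wt p E X * c ^ card (B - X) = (\<Prod>x\<in>X. p) * (\<Prod>x\<in>E - X. ?g x)" if "X \<in> Pow E" for X
  proof -
    have "(\<Prod>x\<in>E - X. ?g x) = (\<Prod>x\<in>E - X. (1 - p) * (if x \<in> B then c else 1))"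
      by (rule prod.cong) auto
    also have "\<dots> = (1 - p) ^ card (E - X) * c ^ card (B - X)"
    proof -
      have "(E - X) \<inter> B = B - X" using B by auto
      then show ?thesis using E by (simp add: prod.distrib prod.If_cases)
    qed
    finally show ?thesis by (simp add: wt_def)
  qed
  then have "expec p E (\<lambda>X. c ^ card (B - X)) = (\<Prod>x\<in>E. p + ?g x)"
    unfolding expec_def by (subst sum_wt[OF E, symmetric]) (rule sum.cong, auto)
  also have "\<dots> = (\<Prod>x\<in>E. if x \<in> B then p + (1 - p) * c else 1)"
    by (rule prod.cong) auto
  also have "\<dots> = (p + (1 - p) * c) ^ card B"
    using B E by (simp add: prod.If_cases Int_absorb1)
  finally show ?thesis .
qed

lemma expec_add: "expec p E (\<lambda>X. f X + g X) = expec p E f + expec p E g"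
  by (simp add: expec_def distrib_left sum.distrib)

lemma expec_cmult: "expec p E (\<lambda>X. c * f X) = c * expec p E f"
  by (simp add: expec_def sum_distrib_left mult.left_commute)

lemma expec_sum: "expec p E (\<lambda>X. \<Sum>i\<in>I. f i X) = (\<Sum>i\<in>I. expec p E (f i))"
  unfolding expec_def by (simp add: sum_distrib_left) (rule sum.swap)

lemma expec_swap: "expec p E (\<lambda>x. expec q E (\<lambda>y. f x y)) = expec q E (\<lambda>y. expec p E (\<lambda>x. f x y))"
  unfolding expec_def sum_distrib_left
  by (subst sum.swap) (simp add: mult.left_commute)

lemma expec_cong: "(\<And>X. X \<subseteq> E \<Longrightarrow> f X = g X) \<Longrightarrow> expec p E f = expec p E g"
  by (auto simp: expec_def intro!: sum.cong)

lemma expec_mono: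
  "0 \<le> p \<Longrightarrow> p \<le> 1 \<Longrightarrow> (\<And>X. X \<subseteq> E \<Longrightarrow> f X \<le> g X) \<Longrightarrow> expec p E f \<le> expec p E g"
  unfolding expec_def by (intro sum_mono mult_left_mono) (auto simp: wt_def)

lemma expec_const: "finite E \<Longrightarrow> expec p E (\<lambda>X. c) = c"
  using expec_cylinder[of E "{}" "{}" p] expec_cmult[of p E c "\<lambda>_. 1"] by simp

lemma expec_reindex:
  assumes "bij_betw \<tau> E E" and "finite E"
  shows "expec p E f = expec p E (\<lambda>X. f (\<tau> ` X))"
proof -
  have inj: "inj_on \<tau> X" if "X \<subseteq> E" for X using assms(1) that by (auto simp: bij_betw_def intro: inj_on_subset)
  have "wt p E (\<tau> ` X) = wt p E X" if "X \<in> Pow E" for X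
  proof -
    have "E - \<tau> ` X = \<tau> ` (E - X)"
      using that assms(1) by (metis PowD bij_betw_def inj_on_image_set_diff Diff_subset order_refl)
    then show ?thesis using that inj by (simp add: wt_def card_image)
  qed
  moreover have "bij_betw (image \<tau>) (Pow E) (Pow E)" using assms(1) by (rule bij_betw_Pow)
  ultimately show ?thesis
    unfolding expec_def by (subst sum.reindex_bij_betw[symmetric, of "image \<tau>" "Pow E" "Pow E"]) auto
qed

text \<open>Once the other sets are revealed, whether \<open>X\<close> covers the rest of \<open>B\<close> is independent of whether
  it avoids \<open>F\<close>.\<close>

lemma expec_avoid:
  assumes "finite E" "B \<subseteq> E" "F \<subseteq> E" "B \<inter> F = {}"
  shows "expec p E (\<lambda>X. of_bool (B \<subseteq> X \<union> W \<and> F \<inter> X = {})) =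
    (1 - p) ^ card F * expec p E (\<lambda>X. of_bool (B \<subseteq> X \<union> W))"
proof -
  have eq: "B \<subseteq> X \<union> W \<longleftrightarrow> B - W \<subseteq> X" for X by auto
  have "(B - W) \<inter> F = {}" using assms by auto
  then show ?thesis unfolding eq
    using expec_cylinder[of E "B - W" F p] expec_cylinder[of E "B - W" "{}" p] assms by fastforce
qed

lemma sum_power_card: "finite D \<Longrightarrow> (\<Sum>A\<in>Pow D. (x::real) ^ card A) = (1 + x) ^ card D"
  using sum_wt[of D "\<lambda>_. x" "\<lambda>_. 1"] by (simp add: add.commute)

text \<open>The parameters are rates: inclusion has probability \<open>1 - exp (- \<mu>)\<close>, so
  that rates of independent sets add up and avoiding \<open>F\<close> has probability exactly
  \<open>exp (- \<mu> * card F)\<close>.\<close>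

locale random_subsets =
  fixes E :: "'e set" and \<mu>0 \<mu>a \<mu>b \<mu>1 :: real
  assumes finE': "finite E" and mu: "0 \<le> \<mu>0" "0 \<le> \<mu>a" "0 \<le> \<mu>b" "0 \<le> \<mu>1"
begin

abbreviation "prb \<mu> \<equiv> 1 - exp (- (\<mu> :: real))"

definition expec4 :: "('e set \<Rightarrow> 'e set \<Rightarrow> 'e set \<Rightarrow> 'e set \<Rightarrow> real) \<Rightarrow> real" where
  "expec4 f = expec (prb \<mu>0) E (\<lambda>x0. expec (prb \<mu>a) E (\<lambda>xa. expec (prb \<mu>b) E (\<lambda>xb. expec (prb \<mu>1) E (\<lambda>x1. f x0 xa xb x1))))"

definition prob4 :: "('e set \<Rightarrow> 'e set \<Rightarrow> 'e set \<Rightarrow> 'e set \<Rightarrow> bool) \<Rightarrow> real" where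
  "prob4 P = expec4 (\<lambda>x0 xa xb x1. of_bool (P x0 xa xb x1))"

definition total :: real where "total = \<mu>0 + \<mu>a + \<mu>b + \<mu>1"

lemma prb: "0 \<le> \<mu> \<Longrightarrow> 0 \<le> prb \<mu>" "prb \<mu> \<le> 1" "prb \<mu> \<le> \<mu>" for \<mu> :: real
  using exp_ge_add_one_self[of "- \<mu>"] by auto

lemma expec4_mono:
  assumes "\<And>x0 xa xb x1. x0 \<subseteq> E \<Longrightarrow> xa \<subseteq> E \<Longrightarrow> xb \<subseteq> E \<Longrightarrow> x1 \<subseteq> E \<Longrightarrow> f x0 xa xb x1 \<le> g x0 xa xb x1"
  shows "expec4 f \<le> expec4 g"
  unfolding expec4_def by (intro expec_mono prb mu assms)

lemma expec4_cong:
  assumes "\<And>x0 xa xb x1. x0 \<subseteq> E \<Longrightarrow> xa \<subseteq> E \<Longrightarrow> xb \<subseteq> E \<Longrightarrow> x1 \<subseteq> E \<Longrightarrow> f x0 xa xb x1 = g x0 xa xb x1"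
  shows "expec4 f = expec4 g"
  using assms by (intro antisym expec4_mono) auto

lemma expec4_add: "expec4 (\<lambda>x0 xa xb x1. f x0 xa xb x1 + g x0 xa xb x1) = expec4 f + expec4 g"
  by (simp add: expec4_def expec_add)

lemma expec4_cmult: "expec4 (\<lambda>x0 xa xb x1. c * f x0 xa xb x1) = c * expec4 f"
  by (simp add: expec4_def expec_cmult)

lemma expec4_sum: "expec4 (\<lambda>x0 xa xb x1. \<Sum>i\<in>I. f i x0 xa xb x1) = (\<Sum>i\<in>I. expec4 (f i))"
  by (simp add: expec4_def expec_sum)

lemma expec4_const: "expec4 (\<lambda>x0 xa xb x1. c) = c"
  by (simp add: expec4_def expec_const finE')

lemma prob4_mono:
  assumes "\<And>x0 xa xb x1. x0 \<subseteq> E \<Longrightarrow> xa \<subseteq> E \<Longrightarrow> xb \<subseteq> E \<Longrightarrow> x1 \<subseteq> E \<Longrightarrow> P x0 xa xb x1 \<Longrightarrow> Q x0 xa xb x1"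
  shows "prob4 P \<le> prob4 Q"
  unfolding prob4_def by (intro expec4_mono) (use assms in auto)

lemma prob4_union:
  assumes "finite I"
    and "\<And>x0 xa xb x1. x0 \<subseteq> E \<Longrightarrow> xa \<subseteq> E \<Longrightarrow> xb \<subseteq> E \<Longrightarrow> x1 \<subseteq> E \<Longrightarrow> P x0 xa xb x1 \<Longrightarrow> \<exists>i\<in>I. Q i x0 xa xb x1"
  shows "prob4 P \<le> (\<Sum>i\<in>I. prob4 (Q i))"
proof -
  have "prob4 P \<le> expec4 (\<lambda>x0 xa xb x1. \<Sum>i\<in>I. of_bool (Q i x0 xa xb x1))"
    unfolding prob4_def
  proof (rule expec4_mono)
    fix x0 xa xb x1 assume x: "x0 \<subseteq> E" "xa \<subseteq> E" "xb \<subseteq> E" "x1 \<subseteq> E"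
    show "of_bool (P x0 xa xb x1) \<le> (\<Sum>i\<in>I. of_bool (Q i x0 xa xb x1) :: real)"
    proof (cases "P x0 xa xb x1")
      case True
      then obtain i where "i \<in> I" "Q i x0 xa xb x1" using assms(2)[OF x] by blast
      then show ?thesis
        using True member_le_sum[of i I "\<lambda>i. of_bool (Q i x0 xa xb x1) :: real"] assms(1) by auto
    qed (simp add: sum_nonneg)
  qed
  then show ?thesis by (simp add: expec4_sum prob4_def)
qed

lemma prob4_disj: "prob4 (\<lambda>x0 xa xb x1. P x0 xa xb x1 \<or> Q x0 xa xb x1) \<le> prob4 P + prob4 Q"
  unfolding prob4_def expec4_add[symmetric] by (rule expec4_mono) auto

lemma prob4_not: "prob4 (\<lambda>x0 xa xb x1. \<not> P x0 xa xb x1) = 1 - prob4 P"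
proof -
  have "1 = expec4 (\<lambda>x0 xa xb x1. of_bool (\<not> P x0 xa xb x1) + of_bool (P x0 xa xb x1))"
    by (subst expec4_const[symmetric]) (rule expec4_cong, auto)
  then show ?thesis by (simp add: expec4_add prob4_def)
qed

lemma expec_covers:
  assumes "B \<subseteq> E" and "0 \<le> \<mu>" and "0 \<le> c"
  shows "expec (prb \<mu>) E (\<lambda>X. c ^ card (B - W - X)) \<le> (\<mu> + c) ^ card (B - W)"
proof -
  have "expec (prb \<mu>) E (\<lambda>X. c ^ card (B - W - X)) = (prb \<mu> + (1 - prb \<mu>) * c) ^ card (B - W)"
    using assms by (intro expec_power_diff finE') auto
  also have "\<dots> \<le> (\<mu> + c) ^ card (B - W)"
  proof (rule power_mono)
    have "(1 - prb \<mu>) * c \<le> 1 * c" using assms prb[of \<mu>] by (intro mult_right_mono) auto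
    then show "prb \<mu> + (1 - prb \<mu>) * c \<le> \<mu> + c" using prb(3)[of \<mu>] by linarith
  qed (use assms prb[of \<mu>] in auto)
  finally show ?thesis .
qed

text \<open>The sets are integrated out from \<open>x1\<close> back to \<open>x0\<close>. At each
  stage an element not yet covered carries the sum of the rates already integrated, to which the
  next rate is added.\<close>

lemma prob4_cover:
  assumes B: "B \<subseteq> E"
  shows "prob4 (\<lambda>x0 xa xb x1. B \<subseteq> x0 \<union> xa \<union> xb \<union> x1) \<le> total ^ card B"
proof -
  have 1: "expec (prb \<mu>1) E (\<lambda>x1. of_bool (B \<subseteq> x0 \<union> xa \<union> xb \<union> x1)) \<le> \<mu>1 ^ card (B - x0 - xa - xb)" for x0 xa xb
  proof -
    have "expec (prb \<mu>1) E (\<lambda>x1. of_bool (B \<subseteq> x0 \<union> xa \<union> xb \<union> x1))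
        = expec (prb \<mu>1) E (\<lambda>x1. of_bool (B - x0 - xa - xb \<subseteq> x1 \<and> {} \<inter> x1 = {}))"
      by (rule arg_cong[of _ _ "expec (prb \<mu>1) E"]) (auto simp: fun_eq_iff)
    also have "\<dots> = prb \<mu>1 ^ card (B - x0 - xa - xb)"
      using B by (subst expec_cylinder[OF finE']) auto
    also have "\<dots> \<le> \<mu>1 ^ card (B - x0 - xa - xb)" using prb[of \<mu>1] mu by (intro power_mono) auto
    finally show ?thesis .
  qed
  have "prob4 (\<lambda>x0 xa xb x1. B \<subseteq> x0 \<union> xa \<union> xb \<union> x1)
    \<le> expec (prb \<mu>0) E (\<lambda>x0. expec (prb \<mu>a) E (\<lambda>xa. expec (prb \<mu>b) E (\<lambda>xb. \<mu>1 ^ card (B - (x0 \<union> xa) - xb))))"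
    unfolding prob4_def expec4_def by (intro expec_mono prb mu) (use 1 in \<open>auto simp: Diff_eq ac_simps\<close>)
  also have "\<dots> \<le> expec (prb \<mu>0) E (\<lambda>x0. expec (prb \<mu>a) E (\<lambda>xa. (\<mu>b + \<mu>1) ^ card (B - x0 - xa)))"
    by (intro expec_mono prb mu order.trans[OF expec_covers[OF B]]) (use mu in \<open>auto simp: Diff_eq ac_simps\<close>)
  also have "\<dots> \<le> expec (prb \<mu>0) E (\<lambda>x0. (\<mu>a + (\<mu>b + \<mu>1)) ^ card (B - {} - x0))"
    by (intro expec_mono prb mu order.trans[OF expec_covers[OF B]]) (use mu in auto)
  also have "\<dots> \<le> (\<mu>0 + (\<mu>a + (\<mu>b + \<mu>1))) ^ card (B - {})"
    using mu by (intro expec_covers[OF B]) auto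
  finally show ?thesis by (simp add: total_def add.assoc)
qed

lemma exp_card_le: "0 \<le> \<mu> \<Longrightarrow> f \<le> real k \<Longrightarrow> (1 - prb \<mu>) ^ k \<le> exp (- \<mu> * f)"
proof -
  assume "0 \<le> \<mu>" "f \<le> real k"
  then have "- \<mu> * real k \<le> - \<mu> * f" by (simp add: mult_left_mono)
  then show ?thesis by (simp add: exp_of_nat_mult[symmetric] mult.commute)
qed

lemma expec_hit:
  assumes "B \<subseteq> E" "\<Phi> \<subseteq> E" "B \<inter> \<Phi> = {}" "0 \<le> \<mu>"
  shows "expec (prb \<mu>) E (\<lambda>X. of_bool (B \<subseteq> X \<union> W \<and> f \<le> real (card \<Phi>) \<and> \<Phi> \<inter> X = {}))
     \<le> expec (prb \<mu>) E (\<lambda>X. exp (- \<mu> * f) * of_bool (B \<subseteq> X \<union> W))"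
proof (cases "f \<le> real (card \<Phi>)")
  case True
  then have "expec (prb \<mu>) E (\<lambda>X. of_bool (B \<subseteq> X \<union> W \<and> f \<le> real (card \<Phi>) \<and> \<Phi> \<inter> X = {}))
     = (1 - prb \<mu>) ^ card \<Phi> * expec (prb \<mu>) E (\<lambda>X. of_bool (B \<subseteq> X \<union> W))"
    using expec_avoid[OF finE' assms(1-3), of "prb \<mu>" W] by simp
  also have "\<dots> \<le> exp (- \<mu> * f) * expec (prb \<mu>) E (\<lambda>X. of_bool (B \<subseteq> X \<union> W))"
  proof (rule mult_right_mono)
    have "expec (prb \<mu>) E (\<lambda>X. 0) \<le> expec (prb \<mu>) E (\<lambda>X. of_bool (B \<subseteq> X \<union> W))"
      using prb assms by (intro expec_mono) auto
    then show "0 \<le> expec (prb \<mu>) E (\<lambda>X. of_bool (B \<subseteq> X \<union> W))" by (simp add: expec_const finE')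
  qed (rule exp_card_le[OF assms(4) True])
  finally show ?thesis by (simp add: expec_cmult)
next
  case False
  then show ?thesis using prb assms by (intro expec_mono) auto
qed

text \<open>\<open>B\<close> holds the enumerated hyperedges. The target depends on
  \<open>x0\<close> and \<open>xa\<close> only, so the expectation over \<open>xb\<close> is moved
  innermost; as \<open>B\<close> and the target are disjoint, missing the target is independent of
  what \<open>xb\<close> contributes to \<open>B\<close>, and both factors survive.\<close>

lemma prob4_hit_b:
  assumes B: "B \<subseteq> E" and \<Phi>: "\<And>x0 xa. \<Phi> x0 xa \<subseteq> E" "\<And>x0 xa. B \<inter> \<Phi> x0 xa = {}"
  shows "prob4 (\<lambda>x0 xa xb x1. B \<subseteq> x0 \<union> xa \<union> xb \<union> x1 \<and> f \<le> real (card (\<Phi> x0 xa)) \<and> \<Phi> x0 xa \<inter> xb = {})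
     \<le> total ^ card B * exp (- \<mu>b * f)"
proof -
  have sw: "expec4 g = expec (prb \<mu>0) E (\<lambda>x0. expec (prb \<mu>a) E (\<lambda>xa. expec (prb \<mu>1) E (\<lambda>x1. expec (prb \<mu>b) E (\<lambda>xb. g x0 xa xb x1))))" for g
    unfolding expec4_def by (subst expec_swap[of "prb \<mu>b" _ "prb \<mu>1"]) simp
  have "prob4 (\<lambda>x0 xa xb x1. B \<subseteq> x0 \<union> xa \<union> xb \<union> x1 \<and> f \<le> real (card (\<Phi> x0 xa)) \<and> \<Phi> x0 xa \<inter> xb = {})
    = expec (prb \<mu>0) E (\<lambda>x0. expec (prb \<mu>a) E (\<lambda>xa. expec (prb \<mu>1) E (\<lambda>x1. expec (prb \<mu>b) E (\<lambda>xb.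
       of_bool (B \<subseteq> xb \<union> (x0 \<union> xa \<union> x1) \<and> f \<le> real (card (\<Phi> x0 xa)) \<and> \<Phi> x0 xa \<inter> xb = {})))))"
    unfolding prob4_def sw by (intro expec_cong) (simp add: ac_simps)
  also have "\<dots> \<le> expec (prb \<mu>0) E (\<lambda>x0. expec (prb \<mu>a) E (\<lambda>xa. expec (prb \<mu>1) E (\<lambda>x1. expec (prb \<mu>b) E (\<lambda>xb.
       exp (- \<mu>b * f) * of_bool (B \<subseteq> xb \<union> (x0 \<union> xa \<union> x1))))))"
    by (intro expec_mono prb mu expec_hit B \<Phi>)
  also have "\<dots> = exp (- \<mu>b * f) * prob4 (\<lambda>x0 xa xb x1. B \<subseteq> x0 \<union> xa \<union> xb \<union> x1)"
    unfolding prob4_def sw expec_cmult by (simp add: ac_simps)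
  also have "\<dots> \<le> exp (- \<mu>b * f) * total ^ card B"
    by (intro mult_left_mono prob4_cover B) auto
  finally show ?thesis by (simp add: mult.commute)
qed

lemma prob4_hit_a:
  assumes B: "B \<subseteq> E" and \<Phi>: "\<And>x0. \<Phi> x0 \<subseteq> E" "\<And>x0. B \<inter> \<Phi> x0 = {}"
  shows "prob4 (\<lambda>x0 xa xb x1. B \<subseteq> x0 \<union> xa \<union> xb \<union> x1 \<and> f \<le> real (card (\<Phi> x0)) \<and> \<Phi> x0 \<inter> xa = {})
     \<le> total ^ card B * exp (- \<mu>a * f)"
proof -
  have sw: "expec4 g = expec (prb \<mu>0) E (\<lambda>x0. expec (prb \<mu>b) E (\<lambda>xb. expec (prb \<mu>1) E (\<lambda>x1. expec (prb \<mu>a) E (\<lambda>xa. g x0 xa xb x1))))" for g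
    unfolding expec4_def
    by (subst expec_swap[of "prb \<mu>a" _ "prb \<mu>b"], subst expec_swap[of "prb \<mu>a" _ "prb \<mu>1"]) simp
  have "prob4 (\<lambda>x0 xa xb x1. B \<subseteq> x0 \<union> xa \<union> xb \<union> x1 \<and> f \<le> real (card (\<Phi> x0)) \<and> \<Phi> x0 \<inter> xa = {})
    = expec (prb \<mu>0) E (\<lambda>x0. expec (prb \<mu>b) E (\<lambda>xb. expec (prb \<mu>1) E (\<lambda>x1. expec (prb \<mu>a) E (\<lambda>xa.
       of_bool (B \<subseteq> xa \<union> (x0 \<union> xb \<union> x1) \<and> f \<le> real (card (\<Phi> x0)) \<and> \<Phi> x0 \<inter> xa = {})))))"
    unfolding prob4_def sw by (intro expec_cong) (simp add: ac_simps)
  also have "\<dots> \<le> expec (prb \<mu>0) E (\<lambda>x0. expec (prb \<mu>b) E (\<lambda>xb. expec (prb \<mu>1) E (\<lambda>x1. expec (prb \<mu>a) E (\<lambda>xa.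
       exp (- \<mu>a * f) * of_bool (B \<subseteq> xa \<union> (x0 \<union> xb \<union> x1))))))"
    by (intro expec_mono prb mu expec_hit B \<Phi>)
  also have "\<dots> = exp (- \<mu>a * f) * prob4 (\<lambda>x0 xa xb x1. B \<subseteq> x0 \<union> xa \<union> xb \<union> x1)"
    unfolding prob4_def sw expec_cmult by (simp add: ac_simps)
  also have "\<dots> \<le> exp (- \<mu>a * f) * total ^ card B"
    by (intro mult_left_mono prob4_cover B) auto
  finally show ?thesis by (simp add: mult.commute)
qed

lemma prob4_hit_0:
  assumes B: "B \<subseteq> E" and F: "F \<subseteq> E" "B \<inter> F = {}"
  shows "prob4 (\<lambda>x0 xa xb x1. B \<subseteq> x0 \<union> xa \<union> xb \<union> x1 \<and> F \<inter> x0 = {})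
     \<le> total ^ card B * exp (- \<mu>0 * real (card F))"
proof -
  have sw: "expec4 g = expec (prb \<mu>a) E (\<lambda>xa. expec (prb \<mu>b) E (\<lambda>xb. expec (prb \<mu>1) E (\<lambda>x1. expec (prb \<mu>0) E (\<lambda>x0. g x0 xa xb x1))))" for g
    unfolding expec4_def
    by (subst expec_swap[of "prb \<mu>0" _ "prb \<mu>a"], subst expec_swap[of "prb \<mu>0" _ "prb \<mu>b"], subst expec_swap[of "prb \<mu>0" _ "prb \<mu>1"]) simp
  have "prob4 (\<lambda>x0 xa xb x1. B \<subseteq> x0 \<union> xa \<union> xb \<union> x1 \<and> F \<inter> x0 = {})
    = expec (prb \<mu>a) E (\<lambda>xa. expec (prb \<mu>b) E (\<lambda>xb. expec (prb \<mu>1) E (\<lambda>x1. expec (prb \<mu>0) E (\<lambda>x0.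
       of_bool (B \<subseteq> x0 \<union> (xa \<union> xb \<union> x1) \<and> real (card F) \<le> real (card F) \<and> F \<inter> x0 = {})))))"
    unfolding prob4_def sw by (intro expec_cong) (simp add: ac_simps)
  also have "\<dots> \<le> expec (prb \<mu>a) E (\<lambda>xa. expec (prb \<mu>b) E (\<lambda>xb. expec (prb \<mu>1) E (\<lambda>x1. expec (prb \<mu>0) E (\<lambda>x0.
       exp (- \<mu>0 * real (card F)) * of_bool (B \<subseteq> x0 \<union> (xa \<union> xb \<union> x1))))))"
    by (intro expec_mono prb mu expec_hit B F)
  also have "\<dots> = exp (- \<mu>0 * real (card F)) * prob4 (\<lambda>x0 xa xb x1. B \<subseteq> x0 \<union> xa \<union> xb \<union> x1)"
    unfolding prob4_def sw expec_cmult by (simp add: ac_simps)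
  also have "\<dots> \<le> exp (- \<mu>0 * real (card F)) * total ^ card B"
    by (intro mult_left_mono prob4_cover B) auto
  finally show ?thesis by (simp add: mult.commute)
qed

lemma prob4_x1:
  assumes "B \<subseteq> E" "F \<subseteq> E" "B \<inter> F = {}"
  shows "prob4 (\<lambda>x0 xa xb x1. B \<subseteq> x1 \<and> F \<inter> x1 = {}) \<le> \<mu>1 ^ card B * exp (- \<mu>1 * real (card F))"
proof -
  have "prob4 (\<lambda>x0 xa xb x1. B \<subseteq> x1 \<and> F \<inter> x1 = {}) = prb \<mu>1 ^ card B * (1 - prb \<mu>1) ^ card F"
    unfolding prob4_def expec4_def by (simp add: expec_const finE' expec_cylinder[OF finE' assms])
  also have "\<dots> \<le> \<mu>1 ^ card B * exp (- \<mu>1 * real (card F))"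
    using prb[of \<mu>1] mu by (intro mult_mono power_mono exp_card_le) auto
  finally show ?thesis .
qed

definition \<mu>i :: real where "\<mu>i = \<mu>0 + \<mu>a + \<mu>b"

lemma prob4_avoid:
  assumes "F \<subseteq> E"
  shows "prob4 (\<lambda>x0 xa xb x1. F \<inter> (x0 \<union> xa \<union> xb) = {}) = exp (- \<mu>i * real (card F))"
proof -
  have avoid: "expec (prb \<mu>) E (\<lambda>X. of_bool (F \<inter> X = {})) = exp (- \<mu> * real (card F))" for \<mu>
    using expec_cylinder[OF finE', of "{}" F "prb \<mu>"] assms by (simp add: exp_of_nat_mult[symmetric] mult.commute)
  have "prob4 (\<lambda>x0 xa xb x1. F \<inter> (x0 \<union> xa \<union> xb) = {})
    = expec4 (\<lambda>x0 xa xb x1. of_bool (F \<inter> x0 = {}) * (of_bool (F \<inter> xa = {}) * of_bool (F \<inter> xb = {})))"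
    unfolding prob4_def by (rule expec4_cong) (auto simp: Int_Un_distrib)
  also have "\<dots> = exp (- \<mu>0 * real (card F)) * (exp (- \<mu>a * real (card F)) * exp (- \<mu>b * real (card F)))"
    unfolding expec4_def expec_const[OF finE'] expec_cmult avoid
    by (simp only: mult.commute[of "of_bool _"] expec_cmult avoid) (simp only: mult.commute)
  finally show ?thesis by (simp add: \<mu>i_def exp_add[symmetric] algebra_simps)
qed

text \<open>Chebyshev's inequality for the number of classes \<open>D v\<close> that are avoided.\<close>

lemma prob4_no_avoid:
  fixes D :: "'v \<Rightarrow> 'e set"
  assumes V: "finite V" and D: "\<And>v. v \<in> V \<Longrightarrow> D v \<subseteq> E"
    and over: "\<And>u v. u \<in> V \<Longrightarrow> v \<in> V \<Longrightarrow> u \<noteq> v \<Longrightarrow> real (card (D u \<inter> D v)) \<le> \<kappa>"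
    and S: "S = (\<Sum>v\<in>V. exp (- \<mu>i * real (card (D v))))" "0 < S"
  shows "prob4 (\<lambda>x0 xa xb x1. \<forall>v\<in>V. D v \<inter> (x0 \<union> xa \<union> xb) \<noteq> {}) \<le> 1 / S + (exp (\<mu>i * \<kappa>) - 1)"
proof -
  define q where "q v = exp (- \<mu>i * real (card (D v)))" for v
  let ?I = "\<lambda>v x0 xa xb x1. of_bool (D v \<inter> (x0 \<union> xa \<union> xb) = {}) :: real"
  let ?Y = "\<lambda>x0 xa xb x1. \<Sum>v\<in>V. ?I v x0 xa xb x1"
  have mui: "0 \<le> \<mu>i" using mu by (simp add: \<mu>i_def)
  have E1: "expec4 (?I v) = q v" if "v \<in> V" for v
    using prob4_avoid[OF D[OF that]] by (simp add: prob4_def q_def)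
  have EY: "expec4 ?Y = S" unfolding expec4_sum using E1 by (simp add: S q_def)
  have E2: "expec4 (\<lambda>x0 xa xb x1. ?I u x0 xa xb x1 * ?I v x0 xa xb x1) \<le> (if u = v then q v else 0) + q u * q v * exp (\<mu>i * \<kappa>)"
    if uv: "u \<in> V" "v \<in> V" for u v
  proof -
    have fin: "finite (D u)" "finite (D v)" using D uv finE' finite_subset by metis+
    have "expec4 (\<lambda>x0 xa xb x1. ?I u x0 xa xb x1 * ?I v x0 xa xb x1) = prob4 (\<lambda>x0 xa xb x1. (D u \<union> D v) \<inter> (x0 \<union> xa \<union> xb) = {})"
      unfolding prob4_def by (rule expec4_cong) (auto simp: Int_Un_distrib2)
    also have "\<dots> = exp (- \<mu>i * real (card (D u \<union> D v)))" using D uv by (intro prob4_avoid) auto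
    also have "\<dots> \<le> (if u = v then q v else 0) + q u * q v * exp (\<mu>i * \<kappa>)"
    proof (cases "u = v")
      case True then show ?thesis by (simp add: q_def)
    next
      case False
      have "card (D u) + card (D v) = card (D u \<union> D v) + card (D u \<inter> D v)" using fin by (rule card_Un_Int)
      then have "real (card (D u)) + real (card (D v)) - \<kappa> \<le> real (card (D u \<union> D v))"
        using over[OF uv False] by linarith
      then have "\<mu>i * (real (card (D u)) + real (card (D v)) - \<kappa>) \<le> \<mu>i * real (card (D u \<union> D v))"
        using mui by (rule mult_left_mono)
      then have "exp (- \<mu>i * real (card (D u \<union> D v))) \<le> q u * q v * exp (\<mu>i * \<kappa>)"
        by (simp add: q_def exp_add[symmetric] algebra_simps)
      then show ?thesis using False by simp
    qed
    finally show ?thesis .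
  qed
  have sumq: "(\<Sum>v\<in>V. q v) = S" by (simp add: S q_def)
  have "expec4 (\<lambda>x0 xa xb x1. ?Y x0 xa xb x1 * ?Y x0 xa xb x1) = (\<Sum>u\<in>V. \<Sum>v\<in>V. expec4 (\<lambda>x0 xa xb x1. ?I u x0 xa xb x1 * ?I v x0 xa xb x1))"
    unfolding sum_product by (simp add: expec4_sum)
  also have "\<dots> \<le> (\<Sum>u\<in>V. \<Sum>v\<in>V. (if u = v then q v else 0) + q u * q v * exp (\<mu>i * \<kappa>))"
    by (intro sum_mono E2)
  also have "\<dots> = S + S * S * exp (\<mu>i * \<kappa>)"
    using V by (simp add: sum.distrib sum.delta sumq sum_distrib_left[symmetric] sum_distrib_right[symmetric])
  finally have EYY: "expec4 (\<lambda>x0 xa xb x1. ?Y x0 xa xb x1 * ?Y x0 xa xb x1) \<le> S + S * S * exp (\<mu>i * \<kappa>)" .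
  have "prob4 (\<lambda>x0 xa xb x1. \<forall>v\<in>V. D v \<inter> (x0 \<union> xa \<union> xb) \<noteq> {})
     \<le> expec4 (\<lambda>x0 xa xb x1. 1 / (S * S) * (?Y x0 xa xb x1 * ?Y x0 xa xb x1) + (- 2 / S * ?Y x0 xa xb x1 + 1))"
    unfolding prob4_def
  proof (rule expec4_mono)
    fix x0 xa xb x1
    \<comment> \<open>If no class is avoided, the count is zero and this squared relative deviation
      equals one.\<close>
    have "1 / (S * S) * (y * y) + (- 2 / S * y + 1) = ((y - S) / S)\<^sup>2" for y
      using S(2) by (simp add: power2_eq_square field_simps)
    then show "of_bool (\<forall>v\<in>V. D v \<inter> (x0 \<union> xa \<union> xb) \<noteq> {})
      \<le> 1 / (S * S) * (?Y x0 xa xb x1 * ?Y x0 xa xb x1) + (- 2 / S * ?Y x0 xa xb x1 + 1)"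
      using S(2) by (auto simp: power2_eq_square)
  qed
  also have "\<dots> = 1 / (S * S) * expec4 (\<lambda>x0 xa xb x1. ?Y x0 xa xb x1 * ?Y x0 xa xb x1) + (- 2 / S * S + 1)"
    by (simp only: expec4_add expec4_cmult expec4_const EY)
  also have "\<dots> \<le> 1 / (S * S) * (S + S * S * exp (\<mu>i * \<kappa>)) + (- 2 / S * S + 1)"
    using EYY S(2) by (intro add_right_mono mult_left_mono) auto
  also have "\<dots> = 1 / S + (exp (\<mu>i * \<kappa>) - 1)" using S(2) by (simp add: field_simps)
  finally show ?thesis .
qed

section \<open>Transfer to the random process\<close>

definition arrange :: "'e set \<Rightarrow> 'e set \<Rightarrow> 'e list \<Rightarrow> 'e list" where
  "arrange A B \<rho> = filter (\<lambda>e. e \<in> A) \<rho> @ filter (\<lambda>e. e \<notin> A \<and> e \<in> B) \<rho> @ filter (\<lambda>e. e \<notin> A \<and> e \<notin> B) \<rho>"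

lemma arrange_perm:
  assumes "\<rho> \<in> permutations_of_set E"
  shows "arrange A B \<rho> \<in> permutations_of_set E"
  using assms by (auto simp: permutations_of_set_def arrange_def)

lemma arrange_prefix:
  assumes "\<rho> \<in> permutations_of_set E" and "A \<subseteq> E" "B \<subseteq> E"
  shows "\<exists>i j. i \<le> j \<and> j \<le> length (arrange A B \<rho>) \<and> set (take i (arrange A B \<rho>)) = A \<and> set (take j (arrange A B \<rho>)) = A \<union> B"
proof -
  let ?i = "length (filter (\<lambda>e. e \<in> A) \<rho>)" and ?j = "length (filter (\<lambda>e. e \<notin> A \<and> e \<in> B) \<rho>)"
  have "set \<rho> = E" using assms by (simp add: permutations_of_set_def)
  then have p: "set (take ?i (arrange A B \<rho>)) = A" "set (take (?i + ?j) (arrange A B \<rho>)) = A \<union> B"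
    using assms by (auto simp: arrange_def)
  have "?i + ?j \<le> length (arrange A B \<rho>)" by (simp add: arrange_def)
  then show ?thesis using p le_add1 by blast
qed

lemma arrange_map:
  assumes "inj_on \<tau> E" "A \<subseteq> E" "B \<subseteq> E" "set \<rho> \<subseteq> E"
  shows "arrange (\<tau> ` A) (\<tau> ` B) (map \<tau> \<rho>) = map \<tau> (arrange A B \<rho>)"
proof -
  have "\<tau> e \<in> \<tau> ` C \<longleftrightarrow> e \<in> C" if "e \<in> set \<rho>" "C \<subseteq> E" for e C
    using that assms by (meson inj_on_image_mem_iff subsetD)
  then show ?thesis using assms(2,3) by (auto simp: arrange_def filter_map o_def cong: filter_cong)
qed

text \<open>Sorting a uniform ordering \<open>\<rho>\<close> by the random sets yields again a
  uniform ordering. Both distributions are invariant under permutations of \<open>E\<close>, and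
  some permutation maps any ordering to any other, so the expected number \<open>M\<close> of
  \<open>\<rho>\<close> arranged into a given ordering is constant; it sums to the number of
  orderings, hence equals one.\<close>

lemma transfer:
  assumes good: "\<And>x0 xa xb x1 \<sigma> i j. x0 \<subseteq> E \<Longrightarrow> xa \<subseteq> E \<Longrightarrow> xb \<subseteq> E \<Longrightarrow> x1 \<subseteq> E \<Longrightarrow> P x0 xa xb x1 \<Longrightarrow>
      \<sigma> \<in> permutations_of_set E \<Longrightarrow> i \<le> j \<Longrightarrow> j \<le> length \<sigma> \<Longrightarrow> set (take i \<sigma>) = x0 \<union> xa \<union> xb \<Longrightarrow>
      set (take j \<sigma>) = x0 \<union> xa \<union> xb \<union> x1 \<Longrightarrow> H \<sigma>"
  shows "prob4 P \<le> measure_pmf.prob (pmf_of_set (permutations_of_set E)) {\<sigma>. H \<sigma>}"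
proof -
  let ?S = "permutations_of_set E"
  have finS: "finite ?S" and neS: "?S \<noteq> {}" using finE' by auto
  define T where "T x0 xa xb x1 \<rho> = arrange (x0 \<union> xa \<union> xb) x1 \<rho>" for x0 xa xb x1 \<rho>
  define M where "M \<sigma> = expec4 (\<lambda>x0 xa xb x1. \<Sum>\<rho>\<in>?S. of_bool (T x0 xa xb x1 \<rho> = \<sigma>))" for \<sigma>
  have Meq: "M \<sigma> = M \<sigma>'" if s: "\<sigma> \<in> ?S" "\<sigma>' \<in> ?S" for \<sigma> \<sigma>'
  proof -
    have d: "distinct \<sigma>" "distinct \<sigma>'" "set \<sigma> = E" "set \<sigma>' = E" using s by (auto simp: permutations_of_set_def)
    then have len: "length \<sigma> = length \<sigma>'" by (metis distinct_card)
    define \<tau> where "\<tau> e = the (map_of (zip \<sigma> \<sigma>') e)" for e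
    have m: "map \<tau> \<sigma> = \<sigma>'"
    proof (rule nth_equalityI)
      fix i assume "i < length (map \<tau> \<sigma>)"
      then show "map \<tau> \<sigma> ! i = \<sigma>' ! i"
        using map_of_zip_nth[OF len d(1), of i] len by (simp add: \<tau>_def)
    qed (simp add: len)
    have inj: "inj_on \<tau> E" using d m by (metis distinct_map)
    have "\<tau> ` E = E" using d m by (metis list.set_map)
    then have bij: "bij_betw \<tau> E E" using inj by (simp add: bij_betw_def)
    have bijS: "bij_betw (map \<tau>) ?S ?S"
      unfolding bij_betw_def
    proof
      show injm: "inj_on (map \<tau>) ?S"
        by (rule inj_onI) (use inj in \<open>auto simp: permutations_of_set_def intro: map_inj_on\<close>)
      have "map \<tau> ` ?S \<subseteq> ?S"
        using inj \<open>\<tau> ` E = E\<close> by (auto simp: permutations_of_set_def distinct_map)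
      then show "map \<tau> ` ?S = ?S" using injm finS by (metis card_image card_subset_eq)
    qed
    have "M \<sigma>' = expec4 (\<lambda>x0 xa xb x1. \<Sum>\<rho>\<in>?S. of_bool (T (\<tau> ` x0) (\<tau> ` xa) (\<tau> ` xb) (\<tau> ` x1) \<rho> = \<sigma>'))"
      unfolding M_def expec4_def
      by (subst expec_reindex[OF bij finE', of "prb \<mu>0"], subst expec_reindex[OF bij finE', of "prb \<mu>a"],
          subst expec_reindex[OF bij finE', of "prb \<mu>b"], subst expec_reindex[OF bij finE', of "prb \<mu>1"]) (rule refl)
    also have "\<dots> = M \<sigma>"
      unfolding M_def
    proof (rule expec4_cong)
      fix x0 xa xb x1 assume x: "x0 \<subseteq> E" "xa \<subseteq> E" "xb \<subseteq> E" "x1 \<subseteq> E"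
      have "(\<Sum>\<rho>\<in>?S. of_bool (T (\<tau> ` x0) (\<tau> ` xa) (\<tau> ` xb) (\<tau> ` x1) \<rho> = \<sigma>') :: real)
        = (\<Sum>\<rho>\<in>?S. of_bool (T (\<tau> ` x0) (\<tau> ` xa) (\<tau> ` xb) (\<tau> ` x1) (map \<tau> \<rho>) = \<sigma>'))"
        by (rule sum.reindex_bij_betw[OF bijS, symmetric])
      also have "\<dots> = (\<Sum>\<rho>\<in>?S. of_bool (T x0 xa xb x1 \<rho> = \<sigma>))"
      proof (rule sum.cong[OF refl])
        fix \<rho> assume \<rho>: "\<rho> \<in> ?S"
        have "T (\<tau> ` x0) (\<tau> ` xa) (\<tau> ` xb) (\<tau> ` x1) (map \<tau> \<rho>) = map \<tau> (T x0 xa xb x1 \<rho>)"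
          unfolding T_def using arrange_map[OF inj, of "x0 \<union> xa \<union> xb" x1 \<rho>] x \<rho>
          by (simp add: image_Un permutations_of_set_def)
        moreover have "map \<tau> (T x0 xa xb x1 \<rho>) = map \<tau> \<sigma> \<longleftrightarrow> T x0 xa xb x1 \<rho> = \<sigma>"
          using bijS s(1) arrange_perm[OF \<rho>] unfolding T_def bij_betw_def by (meson inj_on_eq_iff)
        ultimately show "of_bool (T (\<tau> ` x0) (\<tau> ` xa) (\<tau> ` xb) (\<tau> ` x1) (map \<tau> \<rho>) = \<sigma>') = (of_bool (T x0 xa xb x1 \<rho> = \<sigma>) :: real)"
          using m by simp
      qed
      finally show "(\<Sum>\<rho>\<in>?S. of_bool (T (\<tau> ` x0) (\<tau> ` xa) (\<tau> ` xb) (\<tau> ` x1) \<rho> = \<sigma>') :: real) = (\<Sum>\<rho>\<in>?S. of_bool (T x0 xa xb x1 \<rho> = \<sigma>))" .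
    qed
    finally show ?thesis by simp
  qed
  have "(\<Sum>\<sigma>\<in>?S. M \<sigma>) = expec4 (\<lambda>x0 xa xb x1. \<Sum>\<sigma>\<in>?S. \<Sum>\<rho>\<in>?S. of_bool (T x0 xa xb x1 \<rho> = \<sigma>))"
    unfolding M_def expec4_sum ..
  also have "\<dots> = expec4 (\<lambda>x0 xa xb x1. real (card ?S))"
  proof (rule expec4_cong)
    fix x0 xa xb x1
    have "(\<Sum>\<sigma>\<in>?S. \<Sum>\<rho>\<in>?S. of_bool (T x0 xa xb x1 \<rho> = \<sigma>) :: real) = (\<Sum>\<rho>\<in>?S. \<Sum>\<sigma>\<in>?S. of_bool (T x0 xa xb x1 \<rho> = \<sigma>))"
      by (rule sum.swap)
    also have "\<dots> = (\<Sum>\<rho>\<in>?S. 1)"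
      by (rule sum.cong[OF refl]) (use arrange_perm finS in \<open>auto simp: T_def of_bool_def sum.delta'\<close>)
    finally show "(\<Sum>\<sigma>\<in>?S. \<Sum>\<rho>\<in>?S. of_bool (T x0 xa xb x1 \<rho> = \<sigma>) :: real) = real (card ?S)" by simp
  qed
  also have "\<dots> = real (card ?S)" by (rule expec4_const)
  finally have sumM: "(\<Sum>\<sigma>\<in>?S. M \<sigma>) = real (card ?S)" .
  have M1: "M \<sigma> = 1" if "\<sigma> \<in> ?S" for \<sigma>
  proof -
    have "(\<Sum>\<sigma>'\<in>?S. M \<sigma>') = (\<Sum>\<sigma>'\<in>?S. M \<sigma>)" by (rule sum.cong[OF refl]) (use Meq that in blast)
    then have "real (card ?S) * M \<sigma> = real (card ?S)" using sumM by simp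
    then show ?thesis using finS neS by (simp add: card_gt_0_iff)
  qed
  have "real (card ?S) * prob4 P = expec4 (\<lambda>x0 xa xb x1. real (card ?S) * of_bool (P x0 xa xb x1))"
    by (simp add: expec4_cmult prob4_def)
  also have "\<dots> \<le> expec4 (\<lambda>x0 xa xb x1. \<Sum>\<sigma>\<in>?S \<inter> {\<sigma>. H \<sigma>}. \<Sum>\<rho>\<in>?S. of_bool (T x0 xa xb x1 \<rho> = \<sigma>))"
  proof (rule expec4_mono)
    fix x0 xa xb x1 assume x: "x0 \<subseteq> E" "xa \<subseteq> E" "xb \<subseteq> E" "x1 \<subseteq> E"
    show "real (card ?S) * of_bool (P x0 xa xb x1) \<le> (\<Sum>\<sigma>\<in>?S \<inter> {\<sigma>. H \<sigma>}. \<Sum>\<rho>\<in>?S. of_bool (T x0 xa xb x1 \<rho> = \<sigma>))"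
    proof (cases "P x0 xa xb x1")
      case True
      have "T x0 xa xb x1 \<rho> \<in> ?S \<inter> {\<sigma>. H \<sigma>}" if \<rho>: "\<rho> \<in> ?S" for \<rho>
      proof -
        have "T x0 xa xb x1 \<rho> \<in> ?S" unfolding T_def using \<rho> by (rule arrange_perm)
        moreover have "\<exists>i j. i \<le> j \<and> j \<le> length (T x0 xa xb x1 \<rho>) \<and> set (take i (T x0 xa xb x1 \<rho>)) = x0 \<union> xa \<union> xb
            \<and> set (take j (T x0 xa xb x1 \<rho>)) = x0 \<union> xa \<union> xb \<union> x1"
          unfolding T_def using x by (intro arrange_prefix \<rho>) auto
        ultimately show ?thesis using good[OF x True] by blast
      qed
      then have "(\<Sum>\<rho>\<in>?S. 1) = (\<Sum>\<rho>\<in>?S. \<Sum>\<sigma>\<in>?S \<inter> {\<sigma>. H \<sigma>}. of_bool (T x0 xa xb x1 \<rho> = \<sigma>) :: real)"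
        by (intro sum.cong[OF refl]) (use finS in \<open>auto simp: of_bool_def sum.delta'\<close>)
      also have "\<dots> = (\<Sum>\<sigma>\<in>?S \<inter> {\<sigma>. H \<sigma>}. \<Sum>\<rho>\<in>?S. of_bool (T x0 xa xb x1 \<rho> = \<sigma>))" by (rule sum.swap)
      finally show ?thesis using True by simp
    qed (simp add: sum_nonneg)
  qed
  also have "\<dots> = (\<Sum>\<sigma>\<in>?S \<inter> {\<sigma>. H \<sigma>}. M \<sigma>)" by (simp add: expec4_sum M_def)
  also have "\<dots> = real (card (?S \<inter> {\<sigma>. H \<sigma>}))" using M1 by simp
  finally have "prob4 P \<le> real (card (?S \<inter> {\<sigma>. H \<sigma>})) / real (card ?S)"
    using finS neS by (simp add: field_simps card_gt_0_iff)
  also have "\<dots> = measure_pmf.prob (pmf_of_set ?S) {\<sigma>. H \<sigma>}"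
    using finS neS by (simp add: measure_pmf_of_set)
  finally show ?thesis .
qed

end

section \<open>Hitting times, deterministically\<close>

lemma berge_min_degree:
  assumes "has_berge_hamilton_cycle V E" and "finite E" and "2 \<le> card V"
  shows "min_degree_at_least 2 V E"
  unfolding min_degree_at_least_def
proof
  fix v assume v: "v \<in> V"
  obtain vs es where c: "berge_cycle V E vs es" and V: "set (butlast vs) = V"
    using assms(1) by (auto simp: has_berge_hamilton_cycle_def)
  have len: "length vs = Suc (length es)" and de: "distinct es" and se: "set es \<subseteq> E"
    and inc: "\<And>i. i < length es \<Longrightarrow> vs ! i \<in> es ! i \<and> vs ! Suc i \<in> es ! i"
    and lh: "last vs = hd vs" and db: "distinct (butlast vs)"
    using c by (auto simp: berge_cycle_def)
  have "card V = length es" using distinct_card[OF db] V len by simp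
  then have k2: "2 \<le> length es" using assms(3) by simp
  obtain i where i: "i < length es" "vs ! i = v"
    using v V len by (metis in_set_conv_nth length_butlast nth_butlast diff_Suc_1)
  \<comment> \<open>The second hyperedge at a vertex of the cycle is the preceding one; for the
    first vertex this is the last hyperedge, because the cycle closes up.\<close>
  have "\<exists>j. j < length es \<and> j \<noteq> i \<and> v \<in> es ! j"
  proof (cases i)
    case 0
    have ne: "vs \<noteq> []" using len by auto
    have "vs ! length es = v" using lh i 0 len ne by (simp add: last_conv_nth hd_conv_nth)
    moreover have "Suc (length es - 1) = length es" using k2 by simp
    ultimately have "v \<in> es ! (length es - 1)" using inc[of "length es - 1"] k2 by simp
    then show ?thesis using k2 0 by (intro exI[of _ "length es - 1"]) auto
  next
    case (Suc m)
    then show ?thesis using inc[of m] i by (intro exI[of _ m]) auto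
  qed
  then obtain j where j: "j < length es" "j \<noteq> i" "v \<in> es ! j" by blast
  have ne: "es ! i \<noteq> es ! j" using de i j by (simp add: nth_eq_iff_index_eq)
  have "{es ! i, es ! j} \<subseteq> {e \<in> E. {v} \<subseteq> e}" using se i j inc[OF i(1)] by auto
  then have "card {es ! i, es ! j} \<le> card {e \<in> E. {v} \<subseteq> e}" using assms(2) by (intro card_mono) auto
  then show "2 \<le> degree E {v}" using ne by (simp add: degree_def)
qed

lemma min_degree_mono:
  assumes "min_degree_at_least k V E" "E \<subseteq> E'" "finite E'"
  shows "min_degree_at_least k V E'"
proof -
  have "degree E {v} \<le> degree E' {v}" for v
    unfolding degree_def using assms(2,3) by (intro card_mono) auto
  then show ?thesis using assms(1) unfolding min_degree_at_least_def by (meson order.trans)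
qed

text \<open>A Berge Hamilton cycle forces minimum degree two, so it cannot come first. The first
  time of minimum degree two lies between \<open>i\<close> and \<open>j\<close>, where
  \<open>ham\<close> already supplies the cycle.\<close>

lemma hitting_time_eq:
  assumes "i \<le> j" "j \<le> length \<sigma>"
    and lo: "\<not> min_degree_at_least 2 V (set (take i \<sigma>))"
    and hi: "min_degree_at_least 2 V (set (take j \<sigma>))"
    and ham: "\<And>\<Gamma>. set (take i \<sigma>) \<subseteq> \<Gamma> \<Longrightarrow> \<Gamma> \<subseteq> set (take j \<sigma>) \<Longrightarrow> min_degree_at_least 2 V \<Gamma> \<Longrightarrow> has_berge_hamilton_cycle V \<Gamma>"
    and V: "2 \<le> card V"
  shows "hitting_time (min_degree_at_least 2) V \<sigma> = hitting_time has_berge_hamilton_cycle V \<sigma>"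
proof -
  define Q where "Q t \<longleftrightarrow> min_degree_at_least 2 V (set (take t \<sigma>))" for t
  define t where "t = (LEAST t. Q t)"
  have Qj: "Q j" using hi by (simp add: Q_def)
  have Qt: "Q t" unfolding t_def using Qj by (rule LeastI)
  have tj: "t \<le> j" unfolding t_def using Qj by (rule Least_le)
  have it: "i \<le> t"
  proof (rule ccontr)
    assume "\<not> i \<le> t"
    then have "set (take t \<sigma>) \<subseteq> set (take i \<sigma>)" by (intro set_take_subset_set_take) simp
    then show False using Qt lo min_degree_mono unfolding Q_def by blast
  qed
  have "has_berge_hamilton_cycle V (set (take t \<sigma>))"
    using Qt it tj unfolding Q_def by (intro ham set_take_subset_set_take)
  moreover have "t \<le> s" if "has_berge_hamilton_cycle V (set (take s \<sigma>))" for s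
    unfolding t_def using berge_min_degree[OF that _ V] by (intro Least_le) (simp add: Q_def)
  moreover have "t \<le> s" if "Q s" for s unfolding t_def using that by (rule Least_le)
  moreover have tl: "t \<le> length \<sigma>" using tj assms(2) by simp
  ultimately have "hitting_time (min_degree_at_least 2) V \<sigma> = enat t" "hitting_time has_berge_hamilton_cycle V \<sigma> = enat t"
    using Qt unfolding hitting_time_def process_edges_def Q_def
    by (auto intro!: Inf_eqI[symmetric] antisym Inf_lower Inf_greatest)
  then show ?thesis by simp
qed

section \<open>Degrees in Dirac hypergraphs\<close>

lemma binomial_le_power: "n choose k \<le> n ^ k"
  by (cases "k \<le> n") (auto simp: binomial_le_pow binomial_eq_0)

context dirac_hypergraph
begin

lemma card_supersets_le:
  assumes "S \<subseteq> V" "card S \<le> r"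
  shows "card {e \<in> E. S \<subseteq> e} \<le> n ^ (r - card S)"
proof -
  have finS: "finite S" using assms(1) finV by (rule finite_subset)
  have "card {e \<in> E. S \<subseteq> e} \<le> card {X. X \<subseteq> V \<and> card X = r - card S}"
  proof (rule card_inj_on_le[of "\<lambda>e. e - S"])
    show "inj_on (\<lambda>e. e - S) {e \<in> E. S \<subseteq> e}" by (rule inj_onI) auto
    show "(\<lambda>e. e - S) ` {e \<in> E. S \<subseteq> e} \<subseteq> {X. X \<subseteq> V \<and> card X = r - card S}"
      using E_sub E_card finS by (auto simp: card_Diff_subset)
  qed auto
  also have "\<dots> = n choose (r - card S)" by (rule n_subsets) simp
  also have "\<dots> \<le> n ^ (r - card S)" by (rule binomial_le_power)
  finally show ?thesis .
qed

abbreviation star :: "'a \<Rightarrow> 'a set set" where "star v \<equiv> {e \<in> E. v \<in> e}"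

lemma star_le: "v \<in> V \<Longrightarrow> card (star v) \<le> n ^ (r - 1)"
  using card_supersets_le[of "{v}"] r3 by simp

lemma codegree_le: "u \<in> V \<Longrightarrow> v \<in> V \<Longrightarrow> u \<noteq> v \<Longrightarrow> card (star u \<inter> star v) \<le> n ^ (r - 2)"
proof -
  assume "u \<in> V" "v \<in> V" "u \<noteq> v"
  moreover have "star u \<inter> star v = {e \<in> E. {u, v} \<subseteq> e}" by auto
  ultimately show ?thesis using card_supersets_le[of "{u, v}"] r3 by (simp add: numeral_2_eq_2)
qed

lemma cardE_le: "card E \<le> n ^ r"
  using card_supersets_le[of "{}"] by simp

text \<open>Sum the codegrees over more than \<open>n / 2\<close> Dirac neighbours; each hyperedge
  at \<open>v\<close> is counted at most \<open>r\<close> times.\<close>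

lemma star_ge:
  assumes v: "v \<in> V"
  shows "\<epsilon> / (2 * real r) * real n ^ (r - 1) \<le> real (card (star v))"
proof -
  have "1 / 2 * real n * (\<epsilon> * real n ^ (r - 2)) \<le> real (card (N v)) * (\<epsilon> * real n ^ (r - 2))"
  proof (rule mult_right_mono)
    have "1 / 2 * real n \<le> (1 / 2 + \<epsilon> / 2) * real n" using eps by (intro mult_right_mono) auto
    then show "1 / 2 * real n \<le> real (card (N v))" using card_N[OF v] by linarith
  qed (use eps in auto)
  also have "\<dots> = (\<Sum>u\<in>N v. \<epsilon> * real n ^ (r - 2))" by simp
  also have "\<dots> \<le> (\<Sum>u\<in>N v. real (card {e \<in> star v. u \<in> e}))"
  proof (rule sum_mono)
    fix u assume "u \<in> N v"
    moreover have "{e \<in> E. {v, u} \<subseteq> e} = {e \<in> star v. u \<in> e}" by auto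
    ultimately show "\<epsilon> * real n ^ (r - 2) \<le> real (card {e \<in> star v. u \<in> e})"
      using N_codegree[of u v] by simp
  qed
  also have "\<dots> = real (\<Sum>e\<in>star v. card {u \<in> N v. u \<in> e})"
    using sum_multicount_gen[OF finN[of v], of "star v" "\<lambda>u e. u \<in> e" "\<lambda>e. card {u \<in> N v. u \<in> e}"] finE
    by (simp flip: of_nat_sum)
  also have "\<dots> \<le> real (\<Sum>e\<in>star v. r)"
  proof (intro of_nat_mono sum_mono)
    fix e assume e: "e \<in> star v"
    then have "card {u \<in> N v. u \<in> e} \<le> card e" by (intro card_mono) auto
    then show "card {u \<in> N v. u \<in> e} \<le> r" using e E_card by simp
  qed
  also have "\<dots> = real r * real (card (star v))" by simp
  finally have "\<epsilon> * (real n * real n ^ (r - 2)) \<le> 2 * real r * real (card (star v))" by (simp add: mult_ac)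
  moreover have "real n * real n ^ (r - 2) = real n ^ (r - 1)"
  proof -
    have "r - 1 = Suc (r - 2)" using r3 by simp
    then show ?thesis by simp
  qed
  ultimately show ?thesis using r3 by (simp add: field_simps)
qed

lemma card_two_in_le:
  assumes T: "T \<subseteq> V"
  shows "card {e \<in> E. 2 \<le> card (e \<inter> T)} \<le> card T * card T * n ^ (r - 2)"
proof -
  let ?I = "{p \<in> T \<times> T. fst p \<noteq> snd p}"
  have finT: "finite T" using T finV by (rule finite_subset)
  have "{e \<in> E. 2 \<le> card (e \<inter> T)} \<subseteq> (\<Union>p\<in>?I. star (fst p) \<inter> star (snd p))"
  proof
    fix e assume e: "e \<in> {e \<in> E. 2 \<le> card (e \<inter> T)}"
    then have "2 \<le> card (e \<inter> T)" by simp
    then obtain B where "B \<subseteq> e \<inter> T" "card B = 2" by (rule obtain_subset_with_card_n)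
    then obtain u v where "u \<noteq> v" "{u, v} \<subseteq> e \<inter> T" by (auto simp: card_2_iff)
    then show "e \<in> (\<Union>p\<in>?I. star (fst p) \<inter> star (snd p))"
      using e by (intro UN_I[of "(u, v)"]) auto
  qed
  then have "card {e \<in> E. 2 \<le> card (e \<inter> T)} \<le> card (\<Union>p\<in>?I. star (fst p) \<inter> star (snd p))"
    using finT by (intro card_mono) auto
  also have "\<dots> \<le> (\<Sum>p\<in>?I. card (star (fst p) \<inter> star (snd p)))"
    using finT by (intro card_UN_le) auto
  also have "\<dots> \<le> (\<Sum>p\<in>?I. n ^ (r - 2))" using T by (intro sum_mono codegree_le) auto
  also have "\<dots> \<le> card T * card T * n ^ (r - 2)"
  proof -
    have "card ?I \<le> card (T \<times> T)" using finT by (intro card_mono) auto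
    then show ?thesis by (simp add: card_cartesian_product)
  qed
  finally show ?thesis .
qed

end

section \<open>Probability of the exceptional events\<close>

lemma one_plus_power_le_exp: "0 \<le> x \<Longrightarrow> (1 + x) ^ k \<le> exp (real k * x)" for x :: real
  using power_mono[of "1 + x" "exp x" k] exp_ge_add_one_self[of x] by (simp add: exp_of_nat_mult)

text \<open>Exponential tilting: for \<open>card A \<le> m\<close> and \<open>y \<le> 1\<close> the
  factor \<open>y ^ card A / y ^ m\<close> is at least one. With it the sum may run over all subsets
  and becomes a product.\<close>

lemma sum_small_subsets:
  fixes p y :: real
  assumes "finite D" "0 \<le> p" "0 < y" "y \<le> 1"
  shows "(\<Sum>A | A \<subseteq> D \<and> card A \<le> m. p ^ card A) \<le> 1 / y ^ m * exp (y * p * real (card D))"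
proof -
  have "(\<Sum>A | A \<subseteq> D \<and> card A \<le> m. p ^ card A) \<le> (\<Sum>A | A \<subseteq> D \<and> card A \<le> m. 1 / y ^ m * (y * p) ^ card A)"
  proof (rule sum_mono)
    fix A assume "A \<in> {A. A \<subseteq> D \<and> card A \<le> m}"
    then have "y ^ m \<le> y ^ card A" using assms by (intro power_decreasing) auto
    then have "p ^ card A * y ^ m \<le> p ^ card A * y ^ card A" using assms by (intro mult_left_mono) auto
    then show "p ^ card A \<le> 1 / y ^ m * (y * p) ^ card A"
      using assms by (simp add: field_simps power_mult_distrib)
  qed
  also have "\<dots> \<le> (\<Sum>A\<in>Pow D. 1 / y ^ m * (y * p) ^ card A)"
    using assms by (intro sum_mono2) auto
  also have "\<dots> = 1 / y ^ m * (1 + y * p) ^ card D"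
    by (simp only: sum_distrib_left[symmetric] sum_power_card[OF assms(1)])
  also have "\<dots> \<le> 1 / y ^ m * exp (real (card D) * (y * p))"
    using assms by (intro mult_left_mono one_plus_power_le_exp) auto
  finally show ?thesis by (simp add: mult_ac)
qed

text \<open>One step in summing over chains of hyperedges: the next one either repeats a member of
  \<open>P\<close> at no cost in probability, or is new and costs a factor \<open>p\<close>.\<close>

lemma sum_insert_power:
  fixes p :: real
  assumes "finite Q" "finite P" "0 \<le> p"
  shows "(\<Sum>e\<in>Q. p ^ card (insert e P)) \<le> (real (card P) + real (card Q) * p) * p ^ card P"
proof -
  have "(\<Sum>e\<in>Q. p ^ card (insert e P)) = (\<Sum>e\<in>Q \<inter> P. p ^ card (insert e P)) + (\<Sum>e\<in>Q - P. p ^ card (insert e P))"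
    using assms by (metis sum.Int_Diff)
  also have "(\<Sum>e\<in>Q \<inter> P. p ^ card (insert e P)) = real (card (Q \<inter> P)) * p ^ card P"
    by (simp add: insert_absorb)
  also have "(\<Sum>e\<in>Q - P. p ^ card (insert e P)) = real (card (Q - P)) * (p * p ^ card P)"
    using assms by simp
  also have "real (card (Q \<inter> P)) * p ^ card P + real (card (Q - P)) * (p * p ^ card P)
    \<le> real (card P) * p ^ card P + real (card Q) * (p * p ^ card P)"
    using assms by (intro add_mono mult_right_mono) (auto intro!: card_mono)
  finally show ?thesis by (simp add: algebra_simps)
qed

locale dirac_random = dirac_hypergraph V E r \<epsilon> + random_subsets E \<mu>0 \<mu>a \<mu>b \<mu>1
  for V :: "'a set" and E r \<epsilon> \<mu>0 \<mu>a \<mu>b \<mu>1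
begin

lemma total_nonneg: "0 \<le> total" using mu by (simp add: total_def)

lemma prob_min_degree:
  assumes d: "\<And>v. v \<in> V \<Longrightarrow> d \<le> real (card (star v))" and m1: "\<mu>1 \<le> 1"
  shows "prob4 (\<lambda>x0 xa xb x1. \<not> min_degree_at_least 2 V x1) \<le> real n * (2 * exp 1 * exp (- \<mu>1 * d / 2))"
proof -
  have one: "prob4 (\<lambda>x0 xa xb x1. card {e \<in> x1. v \<in> e} < 2) \<le> 2 * exp 1 * exp (- \<mu>1 * d / 2)"
    if v: "v \<in> V" for v
  proof -
    let ?D = "star v" and ?I = "{A. A \<subseteq> star v \<and> card A \<le> 1}"
    have finI: "finite ?I" by (rule finite_subset[of _ "Pow ?D"]) auto
    have "prob4 (\<lambda>x0 xa xb x1. card {e \<in> x1. v \<in> e} < 2)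
        \<le> (\<Sum>A\<in>?I. prob4 (\<lambda>x0 xa xb x1. A \<subseteq> x1 \<and> (?D - A) \<inter> x1 = {}))"
    proof (rule prob4_union[OF finI])
      fix x0 xa xb x1 :: "'a set set" assume "x1 \<subseteq> E" "card {e \<in> x1. v \<in> e} < 2"
      then show "\<exists>A\<in>?I. A \<subseteq> x1 \<and> (?D - A) \<inter> x1 = {}"
        by (intro bexI[of _ "{e \<in> x1. v \<in> e}"]) auto
    qed
    also have "\<dots> \<le> (\<Sum>A\<in>?I. exp (- \<mu>1 * real (card ?D)) * (\<mu>1 * exp \<mu>1) ^ card A)"
    proof (rule sum_mono)
      fix A assume A: "A \<in> ?I"
      then have finA: "finite A" by (auto intro: finite_subset[of A ?D])
      have "prob4 (\<lambda>x0 xa xb x1. A \<subseteq> x1 \<and> (?D - A) \<inter> x1 = {}) \<le> \<mu>1 ^ card A * exp (- \<mu>1 * real (card (?D - A)))"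
        using A by (intro prob4_x1) auto
      also have "real (card (?D - A)) = real (card ?D) - real (card A)"
        using A finA card_mono[of ?D A] by (simp add: card_Diff_subset of_nat_diff)
      also have "\<mu>1 ^ card A * exp (- \<mu>1 * (real (card ?D) - real (card A))) = exp (- \<mu>1 * real (card ?D)) * (\<mu>1 * exp \<mu>1) ^ card A"
        by (simp add: power_mult_distrib exp_of_nat_mult[symmetric] exp_add[symmetric] algebra_simps)
      finally show "prob4 (\<lambda>x0 xa xb x1. A \<subseteq> x1 \<and> (?D - A) \<inter> x1 = {}) \<le> exp (- \<mu>1 * real (card ?D)) * (\<mu>1 * exp \<mu>1) ^ card A" .
    qed
    also have "\<dots> = exp (- \<mu>1 * real (card ?D)) * (\<Sum>A\<in>?I. (\<mu>1 * exp \<mu>1) ^ card A)"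
      by (simp add: sum_distrib_left)
    \<comment> \<open>The tilt \<open>1 / (2 * exp 1)\<close> compensates
      \<open>exp \<mu>1 \<le> exp 1\<close> and leaves exactly half of the exponent.\<close>
    also have "\<dots> \<le> exp (- \<mu>1 * real (card ?D)) * (1 / (1 / (2 * exp 1)) ^ 1 * exp (1 / (2 * exp 1) * (\<mu>1 * exp \<mu>1) * real (card ?D)))"
    proof (intro mult_left_mono sum_small_subsets)
      show "1 / (2 * exp 1) \<le> (1::real)"
        using exp_ge_add_one_self[of "1::real"] by (simp add: field_simps)
    qed (use mu in auto)
    also have "\<dots> \<le> exp (- \<mu>1 * real (card ?D)) * (2 * exp 1 * exp (\<mu>1 / 2 * real (card ?D)))"
    proof -
      have "\<mu>1 * exp \<mu>1 \<le> \<mu>1 * exp 1" using m1 mu by (intro mult_left_mono) auto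
      then have "1 / (2 * exp 1) * (\<mu>1 * exp \<mu>1) \<le> \<mu>1 / 2" by (simp add: field_simps)
      then have "1 / (2 * exp 1) * (\<mu>1 * exp \<mu>1) * real (card ?D) \<le> \<mu>1 / 2 * real (card ?D)"
        by (rule mult_right_mono) simp
      then show ?thesis by simp
    qed
    also have "\<dots> = 2 * exp 1 * exp (- \<mu>1 * real (card ?D) / 2)"
      by (simp add: exp_add[symmetric] field_simps)
    also have "\<dots> \<le> 2 * exp 1 * exp (- \<mu>1 * d / 2)"
      using mult_left_mono[OF d[OF v], of \<mu>1] mu by simp
    finally show ?thesis .
  qed
  have "prob4 (\<lambda>x0 xa xb x1. \<not> min_degree_at_least 2 V x1) \<le> (\<Sum>v\<in>V. prob4 (\<lambda>x0 xa xb x1. card {e \<in> x1. v \<in> e} < 2))"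
    by (rule prob4_union) (auto simp: min_degree_at_least_def degree_def not_le)
  also have "\<dots> \<le> (\<Sum>v\<in>V. 2 * exp 1 * exp (- \<mu>1 * d / 2))" by (intro sum_mono one)
  finally show ?thesis by simp
qed

text \<open>The bound keeps one avoidance factor for each of the two vertices. The hyperedges at
  both vertices, and those required by \<open>C\<close>, cost only the factor
  \<open>exp (\<mu>0 * (real n ^ (r - 2) + 4))\<close>.\<close>

lemma prob_two_small:
  assumes s: "s \<in> V" "s' \<in> V" "s \<noteq> s'" and C: "C \<subseteq> E" "card C \<le> 4" and y: "0 < y" "y \<le> 1"
  shows "prob4 (\<lambda>x0 xa xb x1. C \<subseteq> x0 \<union> xa \<union> xb \<union> x1 \<and> card {e \<in> x0. s \<in> e} < M \<and> card {e \<in> x0. s' \<in> e} < M)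
    \<le> total ^ card C * (1 / y ^ (2 * M) *
        exp (2 * y * total * exp \<mu>0 * real n ^ (r - 1) + \<mu>0 * (real n ^ (r - 2) + 4))) *
        (exp (- \<mu>0 * real (card (star s))) * exp (- \<mu>0 * real (card (star s'))))"
proof -
  \<comment> \<open>Leaving out \<open>C\<close> makes the hyperedges avoided by \<open>x0\<close>
    disjoint from those required to be present, so that the two requirements factor.\<close>
  let ?D = "star s \<union> star s' - C"
  let ?I = "{A. A \<subseteq> ?D \<and> card A \<le> 2 * M}"
  define \<kappa> where "\<kappa> = real n ^ (r - 2)"
  define NN where "NN = real n ^ (r - 1)"
  have finC: "finite C" using C(1) finE by (rule finite_subset)
  have finD: "finite ?D" by simp
  have finI: "finite ?I" by (rule finite_subset[of _ "Pow ?D"]) auto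
  have D1: "real (card (star s)) + real (card (star s')) - (\<kappa> + 4) \<le> real (card ?D)"
  proof -
    have "card (star s) + card (star s') = card (star s \<union> star s') + card (star s \<inter> star s')"
      by (rule card_Un_Int) auto
    moreover have "card (star s \<union> star s') \<le> card ?D + card C"
      using diff_card_le_card_Diff[OF finC, of "star s \<union> star s'"] by linarith
    moreover have "card (star s \<inter> star s') \<le> n ^ (r - 2)" using s by (intro codegree_le)
    then have "real (card (star s \<inter> star s')) \<le> \<kappa>" unfolding \<kappa>_def by (simp flip: of_nat_power)
    ultimately show ?thesis using C(2) by linarith
  qed
  have D2: "real (card ?D) \<le> 2 * NN"
  proof -
    have "card ?D \<le> card (star s \<union> star s')" by (intro card_mono) auto
    also have "\<dots> \<le> card (star s) + card (star s')" by (rule card_Un_le)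
    also have "\<dots> \<le> n ^ (r - 1) + n ^ (r - 1)" using s by (intro add_mono star_le)
    finally have "real (card ?D) \<le> real (n ^ (r - 1) + n ^ (r - 1))" by (rule of_nat_mono)
    then show ?thesis by (simp add: NN_def)
  qed
  have "prob4 (\<lambda>x0 xa xb x1. C \<subseteq> x0 \<union> xa \<union> xb \<union> x1 \<and> card {e \<in> x0. s \<in> e} < M \<and> card {e \<in> x0. s' \<in> e} < M)
      \<le> (\<Sum>A\<in>?I. prob4 (\<lambda>x0 xa xb x1. A \<union> C \<subseteq> x0 \<union> xa \<union> xb \<union> x1 \<and> (?D - A) \<inter> x0 = {}))"
  proof (rule prob4_union[OF finI])
    fix x0 xa xb x1 :: "'a set set"
    assume x: "x0 \<subseteq> E" and a: "C \<subseteq> x0 \<union> xa \<union> xb \<union> x1 \<and> card {e \<in> x0. s \<in> e} < M \<and> card {e \<in> x0. s' \<in> e} < M"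
    have finx: "finite x0" using x finE by (rule finite_subset)
    have "card (x0 \<inter> ?D) \<le> card ({e \<in> x0. s \<in> e} \<union> {e \<in> x0. s' \<in> e})"
      using finx by (intro card_mono) auto
    also have "\<dots> \<le> card {e \<in> x0. s \<in> e} + card {e \<in> x0. s' \<in> e}" by (rule card_Un_le)
    finally have "card (x0 \<inter> ?D) \<le> 2 * M" using a by linarith
    then show "\<exists>A\<in>?I. A \<union> C \<subseteq> x0 \<union> xa \<union> xb \<union> x1 \<and> (?D - A) \<inter> x0 = {}"
      using a by (intro bexI[of _ "x0 \<inter> ?D"]) auto
  qed
  also have "\<dots> \<le> (\<Sum>A\<in>?I. total ^ card C * exp (- \<mu>0 * real (card ?D)) * (total * exp \<mu>0) ^ card A)"
  proof (rule sum_mono)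
    fix A assume A: "A \<in> ?I"
    then have finA: "finite A" using finD by (auto intro: finite_subset)
    have "prob4 (\<lambda>x0 xa xb x1. A \<union> C \<subseteq> x0 \<union> xa \<union> xb \<union> x1 \<and> (?D - A) \<inter> x0 = {})
      \<le> total ^ card (A \<union> C) * exp (- \<mu>0 * real (card (?D - A)))"
      using A C(1) by (intro prob4_hit_0) auto
    also have "card (A \<union> C) = card A + card C" using A finA finC by (intro card_Un_disjoint) auto
    also have "real (card (?D - A)) = real (card ?D) - real (card A)"
      using A finA card_mono[OF finD, of A] by (simp add: card_Diff_subset of_nat_diff)
    also have "total ^ (card A + card C) * exp (- \<mu>0 * (real (card ?D) - real (card A)))
      = total ^ card C * exp (- \<mu>0 * real (card ?D)) * (total * exp \<mu>0) ^ card A"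
      by (simp add: power_mult_distrib power_add exp_of_nat_mult[symmetric] exp_add[symmetric] algebra_simps)
    finally show "prob4 (\<lambda>x0 xa xb x1. A \<union> C \<subseteq> x0 \<union> xa \<union> xb \<union> x1 \<and> (?D - A) \<inter> x0 = {})
      \<le> total ^ card C * exp (- \<mu>0 * real (card ?D)) * (total * exp \<mu>0) ^ card A" .
  qed
  also have "\<dots> = total ^ card C * exp (- \<mu>0 * real (card ?D)) * (\<Sum>A\<in>?I. (total * exp \<mu>0) ^ card A)"
    by (simp add: sum_distrib_left)
  also have "\<dots> \<le> total ^ card C * exp (- \<mu>0 * real (card ?D)) * (1 / y ^ (2 * M) * exp (y * (total * exp \<mu>0) * real (card ?D)))"
    using y total_nonneg finD by (intro mult_left_mono sum_small_subsets) auto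
  also have "\<dots> \<le> total ^ card C * exp (- \<mu>0 * (real (card (star s)) + real (card (star s')) - (\<kappa> + 4)))
      * (1 / y ^ (2 * M) * exp (y * (total * exp \<mu>0) * (2 * NN)))"
  proof -
    have "- \<mu>0 * real (card ?D) \<le> - \<mu>0 * (real (card (star s)) + real (card (star s')) - (\<kappa> + 4))"
      using mult_left_mono[OF D1 mu(1)] by simp
    moreover have "y * (total * exp \<mu>0) * real (card ?D) \<le> y * (total * exp \<mu>0) * (2 * NN)"
      using D2 y total_nonneg by (intro mult_left_mono) auto
    ultimately have "exp (- \<mu>0 * real (card ?D)) \<le> exp (- \<mu>0 * (real (card (star s)) + real (card (star s')) - (\<kappa> + 4)))"
      "exp (y * (total * exp \<mu>0) * real (card ?D)) \<le> exp (y * (total * exp \<mu>0) * (2 * NN))"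
      by (simp_all only: exp_le_cancel_iff)
    then show ?thesis
      using y total_nonneg by (intro mult_mono) simp_all
  qed
  also have "\<dots> = total ^ card C * (1 / y ^ (2 * M) *
        exp (2 * y * total * exp \<mu>0 * NN + \<mu>0 * (\<kappa> + 4))) *
        (exp (- \<mu>0 * real (card (star s))) * exp (- \<mu>0 * real (card (star s'))))"
    by (simp add: exp_add[symmetric] exp_diff[symmetric] algebra_simps)
  finally show ?thesis by (simp add: \<kappa>_def NN_def)
qed

end

context random_subsets
begin

lemma prob4_bex:
  "finite I \<Longrightarrow> prob4 (\<lambda>x0 xa xb x1. \<exists>i\<in>I. Q i x0 xa xb x1) \<le> (\<Sum>i\<in>I. prob4 (Q i))"
  by (rule prob4_union) auto

end

context dirac_random
begin

text \<open>First moment over chains. A chain may repeat hyperedges, so it is weighted by its set of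
  hyperedges; each step contributes at most three repetitions plus an expected \<open>x\<close> new
  choices. The sum over the first small vertex is kept, and only the second is estimated by the
  minimum degree \<open>d\<close>.\<close>

lemma prob_far_apart:
  fixes M :: nat and d y :: real
  assumes d: "\<And>v. v \<in> V \<Longrightarrow> d \<le> real (card (star v))" and y: "0 < y" "y \<le> 1"
  defines "x \<equiv> real r * real n ^ (r - 1) * total"
    and "G \<equiv> 1 / y ^ (2 * M) * exp (2 * y * total * exp \<mu>0 * real n ^ (r - 1) + \<mu>0 * (real n ^ (r - 2) + 4))"
  shows "prob4 (\<lambda>x0 xa xb x1. \<not> far_apart (x0 \<union> xa \<union> xb \<union> x1) {v \<in> V. card {e \<in> x0. v \<in> e} < M})
    \<le> (\<Sum>s\<in>V. exp (- \<mu>0 * real (card (star s)))) * exp (- \<mu>0 * d) * (G * real r * (3 + x) ^ 4)"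
proof -
  define nb where "nb e = {e' \<in> E. e \<inter> e' \<noteq> {}}" for e :: "'a set"
  have finnb [simp]: "finite (nb e)" for e by (simp add: nb_def)
  have x0: "0 \<le> x" using total_nonneg by (simp add: x_def)
  have G0: "0 \<le> G" using y by (simp add: G_def)
  have nb: "real (card (nb e)) * total \<le> x" if e: "e \<in> E" for e
  proof -
    have "nb e = (\<Union>v\<in>e. star v)" by (auto simp: nb_def)
    then have "card (nb e) \<le> (\<Sum>v\<in>e. card (star v))" using e card_UN_le[of e star] by simp
    also have "\<dots> \<le> (\<Sum>v\<in>e. n ^ (r - 1))" using E_sub[OF e] by (intro sum_mono star_le) auto
    also have "\<dots> = r * n ^ (r - 1)" using E_card[OF e] by simp
    finally have "real (card (nb e)) \<le> real (r * n ^ (r - 1))" by (rule of_nat_mono)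
    then show ?thesis using total_nonneg unfolding x_def by (intro mult_right_mono) auto
  qed
  have step: "(\<Sum>e'\<in>nb e. c * total ^ card (insert e' P)) \<le> c * (3 + x) * total ^ card P"
    if e: "e \<in> E" "finite P" "card P \<le> 3" "0 \<le> c" for e P c
  proof -
    have "(\<Sum>e'\<in>nb e. total ^ card (insert e' P)) \<le> (real (card P) + real (card (nb e)) * total) * total ^ card P"
      using e total_nonneg by (intro sum_insert_power) auto
    also have "\<dots> \<le> (3 + x) * total ^ card P"
      using e nb[OF e(1)] total_nonneg by (intro mult_right_mono add_mono) auto
    finally show ?thesis using e(4) by (simp add: sum_distrib_left[symmetric] mult.assoc mult_left_mono)
  qed
  define sm where "sm v x0 \<longleftrightarrow> card {e \<in> x0. v \<in> e} < M" for v and x0 :: "'a set set"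
  let ?P = "\<lambda>s e1 e2 e3 e4 s' x0 xa xb x1. insert e4 (insert e3 (insert e2 {e1})) \<subseteq> x0 \<union> xa \<union> xb \<union> x1 \<and> sm s x0 \<and> sm s' x0"
  have one: "prob4 (\<lambda>x0 xa xb x1. \<exists>e1\<in>star s. \<exists>e2\<in>nb e1. \<exists>e3\<in>nb e2. \<exists>e4\<in>nb e3. \<exists>s'\<in>e4 - {s}. ?P s e1 e2 e3 e4 s' x0 xa xb x1)
    \<le> G * (exp (- \<mu>0 * real (card (star s))) * exp (- \<mu>0 * d)) * real r * (3 + x) ^ 4" if s: "s \<in> V" for s
  proof -
    define c where "c = G * (exp (- \<mu>0 * real (card (star s))) * exp (- \<mu>0 * d))"
    have c0: "0 \<le> c" using G0 by (simp add: c_def)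
    have "prob4 (\<lambda>x0 xa xb x1. \<exists>e1\<in>star s. \<exists>e2\<in>nb e1. \<exists>e3\<in>nb e2. \<exists>e4\<in>nb e3. \<exists>s'\<in>e4 - {s}. ?P s e1 e2 e3 e4 s' x0 xa xb x1)
      \<le> (\<Sum>e1\<in>star s. \<Sum>e2\<in>nb e1. \<Sum>e3\<in>nb e2. \<Sum>e4\<in>nb e3. \<Sum>s'\<in>e4 - {s}. prob4 (?P s e1 e2 e3 e4 s'))"
      by (intro order.trans[OF prob4_bex] sum_mono order_refl) (auto simp: nb_def)
    also have "\<dots> \<le> (\<Sum>e1\<in>star s. \<Sum>e2\<in>nb e1. \<Sum>e3\<in>nb e2. \<Sum>e4\<in>nb e3. \<Sum>s'\<in>e4 - {s}. c * total ^ card (insert e4 (insert e3 (insert e2 {e1}))))"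
    proof (intro sum_mono)
      fix e1 e2 e3 e4 s'
      assume e: "e1 \<in> star s" "e2 \<in> nb e1" "e3 \<in> nb e2" "e4 \<in> nb e3" "s' \<in> e4 - {s}"
      let ?C = "insert e4 (insert e3 (insert e2 {e1}))"
      have CE: "?C \<subseteq> E" using e by (auto simp: nb_def)
      have s': "s' \<in> V" "s \<noteq> s'" using e CE E_sub by auto
      have cC: "card ?C \<le> 4" by (simp add: card_insert_if)
      have "prob4 (?P s e1 e2 e3 e4 s') \<le> total ^ card ?C * G * (exp (- \<mu>0 * real (card (star s))) * exp (- \<mu>0 * real (card (star s'))))"
        unfolding sm_def G_def using prob_two_small[OF s s' CE cC y, of M] by simp
      also have "\<dots> \<le> total ^ card ?C * G * (exp (- \<mu>0 * real (card (star s))) * exp (- \<mu>0 * d))"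
        using d[OF s'(1)] mu G0 total_nonneg by (intro mult_left_mono) (auto intro: mult_left_mono)
      also have "\<dots> = c * total ^ card ?C" by (simp add: c_def)
      finally show "prob4 (?P s e1 e2 e3 e4 s') \<le> c * total ^ card ?C" .
    qed
    also have "\<dots> \<le> (\<Sum>e1\<in>star s. \<Sum>e2\<in>nb e1. \<Sum>e3\<in>nb e2. \<Sum>e4\<in>nb e3. (c * real r) * total ^ card (insert e4 (insert e3 (insert e2 {e1}))))"
    proof (intro sum_mono)
      fix e1 e2 e3 e4 assume e4: "e4 \<in> nb e3"
      then have "card (e4 - {s}) \<le> r" using E_card[of e4] card_Diff1_le[of e4 s] by (auto simp: nb_def)
      then have "real (card (e4 - {s})) * (c * total ^ card (insert e4 (insert e3 (insert e2 {e1}))))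
        \<le> real r * (c * total ^ card (insert e4 (insert e3 (insert e2 {e1}))))"
        using c0 total_nonneg by (intro mult_right_mono) auto
      then show "(\<Sum>s'\<in>e4 - {s}. c * total ^ card (insert e4 (insert e3 (insert e2 {e1}))))
        \<le> (c * real r) * total ^ card (insert e4 (insert e3 (insert e2 {e1})))"
        by (simp only: sum_constant mult_ac)
    qed
    also have "\<dots> \<le> (\<Sum>e1\<in>star s. \<Sum>e2\<in>nb e1. \<Sum>e3\<in>nb e2. (c * real r * (3 + x)) * total ^ card (insert e3 (insert e2 {e1})))"
      using c0 x0 by (intro sum_mono step) (auto simp: nb_def card_insert_if)
    also have "\<dots> \<le> (\<Sum>e1\<in>star s. \<Sum>e2\<in>nb e1. (c * real r * (3 + x) * (3 + x)) * total ^ card (insert e2 {e1}))"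
      using c0 x0 by (intro sum_mono step) (auto simp: nb_def card_insert_if)
    also have "\<dots> \<le> (\<Sum>e1\<in>star s. (c * real r * (3 + x) * (3 + x) * (3 + x)) * total ^ card {e1})"
      using c0 x0 by (intro sum_mono step) (auto simp: nb_def card_insert_if)
    also have "\<dots> = c * real r * (3 + x) * (3 + x) * (3 + x) * (real (card (star s)) * total)" by simp
    also have "\<dots> \<le> c * real r * (3 + x) * (3 + x) * (3 + x) * (3 + x)"
    proof (rule mult_left_mono)
      have "real (card (star s)) \<le> real (n ^ (r - 1))" using star_le[OF s] by (rule of_nat_mono)
      then have "real (card (star s)) * total \<le> 1 * (real n ^ (r - 1) * total)"
        using total_nonneg by (simp add: mult_right_mono)
      also have "\<dots> \<le> real r * (real n ^ (r - 1) * total)"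
        using r3 total_nonneg by (intro mult_right_mono) auto
      finally show "real (card (star s)) * total \<le> 3 + x" by (simp add: x_def mult.assoc)
    qed (use c0 x0 in auto)
    finally show ?thesis by (simp add: c_def power4_eq_xxxx mult.assoc)
  qed
  have "prob4 (\<lambda>x0 xa xb x1. \<not> far_apart (x0 \<union> xa \<union> xb \<union> x1) {v \<in> V. card {e \<in> x0. v \<in> e} < M})
    \<le> (\<Sum>s\<in>V. prob4 (\<lambda>x0 xa xb x1. \<exists>e1\<in>star s. \<exists>e2\<in>nb e1. \<exists>e3\<in>nb e2. \<exists>e4\<in>nb e3. \<exists>s'\<in>e4 - {s}. ?P s e1 e2 e3 e4 s' x0 xa xb x1))"
  proof (rule prob4_union)
    fix x0 xa xb x1 :: "'a set set" assume x: "x0 \<subseteq> E" "xa \<subseteq> E" "xb \<subseteq> E" "x1 \<subseteq> E"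
    let ?\<Gamma> = "x0 \<union> xa \<union> xb \<union> x1"
    assume nfar: "\<not> far_apart ?\<Gamma> {v \<in> V. card {e \<in> x0. v \<in> e} < M}"
    show "\<exists>s\<in>V. \<exists>e1\<in>star s. \<exists>e2\<in>nb e1. \<exists>e3\<in>nb e2. \<exists>e4\<in>nb e3. \<exists>s'\<in>e4 - {s}. ?P s e1 e2 e3 e4 s' x0 xa xb x1"
    proof (rule ccontr)
      assume no: "\<not> ?thesis"
      have "far_apart ?\<Gamma> {v \<in> V. card {e \<in> x0. v \<in> e} < M}"
        unfolding far_apart_def
      proof (intro ballI impI)
        fix s s' e1 e2 e3 e4
        assume h: "s \<in> {v \<in> V. card {e \<in> x0. v \<in> e} < M}" "s' \<in> {v \<in> V. card {e \<in> x0. v \<in> e} < M}"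
          "e1 \<in> ?\<Gamma>" "e2 \<in> ?\<Gamma>" "e3 \<in> ?\<Gamma>" "e4 \<in> ?\<Gamma>"
          "s \<in> e1" "e1 \<inter> e2 \<noteq> {}" "e2 \<inter> e3 \<noteq> {}" "e3 \<inter> e4 \<noteq> {}" "s' \<in> e4"
        have E: "e1 \<in> E" "e2 \<in> E" "e3 \<in> E" "e4 \<in> E" using h(3-6) x by blast+
        show "s = s'"
        proof (rule ccontr)
          assume "s \<noteq> s'"
          have "\<exists>s\<in>V. \<exists>e1\<in>star s. \<exists>e2\<in>nb e1. \<exists>e3\<in>nb e2. \<exists>e4\<in>nb e3. \<exists>s'\<in>e4 - {s}. ?P s e1 e2 e3 e4 s' x0 xa xb x1"
          proof (intro bexI)
            show "?P s e1 e2 e3 e4 s' x0 xa xb x1" using h(1-6) by (simp add: sm_def)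
          qed (use h E \<open>s \<noteq> s'\<close> in \<open>simp_all add: nb_def\<close>)
          then show False using no by contradiction
        qed
      qed
      then show False using nfar by contradiction
    qed
  qed simp
  also have "\<dots> \<le> (\<Sum>s\<in>V. G * (exp (- \<mu>0 * real (card (star s))) * exp (- \<mu>0 * d)) * real r * (3 + x) ^ 4)"
    by (intro sum_mono one)
  also have "\<dots> = (\<Sum>s\<in>V. exp (- \<mu>0 * real (card (star s)))) * exp (- \<mu>0 * d) * (G * real r * (3 + x) ^ 4)"
    by (simp add: sum_distrib_right sum_distrib_left mult_ac)
  finally show ?thesis .
qed

text \<open>First moment over the sets \<open>T\<close>: each violates the condition with
  probability at most \<open>1 / n ^ 3\<close> to the power \<open>card T\<close>, and summing over
  all nonempty subsets gives \<open>(1 + 1 / n ^ 3) ^ n - 1\<close>.\<close>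

lemma prob_locally_sparse:
  fixes a c :: real and k :: nat
  assumes a: "0 \<le> a" and k: "7 * exp (1 + a) * c * (total * real n ^ (r - 1)) \<le> real k"
    and ln: "3 * ln (real n) \<le> a * real k / 7"
  shows "prob4 (\<lambda>x0 xa xb x1. \<not> locally_sparse c k (x0 \<union> xa \<union> xb \<union> x1)) \<le> exp (1 / (real n)\<^sup>2) - 1"
proof -
  \<comment> \<open>One factor \<open>exp 1\<close> per hyperedge cancels the moment bound
    \<open>exp (real kk)\<close>; the remaining \<open>exp a\<close> is the gain.\<close>
  define y where "y = exp (1 + a)"
  have n0: "0 < real n" using n6 by simp
  let ?J = "{T. T \<subseteq> V \<and> T \<noteq> {}}"
  let ?Q = "\<lambda>T x0 xa xb x1. real (card T) \<le> c * real n \<and> k * card T \<le> 7 * card {e \<in> x0 \<union> xa \<union> xb \<union> x1. 2 \<le> card (e \<inter> T)}"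
  have one: "prob4 (?Q T) \<le> (1 / real n ^ 3) ^ card T" if T: "T \<in> ?J" for T
  proof (cases "real (card T) \<le> c * real n")
    case False
    then have "prob4 (?Q T) = 0" by (simp add: prob4_def expec4_const)
    then show ?thesis by simp
  next
    case True
    define t where "t = card T"
    define D where "D = {e \<in> E. 2 \<le> card (e \<inter> T)}"
    \<comment> \<open>This is \<open>k * t / 7\<close> rounded up.\<close>
    define kk where "kk = (k * t + 6) div 7"
    let ?I = "{B. B \<subseteq> D \<and> card B = kk}"
    have finD: "finite D" by (simp add: D_def)
    then have finI: "finite ?I" by simp
    have kk: "real k * real t \<le> 7 * real kk"
    proof -
      have "k * t \<le> 7 * kk" unfolding kk_def by presburger
      then have "real (k * t) \<le> real (7 * kk)" by (rule of_nat_mono)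
      then show ?thesis by simp
    qed
    have "prob4 (?Q T) \<le> (\<Sum>B\<in>?I. prob4 (\<lambda>x0 xa xb x1. B \<subseteq> x0 \<union> xa \<union> xb \<union> x1))"
    proof (rule prob4_union[OF finI])
      fix x0 xa xb x1 :: "'a set set" assume x: "x0 \<subseteq> E" "xa \<subseteq> E" "xb \<subseteq> E" "x1 \<subseteq> E" and q: "?Q T x0 xa xb x1"
      let ?S = "{e \<in> x0 \<union> xa \<union> xb \<union> x1. 2 \<le> card (e \<inter> T)}"
      have "kk \<le> card ?S" using q unfolding kk_def t_def by linarith
      then obtain B where "B \<subseteq> ?S" "card B = kk" by (rule obtain_subset_with_card_n)
      then show "\<exists>B\<in>?I. B \<subseteq> x0 \<union> xa \<union> xb \<union> x1" using x by (intro bexI[of _ B]) (auto simp: D_def)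
    qed
    also have "\<dots> \<le> (\<Sum>B\<in>?I. 1 / y ^ kk * (y * total) ^ card B)"
    proof (rule sum_mono)
      fix B assume B: "B \<in> ?I"
      then have "prob4 (\<lambda>x0 xa xb x1. B \<subseteq> x0 \<union> xa \<union> xb \<union> x1) \<le> total ^ card B"
        by (intro prob4_cover) (auto simp: D_def)
      also have "\<dots> = 1 / y ^ kk * (y * total) ^ card B" using B by (simp add: power_mult_distrib y_def)
      finally show "prob4 (\<lambda>x0 xa xb x1. B \<subseteq> x0 \<union> xa \<union> xb \<union> x1) \<le> 1 / y ^ kk * (y * total) ^ card B" .
    qed
    also have "\<dots> \<le> (\<Sum>B\<in>Pow D. 1 / y ^ kk * (y * total) ^ card B)"
      using finD total_nonneg by (intro sum_mono2) (auto simp: y_def)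
    also have "\<dots> = 1 / y ^ kk * (1 + y * total) ^ card D"
      by (simp only: sum_distrib_left[symmetric] sum_power_card[OF finD])
    also have "\<dots> \<le> 1 / y ^ kk * exp (real (card D) * (y * total))"
      using total_nonneg by (intro mult_left_mono one_plus_power_le_exp) (auto simp: y_def)
    also have "\<dots> \<le> 1 / y ^ kk * exp (real kk)"
    proof -
      have "card D \<le> t * t * n ^ (r - 2)" unfolding D_def t_def using T by (intro card_two_in_le) auto
      then have "real (card D) \<le> real (t * t * n ^ (r - 2))" by (rule of_nat_mono)
      also have "\<dots> = real t * (real t * real n ^ (r - 2))" by simp
      also have "\<dots> \<le> real t * (c * real n * real n ^ (r - 2))"
        using True by (intro mult_left_mono mult_right_mono) (auto simp: t_def)
      also have "real n * real n ^ (r - 2) = real n ^ (r - 1)"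
      proof -
        have "r - 1 = Suc (r - 2)" using r3 by simp
        then show ?thesis by simp
      qed
      then have "real t * (c * real n * real n ^ (r - 2)) = real t * (c * real n ^ (r - 1))" by simp
      finally have "real (card D) * (y * total) \<le> real t * (c * real n ^ (r - 1)) * (y * total)"
        using total_nonneg by (intro mult_right_mono) (auto simp: y_def)
      also have "\<dots> = real t * (7 * exp (1 + a) * c * (total * real n ^ (r - 1))) / 7" by (simp add: y_def)
      also have "\<dots> \<le> real t * real k / 7" using k by (intro divide_right_mono mult_left_mono) auto
      also have "\<dots> \<le> real kk" using kk by (simp add: mult.commute)
      finally have "exp (real (card D) * (y * total)) \<le> exp (real kk)" by simp
      then show ?thesis by (intro mult_left_mono) (auto simp: y_def)
    qed
    also have "\<dots> = exp (- a * real kk)"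
      by (simp add: y_def exp_of_nat_mult[symmetric] exp_minus[symmetric] divide_inverse exp_add[symmetric] algebra_simps)
    also have "\<dots> \<le> exp (- (3 * ln (real n)) * real t)"
    proof -
      have "3 * ln (real n) * real t \<le> a * real k / 7 * real t" using ln by (rule mult_right_mono) simp
      also have "\<dots> \<le> a * real kk" using mult_left_mono[OF kk a] by simp
      finally show ?thesis by simp
    qed
    also have "\<dots> = (1 / real n ^ 3) ^ t"
    proof -
      have "exp (- (3 * ln (real n))) = 1 / real n ^ 3"
        using n0 exp_of_nat_mult[of 3 "ln (real n)"] by (simp add: exp_minus divide_inverse)
      then show ?thesis using exp_of_nat_mult[of t "- (3 * ln (real n))"] by (simp add: mult.commute)
    qed
    finally show ?thesis by (simp add: t_def)
  qed
  have finJ: "finite ?J" by (rule finite_subset[of _ "Pow V"]) auto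
  have "prob4 (\<lambda>x0 xa xb x1. \<not> locally_sparse c k (x0 \<union> xa \<union> xb \<union> x1)) \<le> (\<Sum>T\<in>?J. prob4 (?Q T))"
    by (rule prob4_union[OF finJ]) (auto simp: locally_sparse_def not_less)
  also have "\<dots> \<le> (\<Sum>T\<in>?J. (1 / real n ^ 3) ^ card T)" by (intro sum_mono one)
  also have "\<dots> = (\<Sum>T\<in>Pow V. (1 / real n ^ 3) ^ card T) - 1"
  proof -
    have "?J = Pow V - {{}}" by auto
    then show ?thesis by (simp add: sum_diff1)
  qed
  also have "\<dots> = (1 + 1 / real n ^ 3) ^ n - 1" by (subst sum_power_card) auto
  also have "\<dots> \<le> exp (real n * (1 / real n ^ 3)) - 1"
    using one_plus_power_le_exp[of "1 / real n ^ 3" n] by simp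
  also have "real n * (1 / real n ^ 3) = 1 / (real n)\<^sup>2" using n0 by (simp add: power3_eq_cube power2_eq_square)
  finally show ?thesis .
qed

lemma card_labelled_le: "real (card (labelled E)) \<le> real (r\<^sup>2) * real n ^ r"
proof -
  have "labelled E = Sigma E (\<lambda>e. {q. q \<subseteq> e \<and> card q = 2})" by (auto simp: labelled_def)
  then have "card (labelled E) = (\<Sum>e\<in>E. card {q. q \<subseteq> e \<and> card q = 2})" by simp
  also have "\<dots> = (\<Sum>e\<in>E. r choose 2)" by (intro sum.cong refl) (simp add: n_subsets E_card)
  also have "\<dots> \<le> n ^ r * r ^ 2" using cardE_le binomial_le_power[of r 2] by (simp add: mult_le_mono)
  finally have "real (card (labelled E)) \<le> real (n ^ r * r ^ 2)" by (rule of_nat_mono)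
  then show ?thesis by (simp add: mult.commute)
qed

text \<open>\<open>Q\<close> may be any function of \<open>x0\<close>: once \<open>x0\<close> (for
  \<open>Fclose\<close> also \<open>xa\<close>) is revealed, \<open>L\<close> determines the target,
  so \<open>Q\<close> is never enumerated. The factor \<open>(n + 3) * 4 ^ n\<close> counts the
  instances of \<open>boosted\<close>, and the last factor sums the probabilities
  \<open>total ^ card L\<close> over all candidates \<open>L\<close>.\<close>

lemma prob_not_boosted:
  fixes Q :: "'a set set \<Rightarrow> ('a set \<times> 'a set) set" and \<theta> \<mu> y :: real
  assumes \<theta>: "0 < \<theta>" and y: "0 < y" "y \<le> 1" and \<mu>: "\<mu>a = \<mu>" "\<mu>b = \<mu>"
  shows "prob4 (\<lambda>x0 xa xb x1. \<exists>L. labelling (x0 \<union> xa \<union> xb \<union> x1) L \<and> card L \<le> m \<and> \<not> boosted \<theta> xa xb (extend (Q x0) L))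
    \<le> (real n + 3) * 4 ^ n * exp (- \<mu> * (\<theta> * real n ^ r)) * (1 / y ^ m * exp (y * total * (real (r\<^sup>2) * real n ^ r)))"
proof -
  define f where "f = \<theta> * real n ^ r"
  have f0: "0 < f" using \<theta> n6 by (simp add: f_def)
  let ?I = "{L. L \<subseteq> labelled E \<and> card L \<le> m \<and> inj_on fst L}"
  let ?O = "\<lambda>L k x0 xa xb x1. fst ` L \<subseteq> x0 \<union> xa \<union> xb \<union> x1 \<and> f \<le> real (card (Fout V E (extend (Q x0) L) k)) \<and> Fout V E (extend (Q x0) L) k \<inter> xb = {}"
  let ?R = "\<lambda>L p x0 xa xb x1. fst ` L \<subseteq> x0 \<union> xa \<union> xb \<union> x1 \<and> f \<le> real (card (Frot E (extend (Q x0) L) (fst p) (fst (snd p)) (snd (snd p)))) \<and> Frot E (extend (Q x0) L) (fst p) (fst (snd p)) (snd (snd p)) \<inter> xa = {}"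
  let ?C = "\<lambda>L U x0 xa xb x1. fst ` L \<subseteq> x0 \<union> xa \<union> xb \<union> x1 \<and> f \<le> real (card (Fclose E (extend (Q x0) L) U xa)) \<and> Fclose E (extend (Q x0) L) U xa \<inter> xb = {}"
  let ?K = "Pow V \<times> V \<times> Pow V"
  have finlab: "finite (labelled E)"
    by (rule finite_subset[of _ "E \<times> Pow V"]) (use E_sub in \<open>auto simp: labelled_def\<close>)
  have finI: "finite ?I" using finlab by simp
  have sub: "L \<subseteq> extend (Q x0) L" for L x0 by (auto simp: extend_def)
  have one: "prob4 (\<lambda>x0 xa xb x1. fst ` L \<subseteq> x0 \<union> xa \<union> xb \<union> x1 \<and> \<not> boosted \<theta> xa xb (extend (Q x0) L))
      \<le> (real n + 3) * 4 ^ n * exp (- \<mu> * f) * total ^ card L" if L: "L \<in> ?I" for L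
  proof -
    define b where "b = total ^ card L * exp (- \<mu> * f)"
    have b0: "0 \<le> b" using total_nonneg by (simp add: b_def)
    have cL: "card (fst ` L) = card L" using L by (intro card_image) auto
    have LE: "fst ` L \<subseteq> E" using L by (auto simp: labelled_def)
    have "prob4 (\<lambda>x0 xa xb x1. fst ` L \<subseteq> x0 \<union> xa \<union> xb \<union> x1 \<and> \<not> boosted \<theta> xa xb (extend (Q x0) L))
      \<le> prob4 (\<lambda>x0 xa xb x1. (\<exists>k\<in>{..n}. ?O L k x0 xa xb x1) \<or> ((\<exists>p\<in>?K. ?R L p x0 xa xb x1) \<or> (\<exists>U\<in>Pow V. ?C L U x0 xa xb x1)))"
    proof (rule prob4_mono)
      fix x0 xa xb x1 :: "'a set set"
      assume h: "fst ` L \<subseteq> x0 \<union> xa \<union> xb \<union> x1 \<and> \<not> boosted \<theta> xa xb (extend (Q x0) L)"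
      \<comment> \<open>A positive threshold makes the booster set nonempty, so a path on
        \<open>Suc k\<close> vertices exists; this leaves finitely many \<open>k\<close>.\<close>
      have kn: "k \<le> n" if k: "f \<le> real (card (Fout V E (extend (Q x0) L) k))" for k
      proof -
        have "Fout V E (extend (Q x0) L) k \<noteq> {}" using k f0 by auto
        then obtain D p where "gpath D p" "set p \<subseteq> V" "length p = Suc k" by (auto simp: Fout_def)
        then have "Suc k \<le> n" using card_mono[OF finV, of "set p"] by (simp add: gpath_def distinct_card)
        then show ?thesis by simp
      qed
      consider k where "f \<le> real (card (Fout V E (extend (Q x0) L) k))" "Fout V E (extend (Q x0) L) k \<inter> xb = {}"
        | U v B where "U \<subseteq> V" "v \<in> V" "B \<subseteq> V" "f \<le> real (card (Frot E (extend (Q x0) L) U v B))" "Frot E (extend (Q x0) L) U v B \<inter> xa = {}"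
        | U where "U \<subseteq> V" "f \<le> real (card (Fclose E (extend (Q x0) L) U xa))" "Fclose E (extend (Q x0) L) U xa \<inter> xb = {}"
        using h unfolding boosted_def f_def by blast
      then show "(\<exists>k\<in>{..n}. ?O L k x0 xa xb x1) \<or> ((\<exists>p\<in>?K. ?R L p x0 xa xb x1) \<or> (\<exists>U\<in>Pow V. ?C L U x0 xa xb x1))"
      proof cases
        case 1 then show ?thesis using h kn by blast
      next
        case 2
        then have "\<exists>p\<in>?K. ?R L p x0 xa xb x1" using h by (intro bexI[of _ "(U, v, B)"]) auto
        then show ?thesis by blast
      next
        case 3 then show ?thesis using h by blast
      qed
    qed
    also have "\<dots> \<le> prob4 (\<lambda>x0 xa xb x1. \<exists>k\<in>{..n}. ?O L k x0 xa xb x1)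
        + (prob4 (\<lambda>x0 xa xb x1. \<exists>p\<in>?K. ?R L p x0 xa xb x1) + prob4 (\<lambda>x0 xa xb x1. \<exists>U\<in>Pow V. ?C L U x0 xa xb x1))"
      by (intro order.trans[OF prob4_disj] add_left_mono prob4_disj)
    also have "\<dots> \<le> (\<Sum>k\<in>{..n}. prob4 (?O L k)) + ((\<Sum>p\<in>?K. prob4 (?R L p)) + (\<Sum>U\<in>Pow V. prob4 (?C L U)))"
      by (intro add_mono prob4_bex) auto
    also have "\<dots> \<le> (\<Sum>k\<in>{..n}. b) + ((\<Sum>p\<in>?K. b) + (\<Sum>U\<in>Pow V. b))"
    proof (intro add_mono sum_mono)
      \<comment> \<open>Hyperedges carrying a label are excluded from every booster set; this is the
        disjointness that makes hitting independent of the presence of \<open>L\<close>.\<close>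
      have dis: "fst ` L \<inter> (E - fst ` extend (Q x0) L) = {}" for x0 using sub by blast
      fix k show "prob4 (?O L k) \<le> b"
        unfolding b_def using cL \<mu> prob4_hit_b[OF LE, of "\<lambda>x0 xa. Fout V E (extend (Q x0) L) k" f] dis
        by (simp add: Fout_def) (use dis in blast)
    next
      have dis: "fst ` L \<inter> (E - fst ` extend (Q x0) L) = {}" for x0 using sub by blast
      fix p show "prob4 (?R L p) \<le> b"
        unfolding b_def using cL \<mu> prob4_hit_a[OF LE, of "\<lambda>x0. Frot E (extend (Q x0) L) (fst p) (fst (snd p)) (snd (snd p))" f]
        by (simp add: Frot_def) (use dis in blast)
    next
      have dis: "fst ` L \<inter> (E - fst ` extend (Q x0) L) = {}" for x0 using sub by blast
      fix U show "prob4 (?C L U) \<le> b"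
        unfolding b_def using cL \<mu> prob4_hit_b[OF LE, of "\<lambda>x0 xa. Fclose E (extend (Q x0) L) U xa" f]
        by (simp add: Fclose_def) (use dis in blast)
    qed
    also have "\<dots> = ((real n + 1) + (real n * 4 ^ n + 2 ^ n)) * b"
    proof -
      have "(2::real) ^ n * 2 ^ n = 4 ^ n" by (simp add: power_mult_distrib[symmetric])
      then show ?thesis by (simp add: card_cartesian_product card_Pow algebra_simps)
    qed
    also have "\<dots> \<le> ((real n + 3) * 4 ^ n) * b"
    proof (rule mult_right_mono)
      have "(2::real) ^ n \<le> 4 ^ n" by (intro power_mono) auto
      moreover have "real n < 2 ^ n" by (rule of_nat_less_two_power)
      moreover have "(1::real) \<le> 4 ^ n" by simp
      ultimately have "real n + 1 + 2 ^ n \<le> 3 * 4 ^ n" by linarith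
      then show "(real n + 1) + (real n * 4 ^ n + 2 ^ n) \<le> (real n + 3) * 4 ^ n" by (simp add: algebra_simps)
    qed (rule b0)
    finally show ?thesis by (simp add: b_def mult_ac)
  qed
  have "prob4 (\<lambda>x0 xa xb x1. \<exists>L. labelling (x0 \<union> xa \<union> xb \<union> x1) L \<and> card L \<le> m \<and> \<not> boosted \<theta> xa xb (extend (Q x0) L))
    \<le> (\<Sum>L\<in>?I. prob4 (\<lambda>x0 xa xb x1. fst ` L \<subseteq> x0 \<union> xa \<union> xb \<union> x1 \<and> \<not> boosted \<theta> xa xb (extend (Q x0) L)))"
  proof (rule prob4_union[OF finI])
    fix x0 xa xb x1 :: "'a set set" assume x: "x0 \<subseteq> E" "xa \<subseteq> E" "xb \<subseteq> E" "x1 \<subseteq> E"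
    assume "\<exists>L. labelling (x0 \<union> xa \<union> xb \<union> x1) L \<and> card L \<le> m \<and> \<not> boosted \<theta> xa xb (extend (Q x0) L)"
    then obtain L where L: "labelling (x0 \<union> xa \<union> xb \<union> x1) L" "card L \<le> m" "\<not> boosted \<theta> xa xb (extend (Q x0) L)" by blast
    then have "L \<in> ?I" using x by (auto simp: labelling_def labelled_def)
    moreover have "fst ` L \<subseteq> x0 \<union> xa \<union> xb \<union> x1" using L(1) by (auto simp: labelling_def labelled_def)
    ultimately show "\<exists>L\<in>?I. fst ` L \<subseteq> x0 \<union> xa \<union> xb \<union> x1 \<and> \<not> boosted \<theta> xa xb (extend (Q x0) L)" using L(3) by blast
  qed
  also have "\<dots> \<le> (\<Sum>L\<in>?I. (real n + 3) * 4 ^ n * exp (- \<mu> * f) * total ^ card L)" by (intro sum_mono one)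
  also have "\<dots> \<le> (\<Sum>L | L \<subseteq> labelled E \<and> card L \<le> m. (real n + 3) * 4 ^ n * exp (- \<mu> * f) * total ^ card L)"
    using finlab total_nonneg by (intro sum_mono2) auto
  also have "\<dots> = (real n + 3) * 4 ^ n * exp (- \<mu> * f) * (\<Sum>L | L \<subseteq> labelled E \<and> card L \<le> m. total ^ card L)"
    by (simp add: sum_distrib_left)
  also have "\<dots> \<le> (real n + 3) * 4 ^ n * exp (- \<mu> * f) * (1 / y ^ m * exp (y * total * real (card (labelled E))))"
    using finlab total_nonneg y by (intro mult_left_mono sum_small_subsets) auto
  also have "\<dots> \<le> (real n + 3) * 4 ^ n * exp (- \<mu> * f) * (1 / y ^ m * exp (y * total * (real (r\<^sup>2) * real n ^ r)))"
    using y total_nonneg card_labelled_le by (intro mult_left_mono) (auto intro!: mult_left_mono)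
  finally show ?thesis by (simp add: f_def)
qed

end

section \<open>From the random properties to Hamiltonicity\<close>

lemma far_apart_mono: "far_apart \<Gamma>' S \<Longrightarrow> \<Gamma> \<subseteq> \<Gamma>' \<Longrightarrow> far_apart \<Gamma> S"
  unfolding far_apart_def subset_iff by meson

lemma labelling_mono: "labelling \<Gamma> L \<Longrightarrow> \<Gamma> \<subseteq> \<Gamma>' \<Longrightarrow> L' \<subseteq> L \<Longrightarrow> labelling \<Gamma>' L'"
  unfolding labelling_def labelled_def by (auto intro: inj_on_subset)

context dirac_hypergraph
begin

lemma locally_sparse_mono:
  assumes "locally_sparse c k \<Gamma>'" "\<Gamma> \<subseteq> \<Gamma>'" "finite \<Gamma>'"
  shows "locally_sparse c k \<Gamma>"
  unfolding locally_sparse_def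
proof (intro allI impI)
  fix T assume T: "T \<subseteq> V" "T \<noteq> {}" "real (card T) \<le> c * real n"
  have "card {e \<in> \<Gamma>. 2 \<le> card (e \<inter> T)} \<le> card {e \<in> \<Gamma>'. 2 \<le> card (e \<inter> T)}"
    using assms(2,3) by (intro card_mono) auto
  moreover have "7 * card {e \<in> \<Gamma>'. 2 \<le> card (e \<inter> T)} < k * card T"
    using assms(1) T by (simp add: locally_sparse_def)
  ultimately show "7 * card {e \<in> \<Gamma>. 2 \<le> card (e \<inter> T)} < k * card T" by linarith
qed

definition large :: "nat \<Rightarrow> 'a set set \<Rightarrow> 'a set" where
  "large k X = {v \<in> V. r * (k + 2) \<le> card {e \<in> X. v \<in> e}}"

text \<open>The choice operator makes the owned family a function of \<open>X\<close> alone, as the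
  union bound over the remaining hyperedges requires.\<close>

definition owned :: "nat \<Rightarrow> 'a set set \<Rightarrow> ('a set \<times> 'a set) set" where
  "owned k X = \<Union>((SOME Ow. owners X (large k X) (k + 2) Ow) ` large k X)"

text \<open>The random properties are stated for the final union only, but hold for every
  intermediate \<open>\<Gamma>\<close>: they are inherited by subsets, and the owned family lies in
  \<open>x0\<close>. The bound \<open>5 * n + 5\<close> consists of the two hyperedges per small
  vertex and the \<open>3 * n + 3\<close> of the extremal argument.\<close>

lemma hamiltonian_between:
  fixes c \<theta> :: real
  assumes c: "0 < c" and x: "x0 \<subseteq> E" "xa \<subseteq> E" "xb \<subseteq> E" "x1 \<subseteq> E"
    and far: "far_apart (x0 \<union> xa \<union> xb \<union> x1) {v \<in> V. card {e \<in> x0. v \<in> e} < r * (k + 2)}"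
    and sparse: "locally_sparse (7 * c) k (x0 \<union> xa \<union> xb \<union> x1)"
    and boost: "\<And>L. labelling (x0 \<union> xa \<union> xb \<union> x1) L \<Longrightarrow> card L \<le> 5 * n + 5 \<Longrightarrow> boosted \<theta> xa xb (extend (owned k x0) L)"
    and theta: "real (r\<^sup>2) * (\<theta> * real n ^ r + (real ((k + 2) * n + 2 * n) + 3 * real n + 3))
      \<le> c * \<epsilon> / 8 * (real n)\<^sup>2 * (\<epsilon> * real n ^ (r - 2) - 1)"
    and \<Gamma>: "x0 \<union> xa \<union> xb \<subseteq> \<Gamma>" "\<Gamma> \<subseteq> x0 \<union> xa \<union> xb \<union> x1" and deg: "min_degree_at_least 2 V \<Gamma>"
  shows "has_berge_hamilton_cycle V \<Gamma>"
proof -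
  let ?\<Gamma>1 = "x0 \<union> xa \<union> xb \<union> x1"
  define S where "S = large k x0"
  define Ow where "Ow = (SOME Ow. owners x0 S (k + 2) Ow)"
  have SV: "S \<subseteq> V" by (auto simp: S_def large_def)
  have \<Gamma>1E: "?\<Gamma>1 \<subseteq> E" using x by auto
  have \<Gamma>E: "\<Gamma> \<subseteq> E" using \<Gamma>(2) \<Gamma>1E by auto
  have fin1: "finite ?\<Gamma>1" using \<Gamma>1E finE by (rule finite_subset)
  have "\<exists>Ow. owners x0 S (k + 2) Ow"
  proof (rule owners_labelled_exist)
    show "finite x0" using x(1) finE by (rule finite_subset)
    show "finite S" using SV finV by (rule finite_subset)
    show "finite e \<and> card e = r" if "e \<in> x0" for e using that x(1) E_card by auto
    show "r * (k + 2) \<le> card {e \<in> x0. v \<in> e}" if "v \<in> S" for v using that by (simp add: S_def large_def)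
  qed (use r3 in simp)
  then have Ow: "owners x0 S (k + 2) Ow" unfolding Ow_def by (rule someI_ex)
  define Q where "Q = \<Union>(Ow ` S)"
  have Qowned: "owned k x0 = Q" by (simp add: owned_def Q_def Ow_def S_def)
  have labQ: "labelling \<Gamma> Q" using Ow \<Gamma>(1) unfolding owners_def Q_def by (blast intro: labelling_mono)
  have cQ: "card Q \<le> (k + 2) * n"
  proof -
    have "finite S" using SV finV by (rule finite_subset)
    then have "card Q \<le> (\<Sum>v\<in>S. card (Ow v))" unfolding Q_def by (rule card_UN_le)
    also have "\<dots> = (k + 2) * card S" using Ow by (simp add: owners_def)
    also have "\<dots> \<le> (k + 2) * n" using SV by (intro mult_le_mono2 card_mono) auto
    finally show ?thesis .
  qed
  have "V - S = {v \<in> V. card {e \<in> x0. v \<in> e} < r * (k + 2)}" by (auto simp: S_def large_def)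
  then have far': "far_apart \<Gamma> (V - S)" using far_apart_mono[OF far \<Gamma>(2)] by simp
  obtain L1 where L1: "labelling \<Gamma> L1" "card L1 \<le> 2 * n" "expanding c (snd ` extend Q L1)"
    using expander_exists[OF \<Gamma>E _ SV Ow far' locally_sparse_mono[OF sparse \<Gamma>(2) fin1] deg] \<Gamma>(1)
    unfolding Q_def by auto
  let ?L0 = "extend Q L1"
  have labL0: "labelling \<Gamma> ?L0" using labQ L1(1) by (rule labelling_extend)
  show ?thesis
  proof (rule boosted_hamiltonian[OF c \<Gamma>E _ _ labL0 L1(3) _ theta])
    show "xa \<subseteq> \<Gamma>" "xb \<subseteq> \<Gamma>" using \<Gamma>(1) by auto
    have finQ: "finite Q"
      by (rule finite_subset[of _ "E \<times> Pow V"]) (use labQ \<Gamma>E E_sub in \<open>fastforce simp: labelling_def labelled_def\<close>, simp)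
    have "card ?L0 \<le> card {p \<in> Q. fst p \<notin> fst ` L1} + card L1" unfolding extend_def by (rule card_Un_le)
    also have "\<dots> \<le> card Q + card L1" using finQ by (intro add_right_mono card_mono) auto
    finally have "card ?L0 \<le> (k + 2) * n + 2 * n" using cQ L1(2) by linarith
    then have "real (card ?L0) \<le> real ((k + 2) * n + 2 * n)" by (rule of_nat_mono)
    then show "real (card ?L0) + 3 * real n + 3 \<le> real ((k + 2) * n + 2 * n) + 3 * real n + 3" by simp
    fix L assume L: "?L0 \<subseteq> L" "labelling \<Gamma> L" "card (L - ?L0) \<le> 3 * n + 3"
    let ?M = "L1 \<union> (L - ?L0)"
    have "L1 \<subseteq> ?L0" by (auto simp: extend_def)
    then have "?M \<subseteq> L" using L(1) by auto
    then have labM: "labelling ?\<Gamma>1 ?M" using L(2) \<Gamma>(2) by (blast intro: labelling_mono)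
    have "card ?M \<le> card L1 + card (L - ?L0)" by (rule card_Un_le)
    then have "card ?M \<le> 5 * n + 5" using L1(2) L(3) by linarith
    moreover have "extend Q ?M = L" using L by (intro extend_enlarge) (auto simp: labelling_def)
    ultimately show "boosted \<theta> xa xb L" using boost[OF labM] Qowned by simp
  qed
qed

end

section \<open>The exceptional events combined\<close>

context dirac_random
begin

lemma prob_hitting_times_eq:
  fixes k :: nat and c \<theta> \<mu> a d y z :: real
  assumes c: "0 < c" and \<theta>: "0 < \<theta>" and \<mu>: "\<mu>a = \<mu>" "\<mu>b = \<mu>"
    and d: "\<And>v. v \<in> V \<Longrightarrow> d \<le> real (card (star v))" and m1: "\<mu>1 \<le> 1"
    and y: "0 < y" "y \<le> 1" and z: "0 < z" "z \<le> 1"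
    and a: "0 \<le> a" "7 * exp (1 + a) * (7 * c) * (total * real n ^ (r - 1)) \<le> real k" "3 * ln (real n) \<le> a * real k / 7"
    and theta: "real (r\<^sup>2) * (\<theta> * real n ^ r + (real ((k + 2) * n + 2 * n) + 3 * real n + 3))
      \<le> c * \<epsilon> / 8 * (real n)\<^sup>2 * (\<epsilon> * real n ^ (r - 2) - 1)"
    and S: "S = (\<Sum>v\<in>V. exp (- \<mu>i * real (card (star v))))" "0 < S"
  shows "1 - ((1 / S + (exp (\<mu>i * real n ^ (r - 2)) - 1))
      + (real n * (2 * exp 1 * exp (- \<mu>1 * d / 2))
      + ((\<Sum>s\<in>V. exp (- \<mu>0 * real (card (star s)))) * exp (- \<mu>0 * d) *
          ((1 / y ^ (2 * (r * (k + 2))) * exp (2 * y * total * exp \<mu>0 * real n ^ (r - 1) + \<mu>0 * (real n ^ (r - 2) + 4)))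
            * real r * (3 + real r * real n ^ (r - 1) * total) ^ 4)
      + ((exp (1 / (real n)\<^sup>2) - 1)
      + (real n + 3) * 4 ^ n * exp (- \<mu> * (\<theta> * real n ^ r)) * (1 / z ^ (5 * n + 5) * exp (z * total * (real (r\<^sup>2) * real n ^ r)))))))
    \<le> measure_pmf.prob (random_ordering E)
        {\<sigma>. hitting_time (min_degree_at_least 2) V \<sigma> = hitting_time has_berge_hamilton_cycle V \<sigma>}"
    (is "1 - (?B1 + (?B2 + (?B3 + (?B4 + ?B5)))) \<le> _")
proof -
  \<comment> \<open>An isolated vertex is more than needed for minimum degree below two, but
    isolation is a pure avoidance event with an exact probability.\<close>
  let ?P1 = "\<lambda>x0 xa xb x1. \<forall>v\<in>V. star v \<inter> (x0 \<union> xa \<union> xb) \<noteq> {}"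
  let ?P2 = "\<lambda>x0 xa xb x1. \<not> min_degree_at_least 2 V x1"
  let ?P3 = "\<lambda>x0 xa xb x1. \<not> far_apart (x0 \<union> xa \<union> xb \<union> x1) {v \<in> V. card {e \<in> x0. v \<in> e} < r * (k + 2)}"
  let ?P4 = "\<lambda>x0 xa xb x1. \<not> locally_sparse (7 * c) k (x0 \<union> xa \<union> xb \<union> x1)"
  let ?P5 = "\<lambda>x0 xa xb x1. \<exists>L. labelling (x0 \<union> xa \<union> xb \<union> x1) L \<and> card L \<le> 5 * n + 5 \<and> \<not> boosted \<theta> xa xb (extend (owned k x0) L)"
  let ?bad = "\<lambda>x0 xa xb x1. ?P1 x0 xa xb x1 \<or> (?P2 x0 xa xb x1 \<or> (?P3 x0 xa xb x1 \<or> (?P4 x0 xa xb x1 \<or> ?P5 x0 xa xb x1)))"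
  have "prob4 ?P1 \<le> ?B1"
  proof (rule prob4_no_avoid[OF finV _ _ S])
    fix u v assume "u \<in> V" "v \<in> V" "u \<noteq> v"
    then have "real (card (star u \<inter> star v)) \<le> real (n ^ (r - 2))" by (intro of_nat_mono codegree_le)
    then show "real (card (star u \<inter> star v)) \<le> real n ^ (r - 2)" by simp
  qed auto
  moreover have "prob4 ?P2 \<le> ?B2" using d m1 by (rule prob_min_degree)
  moreover have "prob4 ?P3 \<le> ?B3" using d y by (rule prob_far_apart)
  moreover have "prob4 ?P4 \<le> ?B4" using a by (rule prob_locally_sparse)
  moreover have "prob4 ?P5 \<le> ?B5" using \<theta> z \<mu> by (rule prob_not_boosted)
  moreover have "prob4 ?bad \<le> prob4 ?P1 + (prob4 ?P2 + (prob4 ?P3 + (prob4 ?P4 + prob4 ?P5)))"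
    by (intro order.trans[OF prob4_disj] add_left_mono order_refl)
  ultimately have "prob4 ?bad \<le> ?B1 + (?B2 + (?B3 + (?B4 + ?B5)))" by linarith
  then have "1 - (?B1 + (?B2 + (?B3 + (?B4 + ?B5)))) \<le> prob4 (\<lambda>x0 xa xb x1. \<not> ?bad x0 xa xb x1)"
    unfolding prob4_not by linarith
  also have "\<dots> \<le> measure_pmf.prob (pmf_of_set (permutations_of_set E))
        {\<sigma>. hitting_time (min_degree_at_least 2) V \<sigma> = hitting_time has_berge_hamilton_cycle V \<sigma>}"
  proof (rule transfer)
    fix x0 xa xb x1 \<sigma> i j
    assume x: "x0 \<subseteq> E" "xa \<subseteq> E" "xb \<subseteq> E" "x1 \<subseteq> E" and good: "\<not> ?bad x0 xa xb x1"
      and ij: "i \<le> j" "j \<le> length \<sigma>" and i: "set (take i \<sigma>) = x0 \<union> xa \<union> xb" and j: "set (take j \<sigma>) = x0 \<union> xa \<union> xb \<union> x1"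
    have md: "min_degree_at_least 2 V x1"
      and far: "far_apart (x0 \<union> xa \<union> xb \<union> x1) {v \<in> V. card {e \<in> x0. v \<in> e} < r * (k + 2)}"
      and sp: "locally_sparse (7 * c) k (x0 \<union> xa \<union> xb \<union> x1)"
      and bo: "\<And>L. labelling (x0 \<union> xa \<union> xb \<union> x1) L \<Longrightarrow> card L \<le> 5 * n + 5 \<Longrightarrow> boosted \<theta> xa xb (extend (owned k x0) L)"
      using good by blast+
    show "hitting_time (min_degree_at_least 2) V \<sigma> = hitting_time has_berge_hamilton_cycle V \<sigma>"
    proof (rule hitting_time_eq[OF ij])
      obtain v where v: "v \<in> V" "star v \<inter> (x0 \<union> xa \<union> xb) = {}" using good by blast
      then have "{e \<in> x0 \<union> xa \<union> xb. {v} \<subseteq> e} = {}" using x by blast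
      then have "degree (x0 \<union> xa \<union> xb) {v} = 0" unfolding degree_def by (simp only: card.empty)
      then show "\<not> min_degree_at_least 2 V (set (take i \<sigma>))"
        unfolding i min_degree_at_least_def using v(1) by fastforce
      have "finite (x0 \<union> xa \<union> xb \<union> x1)" by (rule finite_subset[OF _ finE]) (use x in auto)
      then show "min_degree_at_least 2 V (set (take j \<sigma>))"
        unfolding j by (intro min_degree_mono[OF md]) auto
      fix \<Gamma> assume "set (take i \<sigma>) \<subseteq> \<Gamma>" "\<Gamma> \<subseteq> set (take j \<sigma>)" "min_degree_at_least 2 V \<Gamma>"
      then show "has_berge_hamilton_cycle V \<Gamma>"
        unfolding i j by (intro hamiltonian_between[OF c x far sp _ theta] bo) assumption+
    qed (use n6 in simp)
  qed
  finally show ?thesis by (simp add: random_ordering_def)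
qed

end

section \<open>Asymptotics\<close>

lemma tendsto_isolated:
  fixes c \<eta> :: real
  assumes "0 < c" "0 < \<eta>"
  shows "(\<lambda>n::nat. real n powr (- \<eta>) + (exp (2 * ln (real n) / (c * real n)) - 1)) \<longlonglongrightarrow> 0"
  using assms by real_asymp

lemma tendsto_min_degree:
  "(\<lambda>n::nat. real n * (2 * exp 1 * exp (- 2 * ln (real n)))) \<longlonglongrightarrow> 0"
  by real_asymp

lemma tendsto_far_apart:
  fixes a b K :: real
  assumes "0 < a" "0 < b"
  shows "(\<lambda>n::nat. K * (exp (- a * ln (real n)) * (3 + b * ln (real n)) ^ 4)) \<longlonglongrightarrow> 0"
proof -
  have "(\<lambda>n::nat. exp (- a * ln (real n)) * (3 + b * ln (real n)) ^ 4) \<longlonglongrightarrow> 0"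
    using assms by real_asymp
  then show ?thesis by (rule tendsto_mult_right_zero)
qed

lemma tendsto_sparse: "(\<lambda>n::nat. exp (1 / (real n)\<^sup>2) - 1) \<longlonglongrightarrow> 0"
  by real_asymp

lemma tendsto_boosted:
  fixes a b c :: real
  assumes "0 < a" "0 < b"
  shows "(\<lambda>n::nat. (real n + 3) * exp (b * real n + c - a * (real n * ln (real n)))) \<longlonglongrightarrow> 0"
proof -
  have "(\<lambda>n::nat. exp c * ((real n + 3) * exp (b * real n - a * (real n * ln (real n))))) \<longlonglongrightarrow> exp c * 0"
    by (intro tendsto_mult tendsto_const) (use assms in real_asymp)
  then show ?thesis by (simp add: exp_add exp_diff mult_ac)
qed

lemma eventually_threshold:
  fixes A B C D :: real
  assumes "0 < A" "0 < D"
  shows "\<forall>\<^sub>F n in sequentially. B * (real n * (C * ln (real n) + 8) + 3) + A * (real n)\<^sup>2 \<le> D * real n ^ 3"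
  by (cases "B = 0"; cases "C = 0") (use assms in real_asymp)+

text \<open>Since degrees vary, the rate comes from the intermediate value theorem: the sum equals
  \<open>n\<close> at rate zero and is at most one at \<open>ln n / (c1 * NN)\<close>.\<close>

lemma (in dirac_hypergraph) rate_exists:
  fixes c1 \<delta> \<eta> :: real
  assumes c1: "0 < c1" "\<And>v. v \<in> V \<Longrightarrow> c1 * real n ^ (r - 1) \<le> real (card (star v))"
    and \<delta>: "0 \<le> \<delta>" "2 * \<delta> \<le> 1" and \<eta>: "0 \<le> \<eta>" "\<eta> \<le> 1 / 2"
  shows "\<exists>\<rho>\<ge>0. (\<Sum>v\<in>V. exp (- ((1 + 2 * \<delta>) * \<rho>) * real (card (star v)))) = real n powr \<eta> \<and>
    \<rho> * real n ^ (r - 1) \<le> ln (real n) / c1 \<and> ln (real n) / 8 \<le> \<rho> * real n ^ (r - 1)"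
proof -
  define NN where "NN = real n ^ (r - 1)"
  define g where "g x = (\<Sum>v\<in>V. exp (- ((1 + 2 * \<delta>) * x) * real (card (star v))))" for x :: real
  have n1: "1 \<le> real n" and n0: "0 < real n" using n6 by auto
  have Vne: "V \<noteq> {}" using n6 by auto
  have l0: "0 \<le> ln (real n)" using n1 by simp
  have NN0: "0 < NN" using n0 by (simp add: NN_def)
  define m where "m = ln (real n) / (c1 * NN)"
  have m0: "0 \<le> m" using l0 c1(1) NN0 by (simp add: m_def)
  have "real n powr \<eta> \<le> real n powr 1" using n1 \<eta> by (intro powr_mono) auto
  then have g0: "real n powr \<eta> \<le> g 0" using n0 by (simp add: g_def)
  have "g m \<le> (\<Sum>v\<in>V. 1 / real n)"
    unfolding g_def
  proof (rule sum_mono)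
    fix v assume v: "v \<in> V"
    have "ln (real n) = m * (c1 * NN)" using c1(1) NN0 by (simp add: m_def)
    also have "\<dots> \<le> m * real (card (star v))" using c1(2)[OF v] m0 by (intro mult_left_mono) (auto simp: NN_def)
    also have "\<dots> \<le> (1 + 2 * \<delta>) * m * real (card (star v))"
      using m0 \<delta> by (intro mult_right_mono) (auto simp: algebra_simps)
    finally have "exp (- ((1 + 2 * \<delta>) * m) * real (card (star v))) \<le> exp (- ln (real n))" by simp
    then show "exp (- ((1 + 2 * \<delta>) * m) * real (card (star v))) \<le> 1 / real n"
      using n0 by (simp add: exp_minus divide_inverse)
  qed
  also have "\<dots> = 1" using n0 Vne by simp
  also have "1 \<le> real n powr \<eta>" using n1 \<eta> by (simp add: ge_one_powr_ge_zero)
  finally have gm: "g m \<le> real n powr \<eta>" .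
  have "continuous_on {0..m} g" unfolding g_def by (intro continuous_intros)
  from IVT2'[OF gm g0 m0 this] obtain x where x: "0 \<le> x" "x \<le> m" "g x = real n powr \<eta>" by blast
  have "x * NN \<le> m * NN" using x NN0 by (intro mult_right_mono) auto
  also have "\<dots> = ln (real n) / c1" using NN0 by (simp add: m_def)
  finally have up: "x * NN \<le> ln (real n) / c1" .
  \<comment> \<open>No degree exceeds \<open>NN\<close>, so a much smaller rate would leave more
    than \<open>n powr \<eta>\<close> isolated vertices in expectation.\<close>
  have "real n * exp (- (2 * (x * NN))) = (\<Sum>v\<in>V. exp (- (2 * (x * NN))))" by simp
  also have "\<dots> \<le> g x"
    unfolding g_def
  proof (rule sum_mono)
    fix v assume v: "v \<in> V"
    have "real (card (star v)) \<le> real (n ^ (r - 1))" using star_le[OF v] by (rule of_nat_mono)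
    then have "(1 + 2 * \<delta>) * x * real (card (star v)) \<le> 2 * x * NN"
      using x \<delta> by (intro mult_mono) (auto simp: NN_def)
    then show "exp (- (2 * (x * NN))) \<le> exp (- ((1 + 2 * \<delta>) * x) * real (card (star v)))" by simp
  qed
  also have "\<dots> = exp (\<eta> * ln (real n))" using x(3) n0 Vne by (simp add: powr_def)
  finally have "exp (ln (real n)) * exp (- (2 * (x * NN))) \<le> exp (\<eta> * ln (real n))" using n0 by simp
  then have "ln (real n) - 2 * (x * NN) \<le> \<eta> * ln (real n)" by (simp add: exp_add[symmetric])
  moreover have "\<eta> * ln (real n) \<le> 1 / 2 * ln (real n)" using \<eta> l0 by (intro mult_right_mono) auto
  ultimately have "ln (real n) / 8 \<le> x * NN" using l0 by linarith
  then show ?thesis using x up by (intro exI[of _ x]) (auto simp: g_def NN_def)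
qed

theorem theorem1p3:
  fixes \<epsilon> :: real and r :: nat
  assumes "\<epsilon> > 0" and "r \<ge> 3"
  shows "\<forall>\<delta>::real. \<delta> > 0 \<longrightarrow> (\<exists>N::nat. \<forall>n\<ge>N. \<forall>(V :: 'a set) (E :: 'a set set).
    uniform_hypergraph r V E \<and> card V = n \<and>
    (\<forall>v\<in>V. real (card {u \<in> V. real (codegree E u v) \<ge> \<epsilon> * real n ^ (r - 2)})
              \<ge> (1 / 2 + \<epsilon>) * real n)
    \<longrightarrow> measure_pmf.prob (random_ordering E)
          {\<sigma>. hitting_time (min_degree_at_least 2) V \<sigma>
               = hitting_time has_berge_hamilton_cycle V \<sigma>} \<ge> 1 - \<delta>)"
proof (intro allI impI)
  fix \<tau> :: real assume \<tau>: "\<tau> > 0"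
  show "\<exists>N::nat. \<forall>n\<ge>N. \<forall>(V :: 'a set) (E :: 'a set set).
    uniform_hypergraph r V E \<and> card V = n \<and>
    (\<forall>v\<in>V. real (card {u \<in> V. real (codegree E u v) \<ge> \<epsilon> * real n ^ (r - 2)})
              \<ge> (1 / 2 + \<epsilon>) * real n)
    \<longrightarrow> measure_pmf.prob (random_ordering E)
          {\<sigma>. hitting_time (min_degree_at_least 2) V \<sigma>
               = hitting_time has_berge_hamilton_cycle V \<sigma>} \<ge> 1 - \<tau>"
  proof (cases "\<epsilon> \<le> 1 / 2")
    \<comment> \<open>Here \<open>(1 / 2 + \<epsilon>) * n\<close> exceeds \<open>n\<close>, so no
      nonempty hypergraph qualifies.\<close>
    case False
    have "False" if cn: "card V = n" "n \<ge> 1"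
      and h: "\<forall>v\<in>V. real (card {u \<in> V. real (codegree E u v) \<ge> \<epsilon> * real n ^ (r - 2)}) \<ge> (1 / 2 + \<epsilon>) * real n"
      for V :: "'a set" and E n
    proof -
      have fin: "finite V" using cn card_ge_0_finite[of V] by simp
      have "V \<noteq> {}" using cn by auto
      then obtain v where "v \<in> V" by blast
      then have "(1 / 2 + \<epsilon>) * real n \<le> real (card {u \<in> V. real (codegree E u v) \<ge> \<epsilon> * real n ^ (r - 2)})" using h by blast
      also have "\<dots> \<le> real n" using cn(1) fin by (auto intro!: card_mono)
      finally have "(1 / 2 + \<epsilon>) * real n \<le> 1 * real n" by simp
      then show False using cn(2) False by (simp only: mult_le_cancel_right) auto
    qed
    then show ?thesis by (intro exI[of _ 1]) blast
  next
    case eps: True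
    define c1 where "c1 = \<epsilon> / (2 * real r)"
    have c1: "0 < c1" "c1 \<le> 1"
      using assms eps by (auto simp: c1_def field_simps)
    \<comment> \<open>The powers of \<open>n\<close> lost below are paid from the gain
      \<open>n powr (- c1 / 8)\<close> for a second small vertex nearby. As
      \<open>2 * \<delta> / c1 = c1 / 64\<close>, dropping \<open>xa\<close> and \<open>xb\<close>
      from the rate changes the expected count by at most \<open>n powr (c1 / 64)\<close>, as much
      as the count itself.\<close>
    define \<delta> where "\<delta> = c1\<^sup>2 / 128"
    define \<eta> where "\<eta> = c1 / 64"
    \<comment> \<open>Already \<open>x1\<close> alone must give minimum degree two: as
      \<open>\<rho> * NN\<close> is at least \<open>ln n / 8\<close>, each vertex fails with
      probability of order \<open>1 / n ^ 2\<close>.\<close>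
    define C1 where "C1 = 32 / c1"
    define Cp where "Cp = 2 + C1"
    \<comment> \<open>Chosen so that \<open>2 * y * exp 1 * Cp / c1 = c1 / 64\<close>; likewise
      \<open>\<eta>1\<close> satisfies
      \<open>2 * r * \<eta>1 * ln (1 / y) = c1 / 64\<close>.\<close>
    define y where "y = c1\<^sup>2 / (128 * exp 1 * Cp)"
    define \<eta>1 where "\<eta>1 = c1 / (128 * real r * ln (1 / y))"
    define k where "k n = nat \<lceil>\<eta>1 * ln (real n)\<rceil>" for n :: nat
    \<comment> \<open>\<open>a * \<eta>1 / 7 = 3\<close> is the exponent needed per vertex in the
      sparsity bound; \<open>c\<close> then makes the expected number of hyperedges fit below
      \<open>k\<close>.\<close>
    define a where "a = 21 / \<eta>1"
    define c where "c = \<eta>1 * c1 / (49 * exp (1 + a) * Cp)"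
    \<comment> \<open>A quarter of the available pairs pays for the threshold, three quarters for
      the labelled hyperedges. Then \<open>z\<close> is so small that the tilted enumeration uses at
      most half of the exponent \<open>\<delta> * \<theta> / 8 * n * ln n\<close>.\<close>
    define \<theta> where "\<theta> = c * \<epsilon>\<^sup>2 / (32 * (real r)\<^sup>2)"
    define z where "z = min 1 (\<delta> * \<theta> * c1 / (16 * (real r)\<^sup>2 * Cp))"
    have csq: "0 < c1\<^sup>2" "c1\<^sup>2 \<le> 1" using c1 by (auto simp: power_le_one)
    have \<delta>: "0 < \<delta>" "2 * \<delta> \<le> 1" using csq by (auto simp: \<delta>_def)
    have \<eta>: "0 < \<eta>" "\<eta> \<le> 1 / 2" using c1 by (auto simp: \<eta>_def)
    have C1: "1 \<le> C1" using c1 by (simp add: C1_def)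
    have Cp: "3 \<le> Cp" using C1 by (simp add: Cp_def)
    have e1: "1 \<le> exp (1::real)" by simp
    have y: "0 < y" "y < 1"
    proof -
      show "0 < y" using csq Cp by (simp add: y_def)
      have "1 * 3 \<le> exp (1::real) * Cp" using e1 Cp by (intro mult_mono) auto
      then have "c1\<^sup>2 < 128 * exp 1 * Cp" using csq by simp
      then show "y < 1" using Cp by (simp add: y_def)
    qed
    have lny: "0 < ln (1 / y)" using y by simp
    have \<eta>1: "0 < \<eta>1" using c1 lny assms by (simp add: \<eta>1_def)
    have a: "0 < a" using \<eta>1 by (simp add: a_def)
    have c: "0 < c" using \<eta>1 c1 Cp by (simp add: c_def)
    have \<theta>: "0 < \<theta>" using c assms by (simp add: \<theta>_def)
    have z: "0 < z" "z \<le> 1" "z * ((real r)\<^sup>2 * (Cp / c1)) \<le> \<delta> * \<theta> / 16"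
    proof -
      show "0 < z" "z \<le> 1" using \<delta> \<theta> c1 Cp assms by (auto simp: z_def)
      have "z * ((real r)\<^sup>2 * (Cp / c1)) \<le> \<delta> * \<theta> * c1 / (16 * (real r)\<^sup>2 * Cp) * ((real r)\<^sup>2 * (Cp / c1))"
        using c1 Cp by (intro mult_right_mono) (auto simp: z_def)
      also have "\<dots> = \<delta> * \<theta> / 16" using c1 Cp assms by (simp add: field_simps)
      finally show "z * ((real r)\<^sup>2 * (Cp / c1)) \<le> \<delta> * \<theta> / 16" .
    qed
    define K3 where "K3 = exp (6 * real r * ln (1 / y) + 5) * real r"
    define K5 where "K5 = 5 * ln (1 / z)"
    define K4 where "K4 = ln 4 + K5"
    have lnz: "0 \<le> ln (1 / z)" using z by simp
    have K4: "0 < K4" using lnz by (simp add: K4_def K5_def add_pos_nonneg)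
    define f1 where "f1 n = real n powr (- \<eta>) + (exp (2 * ln (real n) / (c1 * real n)) - 1)" for n :: nat
    define f2 where "f2 n = real n * (2 * exp 1 * exp (- 2 * ln (real n)))" for n :: nat
    define f3 where "f3 n = K3 * (exp (- (c1 / 16) * ln (real n)) * (3 + real r * Cp / c1 * ln (real n)) ^ 4)" for n :: nat
    define f4 where "f4 n = exp (1 / (real n)\<^sup>2) - 1" for n :: nat
    define f5 where "f5 n = (real n + 3) * exp (K4 * real n + K5 - \<delta> * \<theta> / 16 * (real n * ln (real n)))" for n :: nat
    have lim: "f1 \<longlonglongrightarrow> 0" "f2 \<longlonglongrightarrow> 0" "f3 \<longlonglongrightarrow> 0" "f4 \<longlonglongrightarrow> 0" "f5 \<longlonglongrightarrow> 0"
      unfolding f1_def f2_def f3_def f4_def f5_def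
      using c1 \<eta> Cp assms \<delta> \<theta> K4
      by (intro tendsto_isolated tendsto_min_degree tendsto_far_apart tendsto_sparse tendsto_boosted; simp)+
    have ev: "\<forall>\<^sub>F n in sequentially. f n < \<tau> / 5" if "f \<longlonglongrightarrow> 0" for f :: "nat \<Rightarrow> real"
      using that \<tau> by (intro order_tendstoD) auto
    have "\<forall>\<^sub>F n in sequentially. f1 n < \<tau> / 5 \<and> f2 n < \<tau> / 5 \<and> f3 n < \<tau> / 5 \<and> f4 n < \<tau> / 5 \<and> f5 n < \<tau> / 5 \<and>
      6 \<le> n \<and> 2 \<le> \<epsilon> * real n \<and> C1 * ln (real n) / (c1 * real n) \<le> 1 \<and>
      (real r)\<^sup>2 * (real n * (\<eta>1 * ln (real n) + 8) + 3) + c * \<epsilon> / 8 * (real n)\<^sup>2 \<le> 3 / 32 * c * \<epsilon>\<^sup>2 * real n ^ 3"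
    proof (intro eventually_conj ev lim)
      show "\<forall>\<^sub>F n in sequentially. 2 \<le> \<epsilon> * real n" using assms by real_asymp
      show "\<forall>\<^sub>F n in sequentially. C1 * ln (real n) / (c1 * real n) \<le> 1" using c1 C1 by real_asymp
      show "\<forall>\<^sub>F n in sequentially. (real r)\<^sup>2 * (real n * (\<eta>1 * ln (real n) + 8) + 3) + c * \<epsilon> / 8 * (real n)\<^sup>2 \<le> 3 / 32 * c * \<epsilon>\<^sup>2 * real n ^ 3"
        using c assms by (intro eventually_threshold) auto
    qed (rule eventually_ge_at_top)
    then obtain n0 where n0: "\<And>n. n \<ge> n0 \<Longrightarrow> f1 n < \<tau> / 5 \<and> f2 n < \<tau> / 5 \<and> f3 n < \<tau> / 5 \<and> f4 n < \<tau> / 5 \<and> f5 n < \<tau> / 5 \<and>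
      6 \<le> n \<and> 2 \<le> \<epsilon> * real n \<and> C1 * ln (real n) / (c1 * real n) \<le> 1 \<and>
      (real r)\<^sup>2 * (real n * (\<eta>1 * ln (real n) + 8) + 3) + c * \<epsilon> / 8 * (real n)\<^sup>2 \<le> 3 / 32 * c * \<epsilon>\<^sup>2 * real n ^ 3"
      unfolding eventually_sequentially by blast
    have main: "measure_pmf.prob (random_ordering E)
          {\<sigma>. hitting_time (min_degree_at_least 2) V \<sigma> = hitting_time has_berge_hamilton_cycle V \<sigma>} \<ge> 1 - \<tau>"
      if n: "n0 \<le> card V" and unif: "uniform_hypergraph r V E"
        and dirac: "\<forall>v\<in>V. real (card {u \<in> V. real (codegree E u v) \<ge> \<epsilon> * real (card V) ^ (r - 2)}) \<ge> (1 / 2 + \<epsilon>) * real (card V)"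
      for V :: "'a set" and E
    proof -
      note big = n0[OF n]
      interpret dirac_hypergraph V E r \<epsilon>
        by unfold_locales (use assms eps unif dirac big in auto)
      define NN where "NN = real n ^ (r - 1)"
      define l where "l = ln (real n)"
      have n0: "0 < real n" and n1: "1 \<le> real n" using n6 by auto
      have l0: "0 \<le> l" using n1 by (simp add: l_def)
      have Vne: "V \<noteq> {}" using n6 by auto
      have NN0: "0 < NN" using n0 by (simp add: NN_def)
      have NNn: "real n * real n ^ (r - 2) = NN" "NN * real n = real n ^ r" "real n \<le> NN" "real n ^ 3 \<le> real n ^ r"
        "(real n)\<^sup>2 * real n ^ (r - 2) = real n ^ r"
      proof -
        have "r - 1 = Suc (r - 2)" "r = Suc (r - 1)" "r = 2 + (r - 2)" using r3 by auto
        then show "real n * real n ^ (r - 2) = NN" "NN * real n = real n ^ r" "(real n)\<^sup>2 * real n ^ (r - 2) = real n ^ r"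
          unfolding NN_def by (metis power_Suc, metis power_Suc2, metis power_add)
        have "real n ^ 1 \<le> NN" unfolding NN_def using n1 r3 by (intro power_increasing) auto
        then show "real n \<le> NN" by simp
        show "real n ^ 3 \<le> real n ^ r" using n1 r3 by (intro power_increasing)
      qed
      have d: "c1 * NN \<le> real (card (star v))" if "v \<in> V" for v
        using star_ge[OF that] by (simp add: c1_def NN_def)
      obtain \<rho> where \<rho>0: "0 \<le> \<rho>" and S: "(\<Sum>v\<in>V. exp (- ((1 + 2 * \<delta>) * \<rho>) * real (card (star v)))) = real n powr \<eta>"
        and up: "\<rho> * NN \<le> l / c1" and lo: "l / 8 \<le> \<rho> * NN"
        using rate_exists[of c1 \<delta> \<eta>] d c1 \<delta> \<eta> unfolding NN_def l_def by auto
      interpret dirac_random V E r \<epsilon> \<rho> "\<delta> * \<rho>" "\<delta> * \<rho>" "C1 * \<rho>"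
        by unfold_locales (use \<rho>0 \<delta> C1 in auto)
      have mui: "\<mu>i = (1 + 2 * \<delta>) * \<rho>" by (simp add: \<mu>i_def algebra_simps)
      have tot: "total \<le> Cp * \<rho>"
      proof -
        have "total = (1 + 2 * \<delta> + C1) * \<rho>" by (simp add: total_def algebra_simps)
        also have "\<dots> \<le> Cp * \<rho>" using \<delta> \<rho>0 by (intro mult_right_mono) (auto simp: Cp_def)
        finally show ?thesis .
      qed
      have totN: "total * NN \<le> Cp / c1 * l"
      proof -
        have "total * NN \<le> Cp * \<rho> * NN" using tot NN0 by (intro mult_right_mono) auto
        also have "\<dots> = Cp * (\<rho> * NN)" by simp
        also have "\<dots> \<le> Cp * (l / c1)" using up Cp by (intro mult_left_mono) auto
        finally show ?thesis by simp
      qed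
      have lamn: "\<rho> \<le> l / (c1 * real n)"
      proof -
        have "\<rho> * real n \<le> \<rho> * NN" using NNn(3) \<rho>0 by (rule mult_left_mono)
        then have "\<rho> * real n \<le> l / c1" using up by linarith
        then show ?thesis using n0 c1(1) by (simp add: field_simps)
      qed
      have m1: "C1 * \<rho> \<le> 1"
      proof -
        have "C1 * \<rho> \<le> C1 * (l / (c1 * real n))" using lamn C1 by (intro mult_left_mono) auto
        also have "\<dots> \<le> 1" using big by (simp add: l_def)
        finally show ?thesis .
      qed
      have lam1: "\<rho> \<le> 1"
      proof -
        have "1 * \<rho> \<le> C1 * \<rho>" using C1 \<rho>0 by (rule mult_right_mono)
        then show ?thesis using m1 by simp
      qed
      have lamk: "\<rho> * real n ^ (r - 2) \<le> l / (c1 * real n)"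
      proof -
        have "\<rho> * real n ^ (r - 2) * real n \<le> l / c1" using up NNn(1) by (simp add: mult_ac)
        then show ?thesis using n0 c1(1) by (simp add: field_simps)
      qed
      have lamk1: "\<rho> * real n ^ (r - 2) \<le> 1"
      proof -
        have "1 * (l / (c1 * real n)) \<le> C1 * (l / (c1 * real n))" using C1 l0 c1 n0 by (intro mult_right_mono) auto
        then show ?thesis using lamk big by (simp add: l_def)
      qed
      define kk where "kk = k n"
      have kk: "\<eta>1 * l \<le> real kk" "real kk \<le> \<eta>1 * l + 1"
      proof -
        have "0 \<le> \<eta>1 * l" using \<eta>1 l0 by simp
        then show "\<eta>1 * l \<le> real kk" "real kk \<le> \<eta>1 * l + 1" unfolding kk_def k_def l_def by linarith+
      qed
      have A2: "7 * exp (1 + a) * (7 * c) * (total * NN) \<le> real kk"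
      proof -
        have "7 * exp (1 + a) * (7 * c) * (total * NN) \<le> 7 * exp (1 + a) * (7 * c) * (Cp / c1 * l)"
          using totN c by (intro mult_left_mono) auto
        also have "\<dots> = \<eta>1 * l" using c1 Cp by (simp add: c_def)
        finally show ?thesis using kk(1) by linarith
      qed
      have A3: "3 * ln (real n) \<le> a * real kk / 7"
      proof -
        have "3 * l = a * (\<eta>1 * l) / 7" using \<eta>1 by (simp add: a_def)
        also have "\<dots> \<le> a * real kk / 7" using kk(1) a by (intro divide_right_mono mult_left_mono) auto
        finally show ?thesis by (simp add: l_def)
      qed
      have theta: "real (r\<^sup>2) * (\<theta> * real n ^ r + (real ((kk + 2) * n + 2 * n) + 3 * real n + 3))
        \<le> c * \<epsilon> / 8 * (real n)\<^sup>2 * (\<epsilon> * real n ^ (r - 2) - 1)"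
      proof -
        have bt: "(real r)\<^sup>2 * (real n * (\<eta>1 * l + 8) + 3) + c * \<epsilon> / 8 * (real n)\<^sup>2 \<le> 3 / 32 * c * \<epsilon>\<^sup>2 * real n ^ 3"
          using big by (simp only: l_def)
        have "real ((kk + 2) * n + 2 * n) + 3 * real n + 3 = real n * (real kk + 7) + 3" by (simp add: algebra_simps)
        also have "\<dots> \<le> real n * (\<eta>1 * l + 8) + 3" using kk(2) n0 by simp
        finally have "real (r\<^sup>2) * (\<theta> * real n ^ r + (real ((kk + 2) * n + 2 * n) + 3 * real n + 3))
          \<le> (real r)\<^sup>2 * (\<theta> * real n ^ r + (real n * (\<eta>1 * l + 8) + 3))"
          by (simp add: mult_left_mono)
        also have "\<dots> = c * \<epsilon>\<^sup>2 / 32 * real n ^ r + (real r)\<^sup>2 * (real n * (\<eta>1 * l + 8) + 3)"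
          using assms by (simp add: \<theta>_def distrib_left)
        also have "\<dots> \<le> c * \<epsilon>\<^sup>2 / 32 * real n ^ r + (3 / 32 * c * \<epsilon>\<^sup>2 * real n ^ 3 - c * \<epsilon> / 8 * (real n)\<^sup>2)"
          using bt by linarith
        also have "\<dots> \<le> c * \<epsilon>\<^sup>2 / 32 * real n ^ r + (3 / 32 * c * \<epsilon>\<^sup>2 * real n ^ r - c * \<epsilon> / 8 * (real n)\<^sup>2)"
          using NNn(4) c by (intro add_left_mono diff_right_mono mult_left_mono) auto
        also have "\<dots> = c * \<epsilon> / 8 * (real n)\<^sup>2 * (\<epsilon> * real n ^ (r - 2) - 1)"
          unfolding NNn(5)[symmetric] by (simp add: power2_eq_square algebra_simps)
        finally show ?thesis .
      qed
      have S': "real n powr \<eta> = (\<Sum>v\<in>V. exp (- \<mu>i * real (card (star v))))" unfolding mui using S by simp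
      have Spos: "0 < real n powr \<eta>" using n0 Vne by simp
      have B1: "1 / (real n powr \<eta>) + (exp (\<mu>i * real n ^ (r - 2)) - 1) \<le> f1 n"
      proof -
        have "\<mu>i * real n ^ (r - 2) \<le> 2 * (\<rho> * real n ^ (r - 2))"
          unfolding mui using \<delta> \<rho>0 by (simp add: mult.assoc mult_right_mono)
        also have "\<dots> \<le> 2 * l / (c1 * real n)" using lamk by simp
        finally show ?thesis by (simp add: f1_def l_def powr_minus divide_inverse)
      qed
      have B2: "real n * (2 * exp 1 * exp (- (C1 * \<rho>) * (c1 * NN) / 2)) \<le> f2 n"
      proof -
        have "- (C1 * \<rho>) * (c1 * NN) / 2 = - 16 * (\<rho> * NN)" using c1 by (simp add: C1_def)
        then have "- (C1 * \<rho>) * (c1 * NN) / 2 \<le> - 2 * l" using lo by linarith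
        then show ?thesis unfolding f2_def l_def using n0 by (intro mult_left_mono) auto
      qed
      have B3: "(\<Sum>s\<in>V. exp (- \<rho> * real (card (star s)))) * exp (- \<rho> * (c1 * NN)) *
          ((1 / y ^ (2 * (r * (kk + 2))) * exp (2 * y * total * exp \<rho> * NN + \<rho> * (real n ^ (r - 2) + 4)))
            * real r * (3 + real r * NN * total) ^ 4) \<le> f3 n"
      proof -
        have T1: "(\<Sum>s\<in>V. exp (- \<rho> * real (card (star s)))) \<le> exp (c1 / 64 * l) * exp (c1 / 64 * l)"
        proof -
          have "(\<Sum>s\<in>V. exp (- \<rho> * real (card (star s))))
            \<le> (\<Sum>s\<in>V. exp (- ((1 + 2 * \<delta>) * \<rho>) * real (card (star s))) * exp (c1 / 64 * l))"
          proof (rule sum_mono)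
            fix s assume s: "s \<in> V"
            have "real (card (star s)) \<le> real (n ^ (r - 1))" using star_le[OF s] by (rule of_nat_mono)
            then have "\<rho> * real (card (star s)) \<le> \<rho> * NN" using \<rho>0 by (intro mult_left_mono) (auto simp: NN_def)
            then have "\<rho> * real (card (star s)) \<le> l / c1" using up by linarith
            then have "2 * \<delta> * (\<rho> * real (card (star s))) \<le> 2 * \<delta> * (l / c1)" using \<delta> by (intro mult_left_mono) auto
            also have "\<dots> = c1 / 64 * l" using c1 by (simp add: \<delta>_def power2_eq_square)
            finally show "exp (- \<rho> * real (card (star s))) \<le> exp (- ((1 + 2 * \<delta>) * \<rho>) * real (card (star s))) * exp (c1 / 64 * l)"
              by (simp add: exp_add[symmetric] algebra_simps)
          qed
          also have "\<dots> = real n powr \<eta> * exp (c1 / 64 * l)" by (simp add: sum_distrib_right[symmetric] S[simplified])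
          also have "real n powr \<eta> = exp (c1 / 64 * l)" using n0 Vne by (simp add: powr_def \<eta>_def l_def)
          finally show ?thesis .
        qed
        have T2: "exp (- \<rho> * (c1 * NN)) \<le> exp (- (c1 / 8) * l)"
          using mult_left_mono[OF lo, of c1] c1 by (simp add: mult_ac)
        have T3: "1 / y ^ (2 * (r * (kk + 2))) \<le> exp (c1 / 64 * l + 6 * real r * ln (1 / y))"
        proof -
          have "1 / y ^ (2 * (r * (kk + 2))) = exp (real (2 * (r * (kk + 2))) * ln (1 / y))"
            using y by (subst exp_of_nat_mult) (simp add: power_one_over)
          also have "\<dots> \<le> exp (2 * real r * (\<eta>1 * l + 3) * ln (1 / y))"
          proof -
            have "real (2 * (r * (kk + 2))) \<le> 2 * real r * (\<eta>1 * l + 3)"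
            proof -
              have "real (2 * (r * (kk + 2))) = 2 * real r * (real kk + 2)" by (simp add: algebra_simps)
              also have "\<dots> \<le> 2 * real r * (\<eta>1 * l + 3)" using kk(2) by (intro mult_left_mono) auto
              finally show ?thesis .
            qed
            then show ?thesis using lny by (simp add: mult_right_mono)
          qed
          also have "2 * real r * (\<eta>1 * l + 3) * ln (1 / y) = c1 / 64 * l + 6 * real r * ln (1 / y)"
          proof -
            have "2 * real r * \<eta>1 * ln (1 / y) = c1 / 64" using lny assms unfolding \<eta>1_def by (simp only: field_simps) simp
            then have "2 * real r * \<eta>1 * ln (1 / y) * l = c1 / 64 * l" by simp
            then show ?thesis by (simp only: algebra_simps)
          qed
          finally show ?thesis .
        qed
        have T4: "exp (2 * y * total * exp \<rho> * NN + \<rho> * (real n ^ (r - 2) + 4)) \<le> exp (c1 / 64 * l + 5)"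
        proof -
          have "2 * y * total * exp \<rho> * NN = 2 * y * exp \<rho> * (total * NN)" by simp
          also have "\<dots> \<le> 2 * y * exp 1 * (Cp / c1 * l)"
            by (rule mult_mono) (use y lam1 totN total_nonneg NN0 in auto)
          also have "\<dots> = c1 / 64 * l" using c1 Cp by (simp add: y_def power2_eq_square)
          finally have "2 * y * total * exp \<rho> * NN \<le> c1 / 64 * l" .
          moreover have "\<rho> * (real n ^ (r - 2) + 4) \<le> 5" using lamk1 lam1 by (simp add: distrib_left)
          ultimately show ?thesis by simp
        qed
        have T5: "(3 + real r * NN * total) ^ 4 \<le> (3 + real r * Cp / c1 * l) ^ 4"
        proof (rule power_mono)
          have "real r * (total * NN) \<le> real r * (Cp / c1 * l)" using totN by (rule mult_left_mono) simp
          then show "3 + real r * NN * total \<le> 3 + real r * Cp / c1 * l" by (simp add: mult_ac)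
        qed (use total_nonneg NN0 in auto)
        have "(\<Sum>s\<in>V. exp (- \<rho> * real (card (star s)))) * exp (- \<rho> * (c1 * NN)) *
          ((1 / y ^ (2 * (r * (kk + 2))) * exp (2 * y * total * exp \<rho> * NN + \<rho> * (real n ^ (r - 2) + 4)))
            * real r * (3 + real r * NN * total) ^ 4)
          \<le> (exp (c1 / 64 * l) * exp (c1 / 64 * l)) * exp (- (c1 / 8) * l) *
          ((exp (c1 / 64 * l + 6 * real r * ln (1 / y)) * exp (c1 / 64 * l + 5)) * real r * (3 + real r * Cp / c1 * l) ^ 4)"
          using T1 T2 T3 T4 T5 y total_nonneg NN0 by (intro mult_mono order_refl) (auto intro!: sum_nonneg)
        also have "\<dots> = (exp (c1 / 64 * l) * exp (c1 / 64 * l) * exp (- (c1 / 8) * l) * exp (c1 / 64 * l + 6 * real r * ln (1 / y)) * exp (c1 / 64 * l + 5))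
          * (real r * (3 + real r * Cp / c1 * l) ^ 4)" by (simp only: mult_ac)
        \<comment> \<open>In units of \<open>c1 / 64\<close> the exponents of \<open>n\<close> are 1
          + 1 - 8 + 1 + 1 = -4.\<close>
        also have "exp (c1 / 64 * l) * exp (c1 / 64 * l) * exp (- (c1 / 8) * l) * exp (c1 / 64 * l + 6 * real r * ln (1 / y)) * exp (c1 / 64 * l + 5)
          = exp (6 * real r * ln (1 / y) + 5) * exp (- (c1 / 16) * l)"
          by (simp only: exp_add[symmetric]) (rule arg_cong[of _ _ exp], simp add: field_simps)
        also have "exp (6 * real r * ln (1 / y) + 5) * exp (- (c1 / 16) * l) * (real r * (3 + real r * Cp / c1 * l) ^ 4) = f3 n"
          by (simp add: f3_def K3_def l_def)
        finally show ?thesis .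
      qed
      have B5: "(real n + 3) * 4 ^ n * exp (- (\<delta> * \<rho>) * (\<theta> * real n ^ r)) * (1 / z ^ (5 * n + 5) * exp (z * total * (real (r\<^sup>2) * real n ^ r))) \<le> f5 n"
      proof -
        have U1: "- (\<delta> * \<rho>) * (\<theta> * real n ^ r) \<le> - (\<delta> * \<theta> / 8) * (real n * l)"
        proof -
          have "\<delta> * \<theta> * real n * (l / 8) \<le> \<delta> * \<theta> * real n * (\<rho> * NN)" using lo \<delta> \<theta> by (intro mult_left_mono) auto
          then show ?thesis unfolding NNn(2)[symmetric] by (simp add: mult_ac)
        qed
        have U2: "z * total * (real (r\<^sup>2) * real n ^ r) \<le> \<delta> * \<theta> / 16 * (real n * l)"
        proof -
          have "z * total * (real (r\<^sup>2) * real n ^ r) = z * (real r)\<^sup>2 * real n * (total * NN)"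
            unfolding NNn(2)[symmetric] by simp
          also have "\<dots> \<le> z * (real r)\<^sup>2 * real n * (Cp / c1 * l)" using totN z by (intro mult_left_mono) auto
          also have "\<dots> = z * ((real r)\<^sup>2 * (Cp / c1)) * (real n * l)" by simp
          also have "\<dots> \<le> \<delta> * \<theta> / 16 * (real n * l)" using z(3) l0 by (intro mult_right_mono) auto
          finally show ?thesis .
        qed
        have U3: "1 / z ^ (5 * n + 5) = exp (K5 * real n + K5)"
        proof -
          have "1 / z ^ (5 * n + 5) = exp (real (5 * n + 5) * ln (1 / z))"
            using z by (subst exp_of_nat_mult) (simp add: power_one_over)
          also have "real (5 * n + 5) * ln (1 / z) = K5 * real n + K5" by (simp add: K5_def algebra_simps)
          finally show ?thesis .
        qed
        have U4: "(4::real) ^ n = exp (ln 4 * real n)" by (simp add: exp_of_nat2_mult)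
        have "(real n + 3) * 4 ^ n * exp (- (\<delta> * \<rho>) * (\<theta> * real n ^ r)) * (1 / z ^ (5 * n + 5) * exp (z * total * (real (r\<^sup>2) * real n ^ r)))
          \<le> (real n + 3) * exp (ln 4 * real n) * exp (- (\<delta> * \<theta> / 8) * (real n * l)) * (exp (K5 * real n + K5) * exp (\<delta> * \<theta> / 16 * (real n * l)))"
        proof -
          have "exp (- (\<delta> * \<rho>) * (\<theta> * real n ^ r)) \<le> exp (- (\<delta> * \<theta> / 8) * (real n * l))"
            using U1 by (simp only: exp_le_cancel_iff)
          moreover have "exp (z * total * (real (r\<^sup>2) * real n ^ r)) \<le> exp (\<delta> * \<theta> / 16 * (real n * l))"
            using U2 by (simp only: exp_le_cancel_iff)
          ultimately show ?thesis unfolding U3 U4 by (intro mult_mono order_refl) auto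
        qed
        also have "\<dots> = (real n + 3) * (exp (ln 4 * real n) * exp (- (\<delta> * \<theta> / 8) * (real n * l)) * exp (K5 * real n + K5) * exp (\<delta> * \<theta> / 16 * (real n * l)))"
          by (simp only: mult.assoc)
        also have "exp (ln 4 * real n) * exp (- (\<delta> * \<theta> / 8) * (real n * l)) * exp (K5 * real n + K5) * exp (\<delta> * \<theta> / 16 * (real n * l))
          = exp (K4 * real n + K5 - \<delta> * \<theta> / 16 * (real n * l))"
          by (simp only: exp_add[symmetric]) (rule arg_cong[of _ _ exp], simp add: K4_def field_simps)
        finally show ?thesis by (simp add: f5_def l_def)
      qed
      have "1 - \<tau> \<le> 1 - (f1 n + (f2 n + (f3 n + (f4 n + f5 n))))" using big by linarith
      also have "\<dots> \<le> 1 - ((1 / (real n powr \<eta>) + (exp (\<mu>i * real n ^ (r - 2)) - 1))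
      + (real n * (2 * exp 1 * exp (- (C1 * \<rho>) * (c1 * NN) / 2))
      + ((\<Sum>s\<in>V. exp (- \<rho> * real (card (star s)))) * exp (- \<rho> * (c1 * NN)) *
          ((1 / y ^ (2 * (r * (kk + 2))) * exp (2 * y * total * exp \<rho> * NN + \<rho> * (real n ^ (r - 2) + 4)))
            * real r * (3 + real r * NN * total) ^ 4)
      + ((exp (1 / (real n)\<^sup>2) - 1)
      + (real n + 3) * 4 ^ n * exp (- (\<delta> * \<rho>) * (\<theta> * real n ^ r)) * (1 / z ^ (5 * n + 5) * exp (z * total * (real (r\<^sup>2) * real n ^ r)))))))"
        using B1 B2 B3 B5 by (intro diff_left_mono add_mono) (auto simp: f4_def)
      also have "\<dots> \<le> measure_pmf.prob (random_ordering E)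
        {\<sigma>. hitting_time (min_degree_at_least 2) V \<sigma> = hitting_time has_berge_hamilton_cycle V \<sigma>}"
        using prob_hitting_times_eq[OF c \<theta> refl refl d m1 y(1) less_imp_le[OF y(2)] z(1,2) less_imp_le[OF a]
            A2[unfolded NN_def] A3 theta S' Spos]
        by (simp only: NN_def)
      finally show ?thesis .
    qed
    show ?thesis by (intro exI[of _ n0] allI impI) (use main in auto)
  qed
qed

end
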